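(* Every subcubic outerplanar graph is $(1,2^5)$-packing edge-colorable, that is, its edge set can be partitioned into one matching and five induced matchings (classes may be empty).
   Context: Graphs are finite and simple. A graph is subcubic if its maximum degree is at most $3$. The distance between two distinct edges of a graph $G$ is their distance in the line graph of $G$, so edges sharing an endpoint are at distance $1$ (edges in different components are at infinite distance). For a non-decreasing sequence $S=(s_1,\dots,s_k)$ of positive integers, an $S$-packing edge-coloring of $G$ is a partition of $E(G)$ into (possibly empty) classes $E_1,\dots,E_k$ such that for each $i$ any two distinct edges in $E_i$ are at distance at least $s_i+1$. Exponents denote repetition: $(1,2^5)=(1,2,2,2,2,2)$. *)

theory Defs
  imports "HOL-Analysis.Analysis"
begin

section \<open>Finite simple graphs\<close>

text \<open>A graph is a vertex set together with a set of two-element sets of vertices.\<close>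

definition simple_graph :: "'a set \<Rightarrow> 'a set set \<Rightarrow> bool" where
  "simple_graph V E \<longleftrightarrow> finite V \<and> (\<forall>e\<in>E. e \<subseteq> V \<and> card e = 2)"

definition vdegree :: "'a set set \<Rightarrow> 'a \<Rightarrow> nat" where
  "vdegree E v = card {e \<in> E. v \<in> e}"

definition subcubic :: "'a set \<Rightarrow> 'a set set \<Rightarrow> bool" where
  "subcubic V E \<longleftrightarrow> (\<forall>v\<in>V. vdegree E v \<le> 3)"


section \<open>Outerplanarity\<close>

text \<open>The map \<open>p\<close> places the vertices in the plane and \<open>\<gamma>\<close> assigns to every edge a Jordan arc
  joining its two ends (in either direction).  Arcs of distinct edges meet only in the images of
  common ends, and no arc passes through the image of a vertex that is not one of its ends.\<close>

definition plane_drawing ::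
    "'a set \<Rightarrow> 'a set set \<Rightarrow> ('a \<Rightarrow> complex) \<Rightarrow> ('a set \<Rightarrow> real \<Rightarrow> complex) \<Rightarrow> bool" where
  "plane_drawing V E p \<gamma> \<longleftrightarrow>
     inj_on p V \<and>
     (\<forall>e\<in>E. arc (\<gamma> e) \<and> {pathstart (\<gamma> e), pathfinish (\<gamma> e)} = p ` e) \<and>
     (\<forall>e\<in>E. \<forall>v\<in>V. p v \<in> path_image (\<gamma> e) \<longrightarrow> v \<in> e) \<and>
     (\<forall>e\<in>E. \<forall>f\<in>E. e \<noteq> f \<longrightarrow> path_image (\<gamma> e) \<inter> path_image (\<gamma> f) \<subseteq> p ` (e \<inter> f))"

definition drawn_set ::
    "'a set \<Rightarrow> 'a set set \<Rightarrow> ('a \<Rightarrow> complex) \<Rightarrow> ('a set \<Rightarrow> real \<Rightarrow> complex) \<Rightarrow> complex set" where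
  "drawn_set V E p \<gamma> = p ` V \<union> (\<Union>e\<in>E. path_image (\<gamma> e))"

text \<open>For a finite graph the drawn set is compact, so \<open>outside\<close> of it, the union of the unbounded
  components of its complement, is the unbounded face.\<close>

definition outerplanar :: "'a set \<Rightarrow> 'a set set \<Rightarrow> bool" where
  "outerplanar V E \<longleftrightarrow>
     (\<exists>p \<gamma>. plane_drawing V E p \<gamma> \<and> p ` V \<subseteq> frontier (outside (drawn_set V E p \<gamma>)))"


section \<open>Distance between edges\<close>

definition walk :: "'a set \<Rightarrow> 'a set set \<Rightarrow> 'a list \<Rightarrow> bool" where
  "walk V E xs \<longleftrightarrow> xs \<noteq> [] \<and> set xs \<subseteq> V \<and> successively (\<lambda>u v. {u, v} \<in> E) xs"

text \<open>The infimum over the empty set is \<open>\<infinity>\<close>, which is the distance of vertices in different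
  components.\<close>

definition graph_dist :: "'a set \<Rightarrow> 'a set set \<Rightarrow> 'a \<Rightarrow> 'a \<Rightarrow> enat" where
  "graph_dist V E u v =
     Inf {enat (length xs - 1) | xs. walk V E xs \<and> hd xs = u \<and> last xs = v}"

text \<open>The line graph has vertex set \<open>E\<close> and the following edge set.\<close>

definition line_graph_edges :: "'a set set \<Rightarrow> 'a set set set" where
  "line_graph_edges E = {{e, f} | e f. e \<in> E \<and> f \<in> E \<and> e \<noteq> f \<and> e \<inter> f \<noteq> {}}"

definition edge_dist :: "'a set set \<Rightarrow> 'a set \<Rightarrow> 'a set \<Rightarrow> enat" where
  "edge_dist E = graph_dist E (line_graph_edges E)"


section \<open>Packing edge-colorings\<close>

text \<open>The sequence \<open>S\<close> is a list, so classes are indexed from 0.\<close>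

definition packing_edge_coloring :: "nat list \<Rightarrow> 'a set set \<Rightarrow> (nat \<Rightarrow> 'a set set) \<Rightarrow> bool" where
  "packing_edge_coloring S E P \<longleftrightarrow>
     (\<Union>i<length S. P i) = E \<and>
     disjoint_family_on P {..<length S} \<and>
     (\<forall>i<length S. \<forall>e\<in>P i. \<forall>f\<in>P i. e \<noteq> f \<longrightarrow> enat (S ! i + 1) \<le> edge_dist E e f)"

definition packing_edge_colorable :: "nat list \<Rightarrow> 'a set set \<Rightarrow> bool" where
  "packing_edge_colorable S E \<longleftrightarrow> (\<exists>P. packing_edge_coloring S E P)"


section \<open>Matchings and induced matchings as color classes\<close>

definition matching :: "'a set set \<Rightarrow> bool" where
  "matching M \<longleftrightarrow> (\<forall>e\<in>M. \<forall>f\<in>M. e \<noteq> f \<longrightarrow> e \<inter> f = {})"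

definition induced_matching :: "'a set set \<Rightarrow> 'a set set \<Rightarrow> bool" where
  "induced_matching E M \<longleftrightarrow> matching M \<and> {e \<in> E. e \<subseteq> \<Union>M} = M"

lemma line_graph_edge_iff:
  "{e, f} \<in> line_graph_edges E \<longleftrightarrow> e \<in> E \<and> f \<in> E \<and> e \<noteq> f \<and> e \<inter> f \<noteq> {}"
  unfolding line_graph_edges_def by (auto simp: doubleton_eq_iff)

lemma edge_dist_ge_iff:
  "enat k \<le> edge_dist E e f \<longleftrightarrow>
     (\<forall>xs. walk E (line_graph_edges E) xs \<and> hd xs = e \<and> last xs = f \<longrightarrow> k \<le> length xs - 1)"
  unfolding edge_dist_def graph_dist_def le_Inf_iff by auto

lemma edge_dist_ge_2_iff:
  assumes "e \<in> E" "f \<in> E" "e \<noteq> f"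
  shows "enat 2 \<le> edge_dist E e f \<longleftrightarrow> e \<inter> f = {}"
proof
  assume *: "enat 2 \<le> edge_dist E e f"
  show "e \<inter> f = {}"
  proof (rule ccontr)
    assume "e \<inter> f \<noteq> {}"
    then have "walk E (line_graph_edges E) [e, f]"
      using assms by (simp add: walk_def line_graph_edge_iff)
    with * show False unfolding edge_dist_ge_iff by fastforce
  qed
next
  assume *: "e \<inter> f = {}"
  show "enat 2 \<le> edge_dist E e f"
    unfolding edge_dist_ge_iff
  proof (intro allI impI)
    fix xs assume xs: "walk E (line_graph_edges E) xs \<and> hd xs = e \<and> last xs = f"
    show "2 \<le> length xs - 1"
    proof (rule ccontr)
      assume "\<not> 2 \<le> length xs - 1"
      then consider "xs = []" | a where "xs = [a]" | a b where "xs = [a, b]"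
        by (cases xs; cases "tl xs"; cases "tl (tl xs)") auto
      then show False
        using xs * assms by cases (auto simp: walk_def line_graph_edge_iff)
    qed
  qed
qed

lemma edge_dist_ge_3_iff:
  assumes "e \<in> E" "f \<in> E" "e \<noteq> f"
  shows "enat 3 \<le> edge_dist E e f \<longleftrightarrow> e \<inter> f = {} \<and> (\<forall>g\<in>E. e \<inter> g = {} \<or> g \<inter> f = {})"
proof
  assume *: "enat 3 \<le> edge_dist E e f"
  then have "enat 2 \<le> edge_dist E e f"
    by (rule order_trans[rotated]) simp
  then have disj: "e \<inter> f = {}"
    using edge_dist_ge_2_iff[OF assms] by simp
  moreover have "e \<inter> g = {} \<or> g \<inter> f = {}" if "g \<in> E" for g
  proof (rule ccontr)
    assume "\<not> (e \<inter> g = {} \<or> g \<inter> f = {})"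
    then have "walk E (line_graph_edges E) [e, g, f]"
      using assms that disj by (auto simp: walk_def line_graph_edge_iff)
    with * show False unfolding edge_dist_ge_iff by fastforce
  qed
  ultimately show "e \<inter> f = {} \<and> (\<forall>g\<in>E. e \<inter> g = {} \<or> g \<inter> f = {})" by blast
next
  assume *: "e \<inter> f = {} \<and> (\<forall>g\<in>E. e \<inter> g = {} \<or> g \<inter> f = {})"
  have ge2: "enat 2 \<le> edge_dist E e f"
    using edge_dist_ge_2_iff[OF assms] * by simp
  show "enat 3 \<le> edge_dist E e f"
    unfolding edge_dist_ge_iff
  proof (intro allI impI)
    fix xs assume xs: "walk E (line_graph_edges E) xs \<and> hd xs = e \<and> last xs = f"
    show "3 \<le> length xs - 1"
    proof (rule ccontr)
      assume "\<not> 3 \<le> length xs - 1"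
      moreover have "2 \<le> length xs - 1"
        using ge2 xs unfolding edge_dist_ge_iff by blast
      ultimately have "length xs = 3" by linarith
      then obtain a b c where "xs = [a, b, c]"
        by (auto simp: numeral_3_eq_3 length_Suc_conv)
      then show False
        using xs * by (auto simp: walk_def line_graph_edge_iff)
    qed
  qed
qed

lemma matching_iff_edge_dist:
  assumes "M \<subseteq> E"
  shows "matching M \<longleftrightarrow> (\<forall>e\<in>M. \<forall>f\<in>M. e \<noteq> f \<longrightarrow> enat 2 \<le> edge_dist E e f)"
proof -
  have "enat 2 \<le> edge_dist E e f \<longleftrightarrow> e \<inter> f = {}" if "e \<in> M" "f \<in> M" "e \<noteq> f" for e f
    using that assms by (intro edge_dist_ge_2_iff) auto
  then show ?thesis unfolding matching_def by simp
qed

lemma induced_matching_iff_edge_dist: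
  assumes "simple_graph V E" "M \<subseteq> E"
  shows "induced_matching E M \<longleftrightarrow> (\<forall>e\<in>M. \<forall>f\<in>M. e \<noteq> f \<longrightarrow> enat 3 \<le> edge_dist E e f)"
    (is "_ \<longleftrightarrow> ?R")
proof
  assume ind: "induced_matching E M"
  show ?R
  proof (intro ballI impI)
    fix e f assume ef: "e \<in> M" "f \<in> M" "e \<noteq> f"
    then have disj: "e \<inter> f = {}"
      using ind unfolding induced_matching_def matching_def by blast
    have "e \<inter> g = {} \<or> g \<inter> f = {}" if "g \<in> E" for g
    proof (rule ccontr)
      assume "\<not> (e \<inter> g = {} \<or> g \<inter> f = {})"
      then obtain a b where ab: "a \<in> e" "a \<in> g" "b \<in> g" "b \<in> f" by blast
      have "card g = 2" using assms that unfolding simple_graph_def by blast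
      then have "g = {a, b}"
        using ab disj by (auto simp: card_2_iff)
      then have "g \<subseteq> \<Union>M" using ab ef by blast
      then have "g \<in> M" using ind that unfolding induced_matching_def by blast
      moreover have "\<And>h. h \<in> M \<Longrightarrow> h \<noteq> g \<Longrightarrow> h \<inter> g = {}"
        using ind \<open>g \<in> M\<close> unfolding induced_matching_def matching_def by simp
      ultimately have "e = g" "f = g" using ab ef(1,2) by auto
      then show False using ef(3) by simp
    qed
    then show "enat 3 \<le> edge_dist E e f"
      using edge_dist_ge_3_iff[of e E f] ef disj assms(2) by blast
  qed
next
  assume R: ?R
  have far: "e \<inter> f = {} \<and> (\<forall>g\<in>E. e \<inter> g = {} \<or> g \<inter> f = {})"
    if "e \<in> M" "f \<in> M" "e \<noteq> f" for e f
  proof -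
    have "e \<in> E" "f \<in> E" using that assms(2) by auto
    moreover have "enat 3 \<le> edge_dist E e f" using R that by simp
    ultimately show ?thesis using edge_dist_ge_3_iff[of e E f] that(3) by simp
  qed
  have "g \<in> M" if g: "g \<in> E" "g \<subseteq> \<Union>M" for g
  proof -
    have cg: "card g = 2" using assms g unfolding simple_graph_def by blast
    then obtain a b where ab: "g = {a, b}" by (auto simp: card_2_iff)
    then obtain e f where ef: "e \<in> M" "f \<in> M" "a \<in> e" "b \<in> f" using g by blast
    have "e = f"
    proof (rule ccontr)
      assume "e \<noteq> f"
      then have "e \<inter> g = {} \<or> g \<inter> f = {}" using far[of e f] ef(1,2) g(1) by simp
      then show False using ab ef(3,4) by auto
    qed
    then have "g \<subseteq> e" using ab ef by blast
    moreover have "card e = 2" using assms ef unfolding simple_graph_def by blast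
    ultimately have "g = e"
      using cg by (intro card_subset_eq) (auto intro: card_ge_0_finite)
    then show ?thesis using ef by simp
  qed
  then have "{e \<in> E. e \<subseteq> \<Union>M} = M" using assms(2) by auto
  moreover have "matching M" unfolding matching_def using far by simp
  ultimately show "induced_matching E M" by (simp add: induced_matching_def)
qed

lemma packing_edge_coloring_1_2_5_iff:
  assumes "simple_graph V E"
  shows "packing_edge_coloring (1 # replicate 5 2) E P \<longleftrightarrow>
    (\<Union>i<6. P i) = E \<and> disjoint_family_on P {..<6} \<and>
    matching (P 0) \<and> (\<forall>i\<in>{1..5}. induced_matching E (P i))"
proof (cases "(\<Union>i<6. P i) = E")
  case True
  then have sub: "P i \<subseteq> E" if "i < 6" for i using that by blast
  have zero_or: "(\<forall>i<6. Q i) \<longleftrightarrow> Q 0 \<and> (\<forall>i\<in>{1..5}. Q i)" for Q :: "nat \<Rightarrow> bool"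
  proof -
    have "{..<6} = insert 0 {1..5::nat}" by auto
    then have "(\<forall>i\<in>{..<6}. Q i) \<longleftrightarrow> Q 0 \<and> (\<forall>i\<in>{1..5}. Q i)" by (simp only: ball_simps)
    then show ?thesis by (simp only: Ball_def lessThan_iff)
  qed
  have nth: "(1 # replicate 5 2) ! i + 1 = (3::nat)" if "i \<in> {1..5}" for i
    using that by (cases i) auto
  have nth0: "(1 # replicate 5 2) ! 0 + 1 = (2::nat)" by simp
  have len: "length (1 # replicate 5 (2::nat)) = 6" by simp
  have m: "matching (P 0) \<longleftrightarrow> (\<forall>e\<in>P 0. \<forall>f\<in>P 0. e \<noteq> f \<longrightarrow> enat 2 \<le> edge_dist E e f)"
    by (rule matching_iff_edge_dist) (simp add: sub)
  have im: "induced_matching E (P i) \<longleftrightarrow>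
      (\<forall>e\<in>P i. \<forall>f\<in>P i. e \<noteq> f \<longrightarrow> enat 3 \<le> edge_dist E e f)" if "i \<in> {1..5}" for i
    by (rule induced_matching_iff_edge_dist[OF assms]) (use sub that in simp)
  show ?thesis
    unfolding packing_edge_coloring_def len zero_or nth0 m
    by (simp only: nth im cong: ball_cong)
next
  case False
  then show ?thesis by (simp add: packing_edge_coloring_def)
qed

end

theory Submission
  imports Defs "HOL-Complex_Analysis.Winding_Numbers"
begin

text \<open>The colouring is built by induction on the number of edges.  Let \<open>H\<close> be the graph without its
  pendant edges.  If \<open>H\<close> has a vertex of degree at most 1, some pendant edge has at most four edges
  within distance 2 and is coloured last.  Otherwise outerplanarity provides in \<open>H\<close> two adjacent
  vertices \<open>x\<close>, \<open>y\<close> of degree 2, or a triangle \<open>t\<close>, \<open>x\<close>, \<open>y\<close> with \<open>t\<close> of degree 2.  Let \<open>w\<close> and \<open>z\<close> be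
  the further neighbours of \<open>x\<close> and \<open>y\<close>.  If \<open>w = z\<close>, delete \<open>x\<close> and \<open>y\<close>.  Otherwise
  drop the pendant edges (and \<open>t\<close>) there and suppress \<open>y\<close>: this gives a smaller outerplanar graph, in
  which \<open>{x, z}\<close> stands for \<open>{y, z}\<close>, and its colouring extends once \<open>{w, x}\<close> and \<open>{y, z}\<close> are moved to
  the matching whenever this is possible.

  Outerplanarity enters through theta curves: of three arcs with common ends, one is enclosed by the
  other two, so in an outerplanar graph one of them has no inner vertex, and chords of a cycle do
  not cross.\<close>

section \<open>Theta curves\<close>

text \<open>Suppression rather than deletion is what makes the colours fit. If \<open>x\<close> and
  \<open>y\<close> were merely deleted, \<open>{w, x}\<close> and \<open>{y, z}\<close> could each
  have six coloured edges within distance 2, too many for five colours. So if both edges move to the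
  matching, an old colour becomes free for \<open>{x, y}\<close>. All further colours exist because
  at most four of the five induced-matching colours are forbidden. For \<open>w = z\<close>
  suppression would create parallel edges, but then \<open>w\<close> has at most one other edge, and
  both edges at \<open>w\<close> can be coloured afresh.

  Pendant edges are set aside because the structural part rests on minimum degree 2; a vertex of
  degree 2 in \<open>H\<close> has at most one of them. Since \<open>H\<close> may have bridges, the
  configuration is sought in a piece attached by at most one edge, and there the degree bound 3
  makes a longest cycle span the piece.\<close>

lemma arc_inside_or_disjoint_inside:
  fixes c1 c2 c3 :: "real \<Rightarrow> complex"
  assumes "arc c3" "pathstart c3 = a" "pathfinish c3 = b"
    and "path_image c3 \<inter> (path_image c1 \<union> path_image c2) \<subseteq> {a, b}"
  shows "path_image c3 - {a, b} \<subseteq> inside (path_image c1 \<union> path_image c2) \<or>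
    (path_image c3 - {a, b}) \<inter> inside (path_image c1 \<union> path_image c2) = {}"
proof -
  let ?C = "path_image c1 \<union> path_image c2"
  have con: "connected (path_image c3 - {a, b})"
    using connected_simple_path_endless[of c3] assms arc_imp_simple_path by auto
  have sub: "path_image c3 - {a, b} \<subseteq> - ?C" using assms(4) by blast
  show ?thesis
  proof (cases "(path_image c3 - {a, b}) \<inter> inside ?C = {}")
    case False
    then obtain z where z: "z \<in> path_image c3 - {a, b}" "z \<in> inside ?C" by blast
    have "path_image c3 - {a, b} \<subseteq> inside ?C"
    proof
      fix w assume w: "w \<in> path_image c3 - {a, b}"
      \<comment> \<open>The open arc is connected and misses \<open>?C\<close>, so it lies in a
        single component of the complement, and \<open>inside\<close> is a union of such
        components.\<close>
      have "connected_component (- ?C) z w"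
        unfolding connected_component_def using con sub z w by blast
      then show "w \<in> inside ?C"
        using inside_same_component z(2) by blast
    qed
    then show ?thesis by blast
  qed blast
qed

lemma simple_path_arc_loop:
  fixes c1 c2 :: "real \<Rightarrow> complex"
  assumes "arc c1" "pathstart c1 = a" "pathfinish c1 = b"
    and "arc c2" "pathstart c2 = a" "pathfinish c2 = b"
    and "path_image c1 \<inter> path_image c2 \<subseteq> {a, b}"
  shows "simple_path (c1 +++ reversepath c2)"
  using assms by (intro simple_path_join_loop) (auto simp: arc_reversepath)

lemma winding_number_arc_loop:
  fixes c1 c2 :: "real \<Rightarrow> complex"
  assumes "arc c1" "pathstart c1 = a" "pathfinish c1 = b"
    and "arc c2" "pathstart c2 = a" "pathfinish c2 = b"
    and "z \<notin> path_image c1" "z \<notin> path_image c2"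
  shows "winding_number (c1 +++ reversepath c2) z = winding_number c1 z - winding_number c2 z"
  using assms by (simp add: winding_number_join winding_number_reversepath arc_imp_path)

text \<open>The loop of two arcs is a Jordan curve, with winding number of norm 1 inside and 0
  outside, and this number is the difference of those of the arcs. Being enclosed thus becomes
  inequality of two complex numbers, which can be compared across three arcs.\<close>

lemma winding_number_arc_loop_eq_0_iff:
  fixes c1 c2 :: "real \<Rightarrow> complex"
  assumes "arc c1" "pathstart c1 = a" "pathfinish c1 = b"
    and "arc c2" "pathstart c2 = a" "pathfinish c2 = b"
    and "path_image c1 \<inter> path_image c2 \<subseteq> {a, b}"
    and "z \<notin> path_image c1" "z \<notin> path_image c2"
  shows "winding_number c1 z = winding_number c2 z \<longleftrightarrow> z \<notin> inside (path_image c1 \<union> path_image c2)"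
proof -
  let ?L = "c1 +++ reversepath c2"
  have sp: "simple_path ?L" using simple_path_arc_loop assms by blast
  have im: "path_image ?L = path_image c1 \<union> path_image c2"
    using assms by (simp add: path_image_join)
  have cl: "pathfinish ?L = pathstart ?L" using assms by simp
  have wn: "winding_number ?L z = winding_number c1 z - winding_number c2 z"
    using winding_number_arc_loop assms by blast
  show ?thesis
  proof (cases "z \<in> inside (path_image c1 \<union> path_image c2)")
    case True
    then have "winding_number ?L z \<noteq> 0"
      using simple_closed_path_norm_winding_number_inside[OF sp] im by fastforce
    then show ?thesis using wn True by simp
  next
    case False
    then have "z \<in> outside (path_image ?L)"
      using assms(8,9) im unfolding outside_inside by simp
    then have "winding_number ?L z = 0"
      using winding_number_zero_in_outside sp cl simple_path_imp_path by blast
    then show ?thesis using wn False by simp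
  qed
qed

text \<open>Two of the three loops of a theta curve enclose a common point, because winding numbers add
  up; if no arc were enclosed by the other two, these loops would have the same inside.\<close>

lemma theta_overlap_contradiction:
  fixes c1 c2 c3 :: "real \<Rightarrow> complex"
  assumes c1: "arc c1" "pathstart c1 = a" "pathfinish c1 = b"
    and c2: "arc c2" "pathstart c2 = a" "pathfinish c2 = b"
    and c3: "arc c3" "pathstart c3 = a" "pathfinish c3 = b"
    and i12: "path_image c1 \<inter> path_image c2 \<subseteq> {a, b}"
    and i13: "path_image c1 \<inter> path_image c3 \<subseteq> {a, b}"
    and i23: "path_image c2 \<inter> path_image c3 \<subseteq> {a, b}"
    and n3: "(path_image c3 - {a, b}) \<inter> inside (path_image c1 \<union> path_image c2) = {}"
    and n1: "(path_image c1 - {a, b}) \<inter> inside (path_image c2 \<union> path_image c3) = {}"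
    and z: "z \<in> inside (path_image c1 \<union> path_image c2)" "z \<in> inside (path_image c2 \<union> path_image c3)"
  shows False
proof -
  let ?A = "path_image c1 \<union> path_image c2" and ?B = "path_image c2 \<union> path_image c3"
  have spA: "simple_path (c1 +++ reversepath c2)" using simple_path_arc_loop c1 c2 i12 by blast
  have spB: "simple_path (c2 +++ reversepath c3)" using simple_path_arc_loop c2 c3 i23 by blast
  have imA: "path_image (c1 +++ reversepath c2) = ?A" using c1 c2 by (simp add: path_image_join)
  have imB: "path_image (c2 +++ reversepath c3) = ?B" using c2 c3 by (simp add: path_image_join)
  have clA: "pathfinish (c1 +++ reversepath c2) = pathstart (c1 +++ reversepath c2)" using c1 c2 by simp
  have clB: "pathfinish (c2 +++ reversepath c3) = pathstart (c2 +++ reversepath c3)" using c2 c3 by simp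
  have JA: "connected (inside ?A)" "frontier (inside ?A) = ?A"
    using Jordan_inside_outside[OF spA clA] unfolding imA by blast+
  have JB: "connected (inside ?B)" "frontier (inside ?B) = ?B"
    using Jordan_inside_outside[OF spB clB] unfolding imB by blast+
  have ab: "{a, b} \<subseteq> ?A" "{a, b} \<subseteq> ?B"
    using c2 pathstart_in_path_image[of c2] pathfinish_in_path_image[of c2] by auto
  have dA: "inside ?A \<inter> ?A = {}" and dB: "inside ?B \<inter> ?B = {}"
    using inside_no_overlap by blast+
  \<comment> \<open>A connected inside that avoids \<open>Y\<close> lies in one component of the
    complement of \<open>Y\<close>; the common point \<open>z\<close> decides in which.\<close>
  have sub: "inside X \<subseteq> inside Y"
    if "connected (inside X)" "inside X \<inter> Y = {}" "z \<in> inside X" "z \<in> inside Y" for X Y :: "complex set"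
  proof
    fix w assume "w \<in> inside X"
    then have "connected_component (- Y) z w"
      unfolding connected_component_def using that by blast
    then show "w \<in> inside Y" using inside_same_component that(4) by blast
  qed
  have "inside ?A \<inter> ?B = {}" using n3 ab dA by blast
  moreover have "inside ?B \<inter> ?A = {}" using n1 ab dB by blast
  ultimately have "inside ?A = inside ?B"
    using sub[of ?A ?B] sub[of ?B ?A] JA(1) JB(1) z by (intro equalityI) simp_all
  \<comment> \<open>By Jordan's theorem each curve is the frontier of its inside, so equal insides
    force the inner points of \<open>c1\<close> onto \<open>c2\<close> or \<open>c3\<close>.\<close>
  then have "?A = ?B" using JA(2) JB(2) by metis
  moreover have "path_image c1 - {a, b} \<noteq> {}"
    using nonempty_simple_path_endless[of c1] c1 arc_imp_simple_path by auto
  ultimately show False using i12 i13 by blast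
qed

lemma theta_middle:
  fixes c1 c2 c3 :: "real \<Rightarrow> complex"
  assumes c1: "arc c1" "pathstart c1 = a" "pathfinish c1 = b"
    and c2: "arc c2" "pathstart c2 = a" "pathfinish c2 = b"
    and c3: "arc c3" "pathstart c3 = a" "pathfinish c3 = b"
    and i12: "path_image c1 \<inter> path_image c2 \<subseteq> {a, b}"
    and i13: "path_image c1 \<inter> path_image c3 \<subseteq> {a, b}"
    and i23: "path_image c2 \<inter> path_image c3 \<subseteq> {a, b}"
  shows "path_image c1 - {a, b} \<subseteq> inside (path_image c2 \<union> path_image c3) \<or>
    path_image c2 - {a, b} \<subseteq> inside (path_image c1 \<union> path_image c3) \<or>
    path_image c3 - {a, b} \<subseteq> inside (path_image c1 \<union> path_image c2)"
proof (rule ccontr)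
  assume neg: "\<not> ?thesis"
  have n1: "(path_image c1 - {a, b}) \<inter> inside (path_image c2 \<union> path_image c3) = {}"
    using arc_inside_or_disjoint_inside[OF c1, of c2 c3] i12 i13 neg by blast
  have n2: "(path_image c2 - {a, b}) \<inter> inside (path_image c1 \<union> path_image c3) = {}"
    using arc_inside_or_disjoint_inside[OF c2, of c1 c3] i12 i23 neg by blast
  have n3: "(path_image c3 - {a, b}) \<inter> inside (path_image c1 \<union> path_image c2) = {}"
    using arc_inside_or_disjoint_inside[OF c3, of c1 c2] i13 i23 neg by blast
  have sp: "simple_path (c1 +++ reversepath c2)" using simple_path_arc_loop c1 c2 i12 by blast
  have im: "path_image (c1 +++ reversepath c2) = path_image c1 \<union> path_image c2"
    using c1 c2 by (simp add: path_image_join)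
  have "inside (path_image c1 \<union> path_image c2) \<noteq> {}"
    using Jordan_inside_outside[OF sp] im c1 c2 by simp
  then obtain z where z: "z \<in> inside (path_image c1 \<union> path_image c2)" by blast
  have z12: "z \<notin> path_image c1" "z \<notin> path_image c2" using z inside_no_overlap by blast+
  have z3: "z \<notin> path_image c3"
    using n3 z z12 c1 pathstart_in_path_image[of c1] pathfinish_in_path_image[of c1] by blast
  have "winding_number c1 z \<noteq> winding_number c2 z"
    using winding_number_arc_loop_eq_0_iff[OF c1 c2 i12 z12] z by blast
  \<comment> \<open>The winding numbers of \<open>c1\<close> and \<open>c2\<close> around
    \<open>z\<close> differ, so that of \<open>c3\<close> differs from at least one of them.\<close>
  then consider "z \<in> inside (path_image c2 \<union> path_image c3)" | "z \<in> inside (path_image c1 \<union> path_image c3)"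
    using winding_number_arc_loop_eq_0_iff[OF c2 c3 i23 z12(2) z3]
      winding_number_arc_loop_eq_0_iff[OF c1 c3 i13 z12(1) z3] by argo
  then show False
  proof cases
    case 1
    show False
      using theta_overlap_contradiction[OF c1 c2 c3 i12 i13 i23 n3 n1 z 1] .
  next
    case 2
    \<comment> \<open>Here \<open>c1\<close> is the arc common to both loops, so it trades places
      with \<open>c2\<close>.\<close>
    show False
      using theta_overlap_contradiction[OF c2 c1 c3 _ i23 i13 _ n2 _ 2] i12 n3 z
      by (simp add: Int_commute Un_commute)
  qed
qed

text \<open>The chord \<open>c3\<close> splits the inside of \<open>c1\<close> and \<open>c2\<close> into two regions, and \<open>c4\<close> would have to stay
  in one of them, but no region has both ends of \<open>c4\<close> on its boundary.\<close>

lemma inner_chords_cross: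
  fixes c1 c2 c3 c4 :: "real \<Rightarrow> complex"
  assumes c1: "arc c1" "pathstart c1 = a" "pathfinish c1 = b"
    and c2: "arc c2" "pathstart c2 = a" "pathfinish c2 = b"
    and c3: "arc c3" "pathstart c3 = a" "pathfinish c3 = b"
    and i12: "path_image c1 \<inter> path_image c2 \<subseteq> {a, b}"
    and i13: "path_image c1 \<inter> path_image c3 \<subseteq> {a, b}"
    and i23: "path_image c2 \<inter> path_image c3 \<subseteq> {a, b}"
    and c4: "arc c4" "pathstart c4 = u" "pathfinish c4 = v"
    and u: "u \<in> path_image c1" "u \<notin> path_image c2"
    and v: "v \<in> path_image c2" "v \<notin> path_image c1"
    and ins3: "path_image c3 - {a, b} \<subseteq> inside (path_image c1 \<union> path_image c2)"
    and ins4: "path_image c4 - {u, v} \<subseteq> inside (path_image c1 \<union> path_image c2)"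
    and i34: "path_image c3 \<inter> path_image c4 = {}"
  shows False
proof -
  have sp: "simple_path c1" "simple_path c2" "simple_path c3"
    using c1 c2 c3 arc_imp_simple_path by auto
  have "a \<noteq> b" using c1 arc_distinct_ends by blast
  have ab: "a \<in> path_image c" "b \<in> path_image c" if "c \<in> {c1, c2, c3}" for c
    using that c1 c2 c3 pathstart_in_path_image[of c] pathfinish_in_path_image[of c] by auto
  have e12: "path_image c1 \<inter> path_image c2 = {a, b}" using i12 ab by blast
  have e13: "path_image c1 \<inter> path_image c3 = {a, b}" using i13 ab by blast
  have e23: "path_image c2 \<inter> path_image c3 = {a, b}" using i23 ab by blast
  have "path_image c3 - {a, b} \<noteq> {}"
    using nonempty_simple_path_endless[of c3] c3 sp by auto
  then have ne: "path_image c3 \<inter> inside (path_image c1 \<union> path_image c2) \<noteq> {}" using ins3 by blast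
  let ?I1 = "inside (path_image c1 \<union> path_image c3)"
  let ?I2 = "inside (path_image c2 \<union> path_image c3)"
  let ?I = "inside (path_image c1 \<union> path_image c2)"
  have split: "?I1 \<inter> ?I2 = {}" "?I1 \<union> ?I2 \<union> (path_image c3 - {a, b}) = ?I"
    using split_inside_simple_closed_curve[OF sp(1) c1(2,3) sp(2) c2(2,3) sp(3) c3(2,3) \<open>a \<noteq> b\<close> e12 e13 e23 ne]
    by metis+
  have uv: "{u, v} \<subseteq> path_image c1 \<union> path_image c2" using u v by blast
  then have uvI: "u \<notin> ?I" "v \<notin> ?I" using inside_no_overlap by blast+
  let ?O = "path_image c4 - {u, v}"
  have Osub: "?O \<subseteq> ?I1 \<union> ?I2" using ins4 split(2) i34 by blast
  have con: "connected ?O"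
    using connected_simple_path_endless[of c4] c4 arc_imp_simple_path by auto
  have Jop: "open ?I1" "open ?I2"
    by (intro open_inside closed_Un closed_path_image arc_imp_path c1 c2 c3)+
  have cl: "path_image c4 \<subseteq> closure ?O"
  proof -
    have "c4 ` closure {0<..<1} \<subseteq> closure (c4 ` {0<..<1})"
      using arc_imp_path[OF c4(1)] by (intro image_closure_subset) (auto simp: path_def closure_subset)
    moreover have "c4 ` {0<..<1} = ?O"
      using simple_path_endless[of c4] c4 arc_imp_simple_path by auto
    ultimately show ?thesis by (simp add: path_image_def)
  qed
  \<comment> \<open>The closure of the open arc contains \<open>u\<close> and \<open>v\<close>. If
    the arc stayed in the region bounded by \<open>c\<close> and \<open>c3\<close>, the end on the
    other boundary arc would have nowhere to be: it is not on \<open>c\<close>, not on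
    \<open>c3\<close> because \<open>c3\<close> and \<open>c4\<close> are disjoint, and not
    inside.\<close>
  have *: False if "?O \<subseteq> inside (path_image c \<union> path_image c3)" "c = c1 \<or> c = c2" for c
  proof -
    have "closed (path_image c \<union> path_image c3)"
      using that c1 c2 c3 by (intro closed_Un closed_path_image) (auto simp: arc_imp_path)
    then have "closure (inside (path_image c \<union> path_image c3)) \<subseteq>
        path_image c \<union> path_image c3 \<union> inside (path_image c \<union> path_image c3)"
      using closure_inside_subset by (metis Un_commute)
    moreover have "inside (path_image c \<union> path_image c3) \<subseteq> ?I" using split(2) that(2) by blast
    ultimately have "path_image c4 \<subseteq> path_image c \<union> path_image c3 \<union> ?I"
      using cl closure_mono[OF that(1)] by blast
    moreover have "{u, v} \<subseteq> path_image c4" using c4 pathstart_in_path_image pathfinish_in_path_image by blast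
    ultimately show False using uvI u v i34 that(2) by blast
  qed
  show False
  proof (cases "?O \<inter> ?I1 = {}")
    case True
    then show ?thesis using *[of c2] Osub by blast
  next
    case False
    then have "?O \<inter> ?I2 = {}"
      using connectedD[OF con Jop] split(1) Osub by blast
    then show ?thesis using *[of c1] Osub by blast
  qed
qed

section \<open>Paths and cycles\<close>

definition segment_edges :: "(nat \<Rightarrow> 'a) \<Rightarrow> nat \<Rightarrow> nat \<Rightarrow> 'a set set" where
  "segment_edges c i j = (\<lambda>k. {c k, c (Suc k)}) ` {i..<j}"

text \<open>A path is an index interval of a function rather than a list, so that the arcs of a
  periodic cycle, including those that pass the end of the period, are paths without
  reindexing.\<close>

definition graph_path :: "'a set set \<Rightarrow> (nat \<Rightarrow> 'a) \<Rightarrow> nat \<Rightarrow> nat \<Rightarrow> bool" where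
  "graph_path E c i j \<longleftrightarrow> i < j \<and> inj_on c {i..j} \<and> segment_edges c i j \<subseteq> E"

text \<open>Cycles of length \<open>n\<close> are given by functions of period \<open>n\<close>, so that each arc of the cycle
  is a segment of the function.\<close>

definition graph_cycle :: "'a set set \<Rightarrow> nat \<Rightarrow> (nat \<Rightarrow> 'a) \<Rightarrow> bool" where
  "graph_cycle E n c \<longleftrightarrow> 3 \<le> n \<and> (\<forall>k. c (k + n) = c k) \<and> inj_on c {..<n} \<and>
     (\<forall>k. {c k, c (Suc k)} \<in> E)"

lemma Union_segment_edges: "i < j \<Longrightarrow> \<Union>(segment_edges c i j) = c ` {i..j}"
proof (rule set_eqI, rule iffI)
  fix x assume "i < j" "x \<in> c ` {i..j}"
  then obtain k where k: "x = c k" "i \<le> k" "k \<le> j" by auto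
  show "x \<in> \<Union>(segment_edges c i j)"
  proof (cases "k < j")
    case True then show ?thesis using k unfolding segment_edges_def by auto
  next
    case False
    then have "x \<in> {c (j - 1), c (Suc (j - 1))}" "j - 1 \<in> {i..<j}" using k \<open>i < j\<close> by auto
    then show ?thesis unfolding segment_edges_def by blast
  qed
qed (auto simp: segment_edges_def)

lemma segment_edges_finite [simp]: "finite (segment_edges c i j)"
  by (simp add: segment_edges_def)

text \<open>If two paths meet in their ends only, a common edge would have to join these ends, and a
  path of length at least 2 has no such edge. Intersecting the vertex sets yields only an inclusion
  for \<open>e\<close>, hence this form.\<close>

lemma graph_path_ends_notin_segment_edges:
  assumes "graph_path E c i j" "i + 2 \<le> j" "e \<subseteq> {c i, c j}"
  shows "e \<notin> segment_edges c i j"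
proof
  assume "e \<in> segment_edges c i j"
  then obtain k where k: "i \<le> k" "k < j" "e = {c k, c (Suc k)}"
    unfolding segment_edges_def by auto
  have inj: "inj_on c {i..j}" using assms(1) by (simp add: graph_path_def)
  have "c k = c i \<or> c k = c j" "c (Suc k) = c i \<or> c (Suc k) = c j" using k(3) assms(3) by auto
  then have "k = i \<or> k = j" "Suc k = i \<or> Suc k = j"
    using k(1,2) by (auto dest!: inj_onD[OF inj])
  then show False using k assms(2) by auto
qed

lemma graph_cycle_mod:
  assumes "graph_cycle E n c"
  shows "c (k mod n) = c k"
proof -
  have "c (m + q * n) = c m" for m q
  proof (induction q)
    case (Suc q)
    have "c (m + q * n + n) = c (m + q * n)" using assms by (simp add: graph_cycle_def)
    then show ?case using Suc by (simp add: algebra_simps)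
  qed simp
  from this[of "k mod n" "k div n"] show ?thesis by simp
qed

lemma graph_cycle_eq_iff:
  assumes "graph_cycle E n c"
  shows "c i = c j \<longleftrightarrow> i mod n = j mod n"
proof -
  have "inj_on c {..<n}" "0 < n" using assms by (auto simp: graph_cycle_def)
  then show ?thesis
    using graph_cycle_mod[OF assms] inj_onD[of c "{..<n}" "i mod n" "j mod n"]
    by (metis lessThan_iff mod_less_divisor)
qed

lemma graph_cycle_inj:
  assumes "graph_cycle E n c" "j < i + n"
  shows "inj_on c {i..j}"
proof (rule inj_onI)
  have *: "x = y" if "x \<le> y" "y < x + n" "c x = c y" for x y
  proof -
    have "n dvd y - x"
      using that graph_cycle_eq_iff[OF assms(1)] mod_eq_dvd_iff_nat by metis
    then show ?thesis using that by (auto dest!: dvd_imp_le)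
  qed
  fix x y assume "x \<in> {i..j}" "y \<in> {i..j}" "c x = c y"
  then show "x = y" using assms(2) *[of x y] *[of y x] by (cases "x \<le> y") auto
qed

lemma graph_cycle_path:
  assumes "graph_cycle E n c" "i < j" "j < i + n"
  shows "graph_path E c i j"
  using assms graph_cycle_inj[OF assms(1,3)]
  by (auto simp: graph_path_def segment_edges_def graph_cycle_def)

text \<open>The right-hand side is independent of \<open>i\<close> and \<open>j\<close>, so that any
  two chords see the same closed curve of the cycle.\<close>

lemma graph_cycle_segments:
  assumes "graph_cycle E n c" "i \<le> j" "j \<le> i + n"
  shows "segment_edges c i j \<union> segment_edges c j (i + n) = range (\<lambda>k. {c k, c (Suc k)})"
proof -
  have "segment_edges c i j \<union> segment_edges c j (i + n) = segment_edges c i (i + n)"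
    unfolding segment_edges_def image_Un[symmetric] using assms by (simp add: ivl_disj_un)
  also have "\<dots> = range (\<lambda>k. {c k, c (Suc k)})"
  proof
    show "range (\<lambda>k. {c k, c (Suc k)}) \<subseteq> segment_edges c i (i + n)"
    proof
      fix e assume "e \<in> range (\<lambda>k. {c k, c (Suc k)})"
      then obtain k where e: "e = {c k, c (Suc k)}" by auto
      have n: "0 < n" using assms by (simp add: graph_cycle_def)
      \<comment> \<open>The representative of \<open>k\<close> modulo \<open>n\<close> in the window
        that starts at \<open>i\<close>. The summand \<open>i * n\<close> keeps the subtraction of
        \<open>i\<close> from being truncated.\<close>
      define m where "m = i + (k + i * n - i) mod n"
      have "i \<le> i * n" using n by simp
      have "m mod n = (i + (k + i * n - i)) mod n" unfolding m_def by (simp add: mod_simps)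
      also have "i + (k + i * n - i) = k + i * n" using \<open>i \<le> i * n\<close> by linarith
      also have "(k + i * n) mod n = k mod n" by simp
      finally have m: "m mod n = k mod n" .
      then have "c m = c k" "c (Suc m) = c (Suc k)"
        using graph_cycle_eq_iff[OF assms(1)] mod_Suc_eq by metis+
      moreover have "m \<in> {i..<i + n}" using n by (simp add: m_def)
      ultimately show "e \<in> segment_edges c i (i + n)"
        unfolding segment_edges_def e by (intro image_eqI[of _ _ m]) simp_all
    qed
  qed (auto simp: segment_edges_def)
  finally show ?thesis .
qed

lemma graph_cycle_segment_Int:
  assumes "graph_cycle E n c" "i < j" "j < i + n"
  shows "c ` {i..j} \<inter> c ` {j..i + n} \<subseteq> {c i, c j}"
proof
  fix x assume x: "x \<in> c ` {i..j} \<inter> c ` {j..i + n}"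
  then obtain k l where k: "k \<in> {i..j}" "x = c k" and l: "l \<in> {j..i + n}" "x = c l" by auto
  \<comment> \<open>The last index repeats \<open>c i\<close>; up to the index before it
    \<open>c\<close> is injective.\<close>
  show "x \<in> {c i, c j}"
  proof (cases "l = i + n")
    case True then show ?thesis using l assms(1) by (simp add: graph_cycle_def)
  next
    case False
    then have "inj_on c {i..i + n - 1}" using graph_cycle_inj[OF assms(1)] assms by simp
    moreover have "k \<in> {i..i + n - 1}" "l \<in> {i..i + n - 1}" using k l False assms by auto
    ultimately have "k = l" using k(2) l(2) by (auto dest: inj_onD)
    then show ?thesis using k l by auto
  qed
qed

section \<open>Paths in drawings\<close>

text \<open>A drawing does not fix the direction of an edge's arc; reversal provides the one needed
  for joining arcs.\<close>

lemma drawing_edge_arc: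
  assumes "plane_drawing V E p \<gamma>" "{u, v} \<in> E"
  obtains g where "arc g" "pathstart g = p u" "pathfinish g = p v"
    "path_image g = path_image (\<gamma> {u, v})"
proof -
  have a: "arc (\<gamma> {u, v})" and "{pathstart (\<gamma> {u, v}), pathfinish (\<gamma> {u, v})} = {p u, p v}"
    using assms by (auto simp: plane_drawing_def)
  then consider "pathstart (\<gamma> {u, v}) = p u" "pathfinish (\<gamma> {u, v}) = p v" |
     "pathstart (\<gamma> {u, v}) = p v" "pathfinish (\<gamma> {u, v}) = p u"
    by (auto simp: doubleton_eq_iff)
  then show thesis
    by cases (use a that[of "\<gamma> {u, v}"] that[of "reversepath (\<gamma> {u, v})"] in
      \<open>auto simp: arc_reversepath\<close>)
qed

lemma drawing_Int_subset:
  assumes "plane_drawing V E p \<gamma>" "F \<subseteq> E" "F' \<subseteq> E" "F \<inter> F' = {}"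
  shows "(\<Union>e\<in>F. path_image (\<gamma> e)) \<inter> (\<Union>e\<in>F'. path_image (\<gamma> e)) \<subseteq> p ` (\<Union>F \<inter> \<Union>F')"
proof
  fix z assume "z \<in> (\<Union>e\<in>F. path_image (\<gamma> e)) \<inter> (\<Union>e\<in>F'. path_image (\<gamma> e))"
  then obtain e f where ef: "e \<in> F" "f \<in> F'" "z \<in> path_image (\<gamma> e) \<inter> path_image (\<gamma> f)" by auto
  then have "e \<noteq> f" "e \<in> E" "f \<in> E" using assms by auto
  then have "z \<in> p ` (e \<inter> f)" using assms(1) ef(3) unfolding plane_drawing_def by blast
  then show "z \<in> p ` (\<Union>F \<inter> \<Union>F')" using ef by blast
qed

lemma drawing_vertex_on_edge:
  assumes "plane_drawing V E p \<gamma>" "simple_graph V E" "F \<subseteq> E" "v \<in> V"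
  shows "p v \<in> (\<Union>e\<in>F. path_image (\<gamma> e)) \<longleftrightarrow> v \<in> \<Union>F"
proof
  assume "p v \<in> (\<Union>e\<in>F. path_image (\<gamma> e))"
  then obtain e where e: "e \<in> F" "p v \<in> path_image (\<gamma> e)" by blast
  then have "v \<in> e" using assms(1,3,4) unfolding plane_drawing_def by auto
  then show "v \<in> \<Union>F" using e by blast
next
  assume "v \<in> \<Union>F"
  then obtain e where e: "e \<in> F" "v \<in> e" by auto
  then have "{pathstart (\<gamma> e), pathfinish (\<gamma> e)} = p ` e"
    using assms(1,3) unfolding plane_drawing_def by auto
  then have "p v \<in> {pathstart (\<gamma> e), pathfinish (\<gamma> e)}" using e(2) by simp
  then have "p v \<in> path_image (\<gamma> e)"
    using pathstart_in_path_image[of "\<gamma> e"] pathfinish_in_path_image[of "\<gamma> e"] by auto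
  then show "p v \<in> (\<Union>e\<in>F. path_image (\<gamma> e))" using e by blast
qed

text \<open>The arcs of the edges are joined one by one. The vertex added last is new, so its arc
  meets the earlier ones only in the image of \<open>c j\<close>, and the join is again an
  arc.\<close>

lemma drawing_path_arc:
  assumes "plane_drawing V E p \<gamma>" "graph_path E c i j"
  obtains g where "arc g" "pathstart g = p (c i)" "pathfinish g = p (c j)"
    "path_image g = (\<Union>e\<in>segment_edges c i j. path_image (\<gamma> e))"
proof -
  have "i < j" using assms(2) by (simp add: graph_path_def)
  then have "Suc i \<le> j" by simp
  then have "graph_path E c i j \<longrightarrow> (\<exists>g. arc g \<and> pathstart g = p (c i) \<and> pathfinish g = p (c j) \<and>
    path_image g = (\<Union>e\<in>segment_edges c i j. path_image (\<gamma> e)))"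
  proof (induction j rule: dec_induct)
    case base
    show ?case
    proof
      assume *: "graph_path E c i (Suc i)"
      then have "{c i, c (Suc i)} \<in> E" by (auto simp: graph_path_def segment_edges_def)
      from drawing_edge_arc[OF assms(1) this] show "\<exists>g. arc g \<and> pathstart g = p (c i) \<and>
        pathfinish g = p (c (Suc i)) \<and>
        path_image g = (\<Union>e\<in>segment_edges c i (Suc i). path_image (\<gamma> e))"
        by (auto simp: segment_edges_def)
    qed
  next
    case (step j)
    show ?case
    proof
      assume *: "graph_path E c i (Suc j)"
      have ij: "i < j" using step by simp
      have inj: "inj_on c {i..Suc j}" using * by (simp add: graph_path_def)
      have "inj_on c {i..j}" by (rule inj_on_subset[OF inj]) auto
      moreover have "segment_edges c i j \<subseteq> segment_edges c i (Suc j)"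
        unfolding segment_edges_def by (rule image_mono) auto
      ultimately have **: "graph_path E c i j" using * ij by (auto simp: graph_path_def)
      then obtain g where g: "arc g" "pathstart g = p (c i)" "pathfinish g = p (c j)"
        "path_image g = (\<Union>e\<in>segment_edges c i j. path_image (\<gamma> e))" using step by blast
      have e: "{c j, c (Suc j)} \<in> E" using * ij by (auto simp: graph_path_def segment_edges_def)
      then obtain h where h: "arc h" "pathstart h = p (c j)" "pathfinish h = p (c (Suc j))"
        "path_image h = path_image (\<gamma> {c j, c (Suc j)})"
        using drawing_edge_arc[OF assms(1)] by blast
      have new: "c (Suc j) \<notin> c ` {i..j}"
      proof
        assume "c (Suc j) \<in> c ` {i..j}"
        then obtain k where "k \<in> {i..j}" "c (Suc j) = c k" by auto
        then have "Suc j = k" using ij by (intro inj_onD[OF inj]) auto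
        then show False using \<open>k \<in> {i..j}\<close> by simp
      qed
      then have "{c j, c (Suc j)} \<notin> segment_edges c i j"
        using Union_segment_edges[OF ij, of c] by blast
      then have "path_image g \<inter> path_image h \<subseteq> p ` (c ` {i..j} \<inter> {c j, c (Suc j)})"
      proof -
        assume "{c j, c (Suc j)} \<notin> segment_edges c i j"
        then have "segment_edges c i j \<inter> {{c j, c (Suc j)}} = {}" by blast
        moreover have "segment_edges c i j \<subseteq> E" using ** by (simp add: graph_path_def)
        moreover have "{{c j, c (Suc j)}} \<subseteq> E" using e by simp
        ultimately have "path_image g \<inter> (\<Union>e\<in>{{c j, c (Suc j)}}. path_image (\<gamma> e)) \<subseteq>
            p ` (\<Union>(segment_edges c i j) \<inter> \<Union>{{c j, c (Suc j)}})"
          unfolding g(4) by (intro drawing_Int_subset[OF assms(1)])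
        then show ?thesis unfolding Union_segment_edges[OF ij] h(4) by simp
      qed
      also have "\<dots> \<subseteq> p ` {c j}"
      proof (rule image_mono, rule subsetI)
        fix w assume w: "w \<in> c ` {i..j} \<inter> {c j, c (Suc j)}"
        then have "w \<noteq> c (Suc j)" using new by (metis IntD1)
        then show "w \<in> {c j}" using w by blast
      qed
      also have "\<dots> = {pathstart h}" using h by simp
      finally have "arc (g +++ h)" using g h by (intro arc_join) auto
      moreover have "path_image (g +++ h) = (\<Union>e\<in>segment_edges c i (Suc j). path_image (\<gamma> e))"
      proof -
        have "segment_edges c i (Suc j) = insert {c j, c (Suc j)} (segment_edges c i j)"
          using ij by (simp add: segment_edges_def atLeastLessThanSuc)
        then show ?thesis using g(3,4) h(2,4) by (simp add: path_image_join Un_commute)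
      qed
      ultimately show "\<exists>g. arc g \<and> pathstart g = p (c i) \<and> pathfinish g = p (c (Suc j)) \<and>
        path_image g = (\<Union>e\<in>segment_edges c i (Suc j). path_image (\<gamma> e))"
        using g(2) h(3) by (intro exI[of _ "g +++ h"] conjI) simp_all
    qed
  qed
  then show thesis using that assms(2) by metis
qed

text \<open>The inside of \<open>K\<close> is open and disjoint from \<open>outside K\<close>, which
  contains \<open>outside D\<close>; so it contains no limit point of
  \<open>outside D\<close>.\<close>

lemma frontier_outside_notin_inside:
  fixes K D :: "complex set"
  assumes "K \<subseteq> D" "closed K" "z \<in> frontier (outside D)"
  shows "z \<notin> inside K"
proof
  assume z: "z \<in> inside K"
  have "outside D \<subseteq> outside K" using assms(1) outside_mono by blast
  then have "outside D \<inter> inside K = {}" using inside_Int_outside by blast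
  moreover have "open (inside K)" using assms(2) open_inside by blast
  ultimately have "closure (outside D) \<inter> inside K = {}"
    by (metis Int_commute open_Int_closure_eq_empty)
  then show False using z assms(3) by (auto simp: frontier_def)
qed

lemma closed_drawn_edges:
  assumes "plane_drawing V E p \<gamma>" "F \<subseteq> E" "finite F"
  shows "closed (\<Union>e\<in>F. path_image (\<gamma> e))"
  using assms by (intro closed_UN) (auto simp: plane_drawing_def arc_imp_path closed_path_image)

section \<open>Forbidden configurations in outerplanar graphs\<close>

lemma outerplanar_vertex_notin_inside:
  assumes "plane_drawing V E p \<gamma>" "p ` V \<subseteq> frontier (outside (drawn_set V E p \<gamma>))"
    and "F \<subseteq> E" "finite F" "v \<in> V"
  shows "p v \<notin> inside (\<Union>e\<in>F. path_image (\<gamma> e))"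
proof (rule frontier_outside_notin_inside)
  show "(\<Union>e\<in>F. path_image (\<gamma> e)) \<subseteq> drawn_set V E p \<gamma>"
    using assms(3) by (auto simp: drawn_set_def)
  show "closed (\<Union>e\<in>F. path_image (\<gamma> e))"
    using closed_drawn_edges assms(1,3,4) by blast
  show "p v \<in> frontier (outside (drawn_set V E p \<gamma>))" using assms(2,5) by blast
qed

text \<open>Such paths form a subdivision of K_{2,3}. Length at least 2 gives each of them an inner
  vertex, so whichever arc is enclosed by the other two hides a vertex from the outer face.\<close>

lemma outerplanar_no_theta:
  assumes G: "simple_graph V E" "outerplanar V E"
    and p1: "graph_path E c1 i1 j1" "i1 + 2 \<le> j1" "c1 i1 = a" "c1 j1 = b"
    and p2: "graph_path E c2 i2 j2" "i2 + 2 \<le> j2" "c2 i2 = a" "c2 j2 = b"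
    and p3: "graph_path E c3 i3 j3" "i3 + 2 \<le> j3" "c3 i3 = a" "c3 j3 = b"
    and d12: "c1 ` {i1..j1} \<inter> c2 ` {i2..j2} \<subseteq> {a, b}"
    and d13: "c1 ` {i1..j1} \<inter> c3 ` {i3..j3} \<subseteq> {a, b}"
    and d23: "c2 ` {i2..j2} \<inter> c3 ` {i3..j3} \<subseteq> {a, b}"
  shows False
proof -
  obtain p \<gamma> where D: "plane_drawing V E p \<gamma>"
    and fr: "p ` V \<subseteq> frontier (outside (drawn_set V E p \<gamma>))"
    using G(2) by (auto simp: outerplanar_def)
  let ?I = "\<lambda>F. \<Union>e\<in>F. path_image (\<gamma> e)"
  have lt: "i1 < j1" "i2 < j2" "i3 < j3" using p1 p2 p3 by (auto simp: graph_path_def)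
  have sub: "segment_edges c1 i1 j1 \<subseteq> E" "segment_edges c2 i2 j2 \<subseteq> E" "segment_edges c3 i3 j3 \<subseteq> E"
    using p1 p2 p3 by (auto simp: graph_path_def)
  obtain g1 where g1: "arc g1" "pathstart g1 = p a" "pathfinish g1 = p b"
    "path_image g1 = ?I (segment_edges c1 i1 j1)"
    using drawing_path_arc[OF D p1(1)] p1 by metis
  obtain g2 where g2: "arc g2" "pathstart g2 = p a" "pathfinish g2 = p b"
    "path_image g2 = ?I (segment_edges c2 i2 j2)"
    using drawing_path_arc[OF D p2(1)] p2 by metis
  obtain g3 where g3: "arc g3" "pathstart g3 = p a" "pathfinish g3 = p b"
    "path_image g3 = ?I (segment_edges c3 i3 j3)"
    using drawing_path_arc[OF D p3(1)] p3 by metis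
  have disj: "segment_edges c i j \<inter> segment_edges c' i' j' = {}"
    if "graph_path E c i j" "i + 2 \<le> j" "c i = a" "c j = b"
      "i' < j'" "c ` {i..j} \<inter> c' ` {i'..j'} \<subseteq> {a, b}" for c c' i i' j j'
  proof (rule ccontr)
    assume "segment_edges c i j \<inter> segment_edges c' i' j' \<noteq> {}"
    then obtain e where e: "e \<in> segment_edges c i j" "e \<in> segment_edges c' i' j'" by blast
    have "i < j" using that by simp
    then have "e \<subseteq> {c i, c j}" using e Union_segment_edges[of i j c] Union_segment_edges[of i' j' c'] that by blast
    then show False using graph_path_ends_notin_segment_edges[OF that(1,2)] e by blast
  qed
  have meet: "?I (segment_edges c i j) \<inter> ?I (segment_edges c' i' j') \<subseteq> {p a, p b}"
    if "graph_path E c i j" "i + 2 \<le> j" "c i = a" "c j = b" "segment_edges c' i' j' \<subseteq> E"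
      "i' < j'" "c ` {i..j} \<inter> c' ` {i'..j'} \<subseteq> {a, b}" for c c' i i' j j'
  proof -
    have "?I (segment_edges c i j) \<inter> ?I (segment_edges c' i' j') \<subseteq> p ` (c ` {i..j} \<inter> c' ` {i'..j'})"
      using drawing_Int_subset[OF D _ that(5) disj[OF that(1-4,6,7)]] that
      by (simp add: graph_path_def Union_segment_edges)
    then show ?thesis using that(7) by blast
  qed
  have V: "e \<subseteq> V" if "e \<in> E" for e using G(1) that by (auto simp: simple_graph_def)
  have inner: "\<exists>v. v \<in> V \<and> p v \<in> ?I (segment_edges c i j) - {p a, p b}"
    if "graph_path E c i j" "i + 2 \<le> j" "c i = a" "c j = b" for c i j
  proof -
    let ?v = "c (Suc i)"
    have inj: "inj_on c {i..j}" using that by (simp add: graph_path_def)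
    have e: "{c i, ?v} \<in> segment_edges c i j" using that by (auto simp: segment_edges_def)
    have sE: "segment_edges c i j \<subseteq> E" using that by (simp add: graph_path_def)
    have VV: "?v \<in> V" "a \<in> V" "b \<in> V"
      using Union_segment_edges[of i j c] sE V that by fastforce+
    have "?v \<noteq> a" "?v \<noteq> b"
      using that inj_onD[OF inj, of "Suc i" i] inj_onD[OF inj, of "Suc i" j] by auto
    then have "p ?v \<noteq> p a" "p ?v \<noteq> p b"
      using D VV by (auto simp: plane_drawing_def dest: inj_onD)
    moreover have "p ?v \<in> ?I (segment_edges c i j)"
      using drawing_vertex_on_edge[OF D G(1) sE VV(1)] e by blast
    ultimately show ?thesis using VV by blast
  qed
  have "\<not> path_image g1 - {p a, p b} \<subseteq> inside (path_image g2 \<union> path_image g3)"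
    using inner[OF p1] outerplanar_vertex_notin_inside[OF D fr, of "segment_edges c2 i2 j2 \<union> segment_edges c3 i3 j3"]
      sub g1 g2 g3 by auto
  moreover have "\<not> path_image g2 - {p a, p b} \<subseteq> inside (path_image g1 \<union> path_image g3)"
    using inner[OF p2] outerplanar_vertex_notin_inside[OF D fr, of "segment_edges c1 i1 j1 \<union> segment_edges c3 i3 j3"]
      sub g1 g2 g3 by auto
  moreover have "\<not> path_image g3 - {p a, p b} \<subseteq> inside (path_image g1 \<union> path_image g2)"
    using inner[OF p3] outerplanar_vertex_notin_inside[OF D fr, of "segment_edges c1 i1 j1 \<union> segment_edges c2 i2 j2"]
      sub g1 g2 g3 by auto
  ultimately show False
    using theta_middle[OF g1(1-3) g2(1-3) g3(1-3)] g1(4) g2(4) g3(4)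
      meet[OF p1 sub(2) lt(2) d12] meet[OF p1 sub(3) lt(3) d13] meet[OF p2 sub(3) lt(3) d23] by metis
qed

text \<open>The chord and the two arcs of the cycle form a theta curve. By the bounds on
  \<open>i\<close> and \<open>j\<close> both cycle arcs have an inner vertex, so only the chord can
  be the enclosed arc.\<close>

lemma outerplanar_chord_inside:
  assumes G: "simple_graph V E"
    and D: "plane_drawing V E p \<gamma>" and fr: "p ` V \<subseteq> frontier (outside (drawn_set V E p \<gamma>))"
    and c: "graph_cycle E n c" and ij: "i + 2 \<le> j" "j + 2 \<le> i + n" and e: "{c i, c j} \<in> E"
  obtains g1 g2 g3 where
    "arc g1" "pathstart g1 = p (c i)" "pathfinish g1 = p (c j)"
    "path_image g1 = (\<Union>e\<in>segment_edges c i j. path_image (\<gamma> e))"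
    "arc g2" "pathstart g2 = p (c i)" "pathfinish g2 = p (c j)"
    "path_image g2 = (\<Union>e\<in>segment_edges c j (i + n). path_image (\<gamma> e))"
    "arc g3" "pathstart g3 = p (c i)" "pathfinish g3 = p (c j)"
    "path_image g3 = path_image (\<gamma> {c i, c j})"
    "path_image g1 \<inter> path_image g2 \<subseteq> {p (c i), p (c j)}"
    "path_image g1 \<inter> path_image g3 \<subseteq> {p (c i), p (c j)}"
    "path_image g2 \<inter> path_image g3 \<subseteq> {p (c i), p (c j)}"
    "path_image g3 - {p (c i), p (c j)} \<subseteq> inside (path_image g1 \<union> path_image g2)"
proof -
  let ?I = "\<lambda>F. \<Union>e\<in>F. path_image (\<gamma> e)"
  let ?a = "c i" and ?b = "c j"
  have per: "c (i + n) = c i" using c by (simp add: graph_cycle_def)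
  have p1: "graph_path E c i j" and p2: "graph_path E c j (i + n)"
    using graph_cycle_path[OF c] ij by auto
  have s1: "segment_edges c i j \<subseteq> E" and s2: "segment_edges c j (i + n) \<subseteq> E"
    using p1 p2 by (auto simp: graph_path_def)
  obtain g1 where g1: "arc g1" "pathstart g1 = p ?a" "pathfinish g1 = p ?b"
    "path_image g1 = ?I (segment_edges c i j)"
    using drawing_path_arc[OF D p1] by metis
  obtain h where h: "arc h" "pathstart h = p ?b" "pathfinish h = p ?a"
    "path_image h = ?I (segment_edges c j (i + n))"
    using drawing_path_arc[OF D p2] per by metis
  \<comment> \<open>The segment from \<open>j\<close> to \<open>i + n\<close> runs from
    \<open>c j\<close> back to \<open>c i\<close>; reversed, it has the same start as the other two
    arcs.\<close>
  define g2 where "g2 = reversepath h"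
  have g2: "arc g2" "pathstart g2 = p ?a" "pathfinish g2 = p ?b"
    "path_image g2 = ?I (segment_edges c j (i + n))"
    using h by (auto simp: g2_def arc_reversepath)
  obtain g3 where g3: "arc g3" "pathstart g3 = p ?a" "pathfinish g3 = p ?b"
    "path_image g3 = path_image (\<gamma> {?a, ?b})"
    using drawing_edge_arc[OF D e] by metis
  have n1: "{?a, ?b} \<notin> segment_edges c i j"
    using graph_path_ends_notin_segment_edges[OF p1 ij(1)] by blast
  have n2: "{?a, ?b} \<notin> segment_edges c j (i + n)"
    using graph_path_ends_notin_segment_edges[OF p2, of "{?a, ?b}"] per ij by auto
  have U1: "\<Union>(segment_edges c i j) = c ` {i..j}"
    and U2: "\<Union>(segment_edges c j (i + n)) = c ` {j..i + n}"
    using ij by (auto simp: Union_segment_edges)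
  have meetv: "c ` {i..j} \<inter> c ` {j..i + n} \<subseteq> {?a, ?b}"
    using graph_cycle_segment_Int[OF c] ij by simp
  have n3: "segment_edges c i j \<inter> segment_edges c j (i + n) = {}"
  proof (rule ccontr)
    assume "segment_edges c i j \<inter> segment_edges c j (i + n) \<noteq> {}"
    then obtain e where e: "e \<in> segment_edges c i j" "e \<in> segment_edges c j (i + n)" by blast
    then have "e \<subseteq> {?a, ?b}" using U1 U2 meetv by blast
    then show False using graph_path_ends_notin_segment_edges[OF p1 ij(1)] e by blast
  qed
  have i12: "path_image g1 \<inter> path_image g2 \<subseteq> {p ?a, p ?b}"
    using order_trans[OF drawing_Int_subset[OF D s1 s2 n3, unfolded U1 U2] image_mono[OF meetv]]
    unfolding g1(4) g2(4) by simp
  have i13: "path_image g1 \<inter> path_image g3 \<subseteq> {p ?a, p ?b}"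
  proof -
    have "{{?a, ?b}} \<subseteq> E" using e by simp
    moreover have "segment_edges c i j \<inter> {{?a, ?b}} = {}" using n1 by blast
    ultimately have "?I (segment_edges c i j) \<inter> ?I {{?a, ?b}} \<subseteq> p ` (\<Union>(segment_edges c i j) \<inter> \<Union>{{?a, ?b}})"
      by (rule drawing_Int_subset[OF D s1])
    also have "\<dots> \<subseteq> p ` {?a, ?b}" by (rule image_mono) blast
    finally show ?thesis unfolding g1(4) g3(4) by simp
  qed
  have i23: "path_image g2 \<inter> path_image g3 \<subseteq> {p ?a, p ?b}"
  proof -
    have "{{?a, ?b}} \<subseteq> E" using e by simp
    moreover have "segment_edges c j (i + n) \<inter> {{?a, ?b}} = {}" using n2 by blast
    ultimately have "?I (segment_edges c j (i + n)) \<inter> ?I {{?a, ?b}} \<subseteq> p ` (\<Union>(segment_edges c j (i + n)) \<inter> \<Union>{{?a, ?b}})"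
      by (rule drawing_Int_subset[OF D s2])
    also have "\<dots> \<subseteq> p ` {?a, ?b}" by (rule image_mono) blast
    finally show ?thesis unfolding g2(4) g3(4) by simp
  qed
  have EV: "v \<in> V" if "v \<in> \<Union>E" for v using G that by (auto simp: simple_graph_def)
  have cV: "c k \<in> V" for k using c by (intro EV) (auto simp: graph_cycle_def)
  have "inj_on c {i..i + n - 1}" using graph_cycle_inj[OF c] ij by simp
  then have inj: "inj_on c {i..<i + n}" by (rule inj_on_subset) auto
  have neq: "p (c k) \<notin> {p ?a, p ?b}" if "i < k" "k < i + n" "k \<noteq> j" for k
  proof -
    have "c k \<noteq> ?a" "c k \<noteq> ?b"
      using that ij inj_onD[OF inj, of k i] inj_onD[OF inj, of k j] by auto
    then show ?thesis using D cV by (auto simp: plane_drawing_def dest: inj_onD)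
  qed
  have v1: "p (c (Suc i)) \<in> path_image g1" "p (c (Suc j)) \<in> path_image g2"
    unfolding g1(4) g2(4) drawing_vertex_on_edge[OF D G s1 cV] drawing_vertex_on_edge[OF D G s2 cV] U1 U2
    using ij by auto
  have "\<not> path_image g1 - {p ?a, p ?b} \<subseteq> inside (path_image g2 \<union> path_image g3)"
    using v1 neq[of "Suc i"] ij s2 e g2(4) g3(4)
      outerplanar_vertex_notin_inside[OF D fr, of "segment_edges c j (i + n) \<union> {{?a, ?b}}" "c (Suc i)"] cV
    by (auto simp: Un_commute)
  moreover have "\<not> path_image g2 - {p ?a, p ?b} \<subseteq> inside (path_image g1 \<union> path_image g3)"
    using v1 neq[of "Suc j"] ij s1 e g1(4) g3(4)
      outerplanar_vertex_notin_inside[OF D fr, of "segment_edges c i j \<union> {{?a, ?b}}" "c (Suc j)"] cV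
    by (auto simp: Un_commute)
  ultimately have "path_image g3 - {p ?a, p ?b} \<subseteq> inside (path_image g1 \<union> path_image g2)"
    using theta_middle[OF g1(1-3) g2(1-3) g3(1-3) i12 i13 i23] by blast
  then show thesis using that g1 g2 g3 i12 i13 i23 by blast
qed

text \<open>Both chords lie inside the closed curve of the whole cycle, and the ends of the second
  lie on different arcs between the ends of the first. The later indices may run beyond the period,
  which covers every cyclic position.\<close>

lemma outerplanar_no_crossing_chords:
  assumes G: "simple_graph V E" "outerplanar V E" and c: "graph_cycle E n c"
    and ord: "i < m" "m < j" "j < l" "l < i + n" and e: "{c i, c j} \<in> E" "{c m, c l} \<in> E"
  shows False
proof -
  obtain p \<gamma> where D: "plane_drawing V E p \<gamma>"
    and fr: "p ` V \<subseteq> frontier (outside (drawn_set V E p \<gamma>))"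
    using G(2) by (auto simp: outerplanar_def)
  have EV: "v \<in> V" if "v \<in> \<Union>E" for v using G that by (auto simp: simple_graph_def)
  have cV: "c k \<in> V" for k using c by (intro EV) (auto simp: graph_cycle_def)
  have len: "i + 2 \<le> j" "j + 2 \<le> i + n" "m + 2 \<le> l" "l + 2 \<le> m + n" using ord by auto
  obtain g1 g2 g3 where g: "arc g1" "pathstart g1 = p (c i)" "pathfinish g1 = p (c j)"
    "path_image g1 = (\<Union>e\<in>segment_edges c i j. path_image (\<gamma> e))"
    "arc g2" "pathstart g2 = p (c i)" "pathfinish g2 = p (c j)"
    "path_image g2 = (\<Union>e\<in>segment_edges c j (i + n). path_image (\<gamma> e))"
    "arc g3" "pathstart g3 = p (c i)" "pathfinish g3 = p (c j)"
    "path_image g3 = path_image (\<gamma> {c i, c j})"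
    and i: "path_image g1 \<inter> path_image g2 \<subseteq> {p (c i), p (c j)}"
    "path_image g1 \<inter> path_image g3 \<subseteq> {p (c i), p (c j)}"
    "path_image g2 \<inter> path_image g3 \<subseteq> {p (c i), p (c j)}"
    and ins: "path_image g3 - {p (c i), p (c j)} \<subseteq> inside (path_image g1 \<union> path_image g2)"
    by (rule outerplanar_chord_inside[OF G(1) D fr c len(1,2) e(1)])
  obtain h1 h2 g4 where h:
    "path_image h1 = (\<Union>e\<in>segment_edges c m l. path_image (\<gamma> e))"
    "path_image h2 = (\<Union>e\<in>segment_edges c l (m + n). path_image (\<gamma> e))"
    and g4: "arc g4" "pathstart g4 = p (c m)" "pathfinish g4 = p (c l)"
    "path_image g4 = path_image (\<gamma> {c m, c l})"
    "path_image g4 - {p (c m), p (c l)} \<subseteq> inside (path_image h1 \<union> path_image h2)"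
    by (rule outerplanar_chord_inside[OF G(1) D fr c len(3,4) e(2)])
  have "path_image h1 \<union> path_image h2 = path_image g1 \<union> path_image g2"
    unfolding h g UN_Un[symmetric] using graph_cycle_segments[OF c, of i j] graph_cycle_segments[OF c, of m l] ord
    by simp
  then have ins4: "path_image g4 - {p (c m), p (c l)} \<subseteq> inside (path_image g1 \<union> path_image g2)"
    using g4(5) by simp
  have p1: "graph_path E c i j" and p2: "graph_path E c j (i + n)"
    using graph_cycle_path[OF c] ord by auto
  have s1: "segment_edges c i j \<subseteq> E" and s2: "segment_edges c j (i + n) \<subseteq> E"
    using p1 p2 by (auto simp: graph_path_def)
  have U1: "\<Union>(segment_edges c i j) = c ` {i..j}"
    and U2: "\<Union>(segment_edges c j (i + n)) = c ` {j..i + n}"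
    using ord by (auto simp: Union_segment_edges)
  have "inj_on c {i..i + n - 1}" using graph_cycle_inj[OF c] ord by simp
  then have inj: "inj_on c {i..<i + n}" by (rule inj_on_subset) auto
  have nn: "c x \<noteq> c y" if "x \<in> {i..<i + n}" "y \<in> {i..<i + n}" "x \<noteq> y" for x y
    using inj_onD[OF inj] that by blast
  have ne: "c m \<noteq> c i" "c m \<noteq> c j" "c l \<noteq> c i" "c l \<noteq> c j"
    using ord by (intro nn; simp)+
  have meetv: "c ` {i..j} \<inter> c ` {j..i + n} \<subseteq> {c i, c j}"
    using graph_cycle_segment_Int[OF c] ord by simp
  have mem: "c m \<in> c ` {i..j}" "c l \<in> c ` {j..i + n}" using ord by auto
  have nmem: "c m \<notin> c ` {j..i + n}" "c l \<notin> c ` {i..j}" using meetv mem ne by auto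
  have on: "p (c k) \<in> path_image g1 \<longleftrightarrow> c k \<in> c ` {i..j}"
    "p (c k) \<in> path_image g2 \<longleftrightarrow> c k \<in> c ` {j..i + n}" for k
    unfolding g drawing_vertex_on_edge[OF D G(1) s1 cV] drawing_vertex_on_edge[OF D G(1) s2 cV] U1 U2
    by (rule refl)+
  have "{c i, c j} \<inter> {c m, c l} = {}" using ne by auto
  moreover have "{c i, c j} \<noteq> {c m, c l}" using ne by auto
  ultimately have i34: "path_image g3 \<inter> path_image g4 = {}"
    using D e unfolding g g4 plane_drawing_def by (metis image_empty subset_empty)
  show False
    by (rule inner_chords_cross[OF g(1-3) g(5-7) g(9-11) i g4(1-3) _ _ _ _ ins ins4 i34])
      (use on mem nmem in auto)
qed

section \<open>Operations preserving outerplanarity\<close>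

text \<open>A smaller drawn set has a larger outside, so the vertices remain in the closure of the
  outside; being drawn, they are not in the outside itself. Deletion and suppression both only
  shrink the drawn set.\<close>

lemma outerplanar_redraw:
  assumes G: "plane_drawing V E p \<gamma>" "p ` V \<subseteq> frontier (outside (drawn_set V E p \<gamma>))"
    and "V' \<subseteq> V" and D': "plane_drawing V' E' p \<gamma>'"
    and sub: "(\<Union>e\<in>E'. path_image (\<gamma>' e)) \<subseteq> (\<Union>e\<in>E. path_image (\<gamma> e))"
  shows "outerplanar V' E'"
proof -
  have s: "drawn_set V' E' p \<gamma>' \<subseteq> drawn_set V E p \<gamma>"
    using sub \<open>V' \<subseteq> V\<close> by (auto simp: drawn_set_def)
  have "p v \<in> frontier (outside (drawn_set V' E' p \<gamma>'))" if v: "v \<in> V'" for v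
  proof -
    have "p v \<in> frontier (outside (drawn_set V E p \<gamma>))" using v assms by blast
    then have "p v \<in> closure (outside (drawn_set V E p \<gamma>))" by (simp add: frontier_def)
    then have "p v \<in> closure (outside (drawn_set V' E' p \<gamma>'))"
      using closure_mono[OF outside_mono[OF s]] by blast
    moreover have "p v \<in> drawn_set V' E' p \<gamma>'" using v by (simp add: drawn_set_def)
    then have "p v \<notin> outside (drawn_set V' E' p \<gamma>')" using outside_no_overlap by blast
    ultimately show ?thesis using interior_subset by (auto simp: frontier_def)
  qed
  then show ?thesis using D' by (auto simp: outerplanar_def)
qed

lemma outerplanar_subgraph:
  assumes "outerplanar V E" "V' \<subseteq> V" "E' \<subseteq> E"
  shows "outerplanar V' E'"
proof -
  obtain p \<gamma> where D: "plane_drawing V E p \<gamma>"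
    and fr: "p ` V \<subseteq> frontier (outside (drawn_set V E p \<gamma>))"
    using assms(1) by (auto simp: outerplanar_def)
  have "inj_on p V'" using D assms(2) by (auto simp: plane_drawing_def intro: inj_on_subset)
  moreover have "\<forall>e\<in>E'. arc (\<gamma> e) \<and> {pathstart (\<gamma> e), pathfinish (\<gamma> e)} = p ` e"
    "\<forall>e\<in>E'. \<forall>v\<in>V'. p v \<in> path_image (\<gamma> e) \<longrightarrow> v \<in> e"
    "\<forall>e\<in>E'. \<forall>f\<in>E'. e \<noteq> f \<longrightarrow> path_image (\<gamma> e) \<inter> path_image (\<gamma> f) \<subseteq> p ` (e \<inter> f)"
    using D assms(2,3) unfolding plane_drawing_def by (meson subsetD)+
  ultimately have "plane_drawing V' E' p \<gamma>" by (simp add: plane_drawing_def)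
  then show ?thesis using outerplanar_redraw[OF D fr assms(2)] assms(3) by blast
qed

text \<open>The arcs of the two edges at \<open>y\<close>, joined, serve as the arc of
  \<open>{x, z}\<close>, so no new point is drawn. Since \<open>{x, z}\<close> is not yet an edge,
  the new arc does not displace an old one.\<close>

lemma outerplanar_suppress:
  assumes G: "simple_graph V E" "outerplanar V E"
    and y: "{x, y} \<in> E" "{y, z} \<in> E" "x \<noteq> z" "\<And>e. e \<in> E \<Longrightarrow> y \<in> e \<Longrightarrow> e = {x, y} \<or> e = {y, z}"
    and xz: "{x, z} \<notin> E"
  shows "outerplanar (V - {y}) (insert {x, z} (E - {{x, y}, {y, z}}))"
proof -
  obtain p \<gamma> where D: "plane_drawing V E p \<gamma>"
    and fr: "p ` V \<subseteq> frontier (outside (drawn_set V E p \<gamma>))"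
    using G(2) by (auto simp: outerplanar_def)
  have ne: "x \<noteq> y" "y \<noteq> z" using G(1) y(1,2) by (fastforce simp: simple_graph_def)+
  have V: "x \<in> V" "y \<in> V" "z \<in> V" using G(1) y(1,2) by (auto simp: simple_graph_def)
  \<comment> \<open>Presents \<open>x\<close>, \<open>y\<close>, \<open>z\<close> as an indexed
    path, so that the joined arc comes from \<open>drawing_path_arc\<close>.\<close>
  define d where "d k = (if k = 0 then x else if k = 1 then y else z)" for k :: nat
  have seg: "segment_edges d 0 2 = {{x, y}, {y, z}}"
    by (auto simp: segment_edges_def d_def numeral_2_eq_2 atLeastLessThanSuc)
  have "graph_path E d 0 2"
    unfolding graph_path_def seg using y ne by (auto simp: d_def inj_on_def)
  then obtain g where "arc g" "pathstart g = p (d 0)" "pathfinish g = p (d 2)"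
    "path_image g = (\<Union>e\<in>segment_edges d 0 2. path_image (\<gamma> e))"
    using drawing_path_arc[OF D] by metis
  then have g: "arc g" "pathstart g = p x" "pathfinish g = p z"
    "path_image g = path_image (\<gamma> {x, y}) \<union> path_image (\<gamma> {y, z})"
    unfolding seg by (auto simp: d_def)
  let ?E = "insert {x, z} (E - {{x, y}, {y, z}})"
  define \<gamma>' where "\<gamma>' = \<gamma>({x, z} := g)"
  have D1: "inj_on p V" "\<And>e. e \<in> E \<Longrightarrow> arc (\<gamma> e) \<and> {pathstart (\<gamma> e), pathfinish (\<gamma> e)} = p ` e"
    "\<And>e v. e \<in> E \<Longrightarrow> v \<in> V \<Longrightarrow> p v \<in> path_image (\<gamma> e) \<Longrightarrow> v \<in> e"
    "\<And>e f. e \<in> E \<Longrightarrow> f \<in> E \<Longrightarrow> e \<noteq> f \<Longrightarrow> path_image (\<gamma> e) \<inter> path_image (\<gamma> f) \<subseteq> p ` (e \<inter> f)"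
    using D unfolding plane_drawing_def by meson+
  \<comment> \<open>A remaining edge misses \<open>y\<close>, so it can meet the joined arc only in
    the images of \<open>x\<close> and \<open>z\<close>.\<close>
  have meet: "path_image (\<gamma> e) \<inter> path_image g \<subseteq> p ` (e \<inter> {x, z})"
    if e: "e \<in> E - {{x, y}, {y, z}}" for e
  proof -
    have "y \<notin> e" using e y(4) by blast
    moreover have "path_image (\<gamma> e) \<inter> path_image (\<gamma> {x, y}) \<subseteq> p ` (e \<inter> {x, y})"
      "path_image (\<gamma> e) \<inter> path_image (\<gamma> {y, z}) \<subseteq> p ` (e \<inter> {y, z})"
      using e y(1,2) by (intro D1(4); blast)+
    ultimately show ?thesis unfolding g by blast
  qed
  have on: "v \<in> {x, z}" if "v \<in> V - {y}" "p v \<in> path_image g" for v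
    using that D1(3)[OF y(1), of v] D1(3)[OF y(2), of v] unfolding g by blast
  have old: "\<gamma>' e = \<gamma> e" if "e \<in> E" for e using that xz by (auto simp: \<gamma>'_def)
  have new: "\<gamma>' {x, z} = g" by (simp add: \<gamma>'_def)
  have "plane_drawing (V - {y}) ?E p \<gamma>'"
    unfolding plane_drawing_def
  proof (intro conjI ballI impI)
    show "inj_on p (V - {y})" using D1(1) by (auto intro: inj_on_subset)
    fix e assume e: "e \<in> ?E"
    show "arc (\<gamma>' e)" "{pathstart (\<gamma>' e), pathfinish (\<gamma>' e)} = p ` e"
    proof (atomize(full), cases "e = {x, z}")
      case True then show "arc (\<gamma>' e) \<and> {pathstart (\<gamma>' e), pathfinish (\<gamma>' e)} = p ` e"
        using g new by simp
    next
      case False then show "arc (\<gamma>' e) \<and> {pathstart (\<gamma>' e), pathfinish (\<gamma>' e)} = p ` e"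
        using D1(2)[of e] e old[of e] by simp
    qed
    fix v assume v: "v \<in> V - {y}" "p v \<in> path_image (\<gamma>' e)"
    show "v \<in> e"
    proof (cases "e = {x, z}")
      case True then show ?thesis using on v new by simp
    next
      case False then show ?thesis using D1(3)[of e v] v e old[of e] by simp
    qed
  next
    fix e f assume ef: "e \<in> ?E" "f \<in> ?E" "e \<noteq> f"
    show "path_image (\<gamma>' e) \<inter> path_image (\<gamma>' f) \<subseteq> p ` (e \<inter> f)"
    proof (cases "e = {x, z}")
      case True
      then show ?thesis using meet[of f] ef old[of f] new by (auto simp: Int_commute)
    next
      case False
      show ?thesis
      proof (cases "f = {x, z}")
        case True
        then show ?thesis using meet[of e] ef old[of e] new by auto
      next
        case F: False
        then show ?thesis using D1(4)[of e f] False ef old[of e] old[of f] by simp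
      qed
    qed
  qed
  moreover have "(\<Union>e\<in>?E. path_image (\<gamma>' e)) \<subseteq> (\<Union>e\<in>E. path_image (\<gamma> e))"
  proof
    fix w assume "w \<in> (\<Union>e\<in>?E. path_image (\<gamma>' e))"
    then consider "w \<in> path_image g" | e where "e \<in> E" "w \<in> path_image (\<gamma> e)"
      using new old by auto
    then show "w \<in> (\<Union>e\<in>E. path_image (\<gamma> e))" using y(1,2) unfolding g by cases blast+
  qed
  ultimately show ?thesis using outerplanar_redraw[OF D fr, of "V - {y}"] by blast
qed

section \<open>Neighbours\<close>

definition neighbours :: "'a set set \<Rightarrow> 'a \<Rightarrow> 'a set" where
  "neighbours E v = {u. {v, u} \<in> E}"

lemma simple_graph_edgeE:
  assumes "simple_graph V E" "e \<in> E"
  obtains u v where "e = {u, v}" "u \<noteq> v" "u \<in> V" "v \<in> V"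
  using assms by (auto simp: simple_graph_def card_2_iff)

lemma simple_graph_edge_other:
  assumes "simple_graph V E" "e \<in> E" "v \<in> e"
  obtains u where "e = {v, u}" "u \<noteq> v"
  using simple_graph_edgeE[OF assms(1,2)] assms(3) by (metis insert_commute insertE singletonD)

lemma simple_graph_no_loop:
  assumes "simple_graph V E" "{u, v} \<in> E"
  shows "u \<noteq> v"
  using assms by (fastforce simp: simple_graph_def)

lemma simple_graph_subset:
  assumes "simple_graph V E" "E' \<subseteq> E"
  shows "simple_graph V E'"
  using assms by (auto simp: simple_graph_def)

lemma simple_graph_finite_edges:
  assumes "simple_graph V E"
  shows "finite E"
  using assms by (auto simp: simple_graph_def intro: finite_subset[of E "Pow V"])

lemma simple_graph_finite_neighbours:
  assumes "simple_graph V E"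
  shows "finite (neighbours E v)"
proof (rule finite_subset)
  show "neighbours E v \<subseteq> V" "finite V" using assms by (auto simp: simple_graph_def neighbours_def)
qed

lemma card_neighbours:
  assumes "simple_graph V E"
  shows "card (neighbours E v) = vdegree E v"
proof -
  have "bij_betw (\<lambda>u. {v, u}) (neighbours E v) {e \<in> E. v \<in> e}"
    unfolding bij_betw_def
  proof
    show "inj_on (\<lambda>u. {v, u}) (neighbours E v)" by (auto simp: inj_on_def doubleton_eq_iff)
    show "(\<lambda>u. {v, u}) ` neighbours E v = {e \<in> E. v \<in> e}"
    proof
      show "{e \<in> E. v \<in> e} \<subseteq> (\<lambda>u. {v, u}) ` neighbours E v"
      proof
        fix e assume "e \<in> {e \<in> E. v \<in> e}"
        then have e: "e \<in> E" "v \<in> e" by auto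
        then obtain u where "e = {v, u}" using simple_graph_edge_other[OF assms] by metis
        then show "e \<in> (\<lambda>u. {v, u}) ` neighbours E v" using e by (auto simp: neighbours_def)
      qed
    qed (auto simp: neighbours_def)
  qed
  then show ?thesis unfolding vdegree_def by (rule bij_betw_same_card)
qed

section \<open>Cycles and paths from lists\<close>

lemma graph_cycle_of_list:
  assumes "distinct xs" "3 \<le> length xs" "successively (\<lambda>u v. {u, v} \<in> E) xs" "{last xs, hd xs} \<in> E"
  shows "graph_cycle E (length xs) (\<lambda>k. xs ! (k mod length xs))"
proof -
  let ?n = "length xs"
  have n: "0 < ?n" "xs \<noteq> []" using assms(2) by auto
  have "{xs ! (k mod ?n), xs ! (Suc k mod ?n)} \<in> E" for k
  proof (cases "Suc (k mod ?n) = ?n")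
    case True
    then have "Suc k mod ?n = 0" "k mod ?n = ?n - 1" by (auto simp: mod_Suc)
    then show ?thesis using assms(4) n by (simp add: last_conv_nth hd_conv_nth)
  next
    case False
    then have "Suc k mod ?n = Suc (k mod ?n)" by (simp add: mod_Suc)
    moreover have "Suc (k mod ?n) < ?n" using False n by (simp add: Suc_lessI)
    ultimately show ?thesis using assms(3) by (simp add: successively_conv_nth)
  qed
  moreover have "inj_on (\<lambda>k. xs ! (k mod ?n)) {..<?n}"
    using assms(1) by (auto simp: inj_on_def nth_eq_iff_index_eq)
  ultimately show ?thesis using assms(2) by (simp add: graph_cycle_def)
qed

lemma graph_path_of_list:
  assumes "distinct xs" "2 \<le> length xs" "successively (\<lambda>u v. {u, v} \<in> E) xs"
  shows "graph_path E (\<lambda>k. xs ! k) 0 (length xs - 1)"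
  using assms by (auto simp: graph_path_def inj_on_def nth_eq_iff_index_eq segment_edges_def
      successively_conv_nth)

lemma graph_path_rev:
  assumes "graph_path E c i j"
  shows "graph_path E (\<lambda>k. c (j - k)) 0 (j - i)"
proof -
  have ij: "i < j" and inj: "inj_on c {i..j}" and E: "segment_edges c i j \<subseteq> E"
    using assms by (auto simp: graph_path_def)
  have "inj_on (\<lambda>k. c (j - k)) {0..j - i}"
  proof (rule inj_onI)
    fix k l assume kl: "k \<in> {0..j - i}" "l \<in> {0..j - i}" "c (j - k) = c (j - l)"
    have "j - k = j - l" by (rule inj_onD[OF inj kl(3)]) (use kl ij in auto)
    then show "k = l" using kl by auto
  qed
  moreover have "segment_edges (\<lambda>k. c (j - k)) 0 (j - i) \<subseteq> segment_edges c i j"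
  proof
    fix e assume "e \<in> segment_edges (\<lambda>k. c (j - k)) 0 (j - i)"
    then obtain k where k: "k < j - i" "e = {c (j - k), c (j - Suc k)}"
      by (auto simp: segment_edges_def)
    then have "e = {c (j - Suc k), c (Suc (j - Suc k))}"
      by (metis Suc_diff_Suc diff_le_self insert_commute less_le_trans)
    moreover have "j - Suc k \<in> {i..<j}" using k ij by auto
    ultimately show "e \<in> segment_edges c i j" by (auto simp: segment_edges_def)
  qed
  ultimately show ?thesis using E ij by (auto simp: graph_path_def)
qed

text \<open>When the walk returns to an earlier vertex, the list is cut back to that vertex. All
  entries other than \<open>a\<close> are targets of \<open>R\<close>, so what holds for these
  targets carries over to them.\<close>

lemma rtrancl_distinct_list:
  assumes "(a, b) \<in> R\<^sup>*"
  shows "\<exists>xs. xs \<noteq> [] \<and> distinct xs \<and> hd xs = a \<and> last xs = b \<and>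
    successively (\<lambda>u v. (u, v) \<in> R) xs \<and> set xs \<subseteq> insert a (Range R)"
  using assms
proof (induction rule: rtrancl_induct)
  case base
  show ?case by (intro exI[of _ "[a]"]) simp
next
  case (step b c)
  then obtain xs where xs: "xs \<noteq> []" "distinct xs" "hd xs = a" "last xs = b"
    "successively (\<lambda>u v. (u, v) \<in> R) xs" "set xs \<subseteq> insert a (Range R)" by blast
  show ?case
  proof (cases "c \<in> set xs")
    case True
    then obtain ys zs where s: "xs = (ys @ [c]) @ zs" by (metis append.assoc append_Cons append_Nil split_list)
    then have "successively (\<lambda>u v. (u, v) \<in> R) (ys @ [c])" using xs(5) by (simp add: successively_append_iff)
    moreover have "hd (ys @ [c]) = a" using xs(3) s by (cases ys) auto
    ultimately show ?thesis using xs(2,6) s by (intro exI[of _ "ys @ [c]"]) auto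
  next
    case False
    then show ?thesis using xs step by (intro exI[of _ "xs @ [c]"])
      (auto simp: successively_append_iff Range.intros)
  qed
qed

section \<open>Reducible configurations\<close>

definition edge_cut :: "'a set set \<Rightarrow> 'a set \<Rightarrow> 'a set set" where
  "edge_cut E S = {e \<in> E. e \<inter> S \<noteq> {} \<and> \<not> e \<subseteq> S}"

text \<open>For edges with two ends only those inside \<open>S\<close> are counted: this is
  2-edge-connectivity of the subgraph induced by \<open>S\<close>, whatever leaves
  \<open>S\<close>.\<close>

definition two_edge_connected :: "'a set set \<Rightarrow> 'a set \<Rightarrow> bool" where
  "two_edge_connected E S \<longleftrightarrow>
     (\<forall>T. T \<noteq> {} \<longrightarrow> T \<subset> S \<longrightarrow> 2 \<le> card {e \<in> E. e \<inter> T \<noteq> {} \<and> e \<inter> (S - T) \<noteq> {}})"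

text \<open>The only edge that may leave \<open>S\<close> has one end in \<open>S\<close>, so it
  misses \<open>T\<close> or \<open>S - T\<close>. The cut of the part that it misses consists of
  edges between \<open>T\<close> and \<open>S - T\<close>, and minimality gives at least two of
  them.\<close>

lemma two_edge_connected_minimal:
  assumes G: "simple_graph V E" and S: "finite S" "card (edge_cut E S) \<le> 1"
    and min: "\<And>T. T \<noteq> {} \<Longrightarrow> T \<subset> S \<Longrightarrow> 1 < card (edge_cut E T)"
  shows "two_edge_connected E S"
  unfolding two_edge_connected_def
proof (intro allI impI)
  fix T assume T: "T \<noteq> {}" "T \<subset> S"
  define D where "D = {e \<in> E. e \<inter> T \<noteq> {} \<and> e \<inter> (S - T) \<noteq> {}}"
  note fin = simple_graph_finite_edges[OF G]
  have finD: "finite D" using fin by (simp add: D_def)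
  have fincut: "finite (edge_cut E S)" using fin by (simp add: edge_cut_def)
  have sub: "edge_cut E X \<subseteq> {e \<in> E. e \<inter> X \<noteq> {} \<and> e \<inter> (S - X) \<noteq> {}}"
    if "X \<subseteq> S" "\<And>e. e \<in> edge_cut E S \<Longrightarrow> e \<inter> X = {}" for X
  proof
    fix e assume e: "e \<in> edge_cut E X"
    then have "e \<inter> X \<noteq> {}" "e \<in> E" "\<not> e \<subseteq> X" by (auto simp: edge_cut_def)
    then have "e \<subseteq> S" using that e by (auto simp: edge_cut_def)
    then show "e \<in> {e \<in> E. e \<inter> X \<noteq> {} \<and> e \<inter> (S - X) \<noteq> {}}" using e by (auto simp: edge_cut_def)
  qed
  have "1 < card D"
  proof (cases "\<exists>f \<in> edge_cut E S. f \<inter> T \<noteq> {}")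
    case False
    then have "edge_cut E T \<subseteq> D" unfolding D_def using sub[of T] T by blast
    then have "card (edge_cut E T) \<le> card D" using finD by (rule card_mono[rotated])
    then show ?thesis using min[OF T] by simp
  next
    case True
    then obtain f u where f: "f \<in> edge_cut E S" "u \<in> f" "u \<in> T" by blast
    then obtain w where "f = {u, w}" using simple_graph_edge_other[OF G, of f u] by (auto simp: edge_cut_def)
    then have "f \<inter> (S - T) = {}" using f T by (auto simp: edge_cut_def)
    moreover have "e = f" if "e \<in> edge_cut E S" for e
      using S(2) f(1) that fincut by (metis One_nat_def card_le_Suc0_iff_eq)
    ultimately have "edge_cut E (S - T) \<subseteq> {e \<in> E. e \<inter> (S - T) \<noteq> {} \<and> e \<inter> (S - (S - T)) \<noteq> {}}"
      by (intro sub) auto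
    also have "\<dots> = D" using T by (auto simp: D_def)
    finally have "card (edge_cut E (S - T)) \<le> card D" using finD by (rule card_mono[rotated])
    moreover have "S - T \<noteq> {}" "S - T \<subset> S" using T by auto
    ultimately show ?thesis using min[of "S - T"] by simp
  qed
  then show "2 \<le> card {e \<in> E. e \<inter> T \<noteq> {} \<and> e \<inter> (S - T) \<noteq> {}}" by (simp add: D_def)
qed

lemma two_edge_connectedE:
  assumes G: "simple_graph V E" and "two_edge_connected E S" "T \<noteq> {}" "T \<subset> S"
  obtains q1 v1 q2 v2 where "{q1, v1} \<in> E" "{q2, v2} \<in> E" "{q1, v1} \<noteq> {q2, v2}"
    "q1 \<in> T" "q2 \<in> T" "v1 \<in> S - T" "v2 \<in> S - T"
proof -
  let ?D = "{e \<in> E. e \<inter> T \<noteq> {} \<and> e \<inter> (S - T) \<noteq> {}}"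
  have "2 \<le> card ?D" using assms(2-4) by (simp add: two_edge_connected_def)
  then have "\<not> card ?D \<le> 1" by simp
  moreover have "finite ?D" using simple_graph_finite_edges[OF G] by simp
  ultimately have "\<not> (\<forall>e1\<in>?D. \<forall>e2\<in>?D. e1 = e2)" using card_le_Suc0_iff_eq[of ?D] by simp
  then obtain e1 e2 where e: "e1 \<in> ?D" "e2 \<in> ?D" "e1 \<noteq> e2" by blast
  have *: "\<exists>q v. e = {q, v} \<and> q \<in> T \<and> v \<in> S - T" if D: "e \<in> ?D" for e
  proof -
    obtain q v where q: "q \<in> e" "q \<in> T" and v: "v \<in> e" "v \<in> S - T" using D by blast
    have "e \<in> E" using D by simp
    then obtain w where "e = {q, w}" using simple_graph_edge_other[OF G _ q(1)] by metis
    then show ?thesis using q v by blast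
  qed
  obtain q1 v1 where "e1 = {q1, v1}" "q1 \<in> T" "v1 \<in> S - T" using *[OF e(1)] by blast
  moreover obtain q2 v2 where "e2 = {q2, v2}" "q2 \<in> T" "v2 \<in> S - T" using *[OF e(2)] by blast
  ultimately show thesis using that[of q1 v1 q2 v2] e by auto
qed

section \<open>Cycles in 2-edge-connected sets\<close>

lemma two_edge_connected_cycle:
  assumes G: "simple_graph V E" and S: "finite S" "2 \<le> card S" "two_edge_connected E S"
  obtains n c where "graph_cycle E n c" "range c \<subseteq> S"
proof -
  let ?P = "\<lambda>xs. xs \<noteq> [] \<and> distinct xs \<and> set xs \<subseteq> S \<and> successively (\<lambda>u v. {u, v} \<in> E) xs"
  obtain s where "s \<in> S" using S(2) by fastforce
  then have "?P [s]" by simp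
  moreover have "\<forall>xs. ?P xs \<longrightarrow> length xs < Suc (card S)"
    using S(1) by (metis card_mono distinct_card less_Suc_eq_le)
  \<comment> \<open>A longest path within \<open>S\<close>: its first vertex has two neighbours in
    \<open>S\<close>, and by maximality both lie on the path.\<close>
  ultimately obtain xs where xs: "?P xs" and max: "\<And>ys. ?P ys \<Longrightarrow> length ys \<le> length xs"
    using ex_has_greatest_nat[of ?P "[s]" length "Suc (card S)"] by blast
  let ?x = "hd xs"
  have "{?x} \<subset> S" using xs S(2) by (cases xs) (auto simp: psubset_eq)
  then obtain v1 v2 where v: "{?x, v1} \<in> E" "{?x, v2} \<in> E" "v1 \<noteq> v2" "v1 \<in> S - {?x}" "v2 \<in> S - {?x}"
    using two_edge_connectedE[OF G S(3), of "{?x}"] by (metis empty_not_insert singletonD)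
  have onpath: "v \<in> set xs" if "{?x, v} \<in> E" "v \<in> S" for v
  proof (rule ccontr)
    assume "v \<notin> set xs"
    then have "?P (v # xs)" using xs that by (auto simp: successively_Cons insert_commute)
    then show False using max[of "v # xs"] by simp
  qed
  obtain a b where ab: "a < length xs" "xs ! a = v1" "b < length xs" "xs ! b = v2"
    using onpath v by (metis DiffD1 in_set_conv_nth)
  have "xs ! 0 = ?x" using xs by (simp add: hd_conv_nth)
  then have "a \<noteq> 0" "b \<noteq> 0" "a \<noteq> b" using ab v(3-5) by (metis DiffD2 singletonI)+
  \<comment> \<open>Of two distinct positions other than 0 one is at least 2, and the path up to
    there closes to a cycle of length at least 3.\<close>
  then obtain m where m: "2 \<le> m" "m < length xs" "{?x, xs ! m} \<in> E"
    using ab v by (metis One_nat_def Suc_leI le_neq_implies_less neq0_conv numeral_2_eq_2)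
  let ?ys = "take (Suc m) xs"
  have ys: "xs = ?ys @ drop (Suc m) xs" by simp
  have "graph_cycle E (length ?ys) (\<lambda>k. ?ys ! (k mod length ?ys))"
  proof (rule graph_cycle_of_list)
    show "distinct ?ys" "3 \<le> length ?ys" using xs m by auto
    show "successively (\<lambda>u v. {u, v} \<in> E) ?ys"
      using xs ys successively_append_iff by metis
    have "last ?ys = xs ! m" using m by (simp add: take_Suc_conv_app_nth)
    moreover have "hd ?ys = ?x" using xs by simp
    ultimately show "{last ?ys, hd ?ys} \<in> E" using m by (simp add: insert_commute)
  qed
  moreover have "range (\<lambda>k. ?ys ! (k mod length ?ys)) \<subseteq> S"
  proof
    fix w assume "w \<in> range (\<lambda>k. ?ys ! (k mod length ?ys))"
    then obtain k where "w = ?ys ! (k mod length ?ys)" by blast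
    moreover have "k mod length ?ys < length ?ys" using m by (intro mod_less_divisor) simp
    ultimately have "w \<in> set ?ys" using nth_mem by metis
    then show "w \<in> S" using xs set_take_subset[of "Suc m" xs] by blast
  qed
  ultimately show thesis by (rule that)
qed

lemma graph_cycle_extend:
  assumes c: "graph_cycle E n c" and qs: "qs \<noteq> []" "distinct qs" "set qs \<inter> range c = {}"
    and succ: "successively (\<lambda>u v. {u, v} \<in> E) qs" and ends: "{c i, hd qs} \<in> E" "{last qs, c (Suc i)} \<in> E"
  obtains c' where "graph_cycle E (n + length qs) c'" "range c' \<subseteq> range c \<union> set qs"
proof -
  have n: "3 \<le> n" using c by (simp add: graph_cycle_def)
  \<comment> \<open>One turn of the cycle from \<open>c (Suc i)\<close> to \<open>c (i + n)\<close>,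
    which is \<open>c i\<close>; then \<open>qs\<close> fills the gap between the two.\<close>
  define xs where "xs = map c [Suc i..<Suc i + n] @ qs"
  have len: "length xs = n + length qs" by (simp add: xs_def)
  have inj: "inj_on c {Suc i..<Suc i + n}"
    by (rule inj_on_subset[OF graph_cycle_inj[OF c, of "i + n" "Suc i"]]) auto
  have [simp]: "last [Suc i..<Suc i + n] = i + n" using n by (simp add: last_conv_nth)
  have ne: "map c [Suc i..<Suc i + n] \<noteq> []" using n by simp
  have per: "c (i + n) = c i" using c by (simp add: graph_cycle_def)
  have "graph_cycle E (length xs) (\<lambda>k. xs ! (k mod length xs))"
  proof (rule graph_cycle_of_list)
    have "distinct (map c [Suc i..<Suc i + n])" using inj by (simp only: distinct_map distinct_upt set_upt)
    then show "distinct xs" using qs(2,3) by (auto simp: xs_def simp del: upt_Suc)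
    show "3 \<le> length xs" using n len by simp
    have "successively (\<lambda>u v. {u, v} \<in> E) (map c [Suc i..<Suc i + n])"
      using c by (auto simp: successively_conv_nth graph_cycle_def simp del: upt_Suc)
    moreover have "last (map c [Suc i..<Suc i + n]) = c i"
      using ne per by (subst last_map) auto
    ultimately show "successively (\<lambda>u v. {u, v} \<in> E) xs"
      using succ ends(1) by (simp add: xs_def successively_append_iff del: upt_Suc)
    have "hd xs = c (Suc i)" using n by (simp add: xs_def upt_rec)
    then show "{last xs, hd xs} \<in> E" using ends(2) qs(1) by (simp add: xs_def)
  qed
  moreover have "range (\<lambda>k. xs ! (k mod length xs)) \<subseteq> range c \<union> set qs"
  proof
    fix w assume "w \<in> range (\<lambda>k. xs ! (k mod length xs))"
    then obtain k where "w = xs ! (k mod length xs)" by blast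
    moreover have "k mod length xs < length xs" using n len by (intro mod_less_divisor) simp
    ultimately have "w \<in> set xs" using nth_mem by metis
    then show "w \<in> range c \<union> set qs" by (auto simp: xs_def)
  qed
  ultimately show thesis using that len by metis
qed

text \<open>If the ends of the ear were not consecutive on the cycle, the ear and both arcs of the
  cycle would have inner vertices and form a forbidden theta. Between consecutive vertices the ear
  is a detour that lengthens the cycle.\<close>

lemma graph_cycle_ear:
  assumes G: "simple_graph V E" "outerplanar V E" and c: "graph_cycle E n c"
    and qs: "qs \<noteq> []" "distinct qs" "set qs \<inter> range c = {}"
    and succ: "successively (\<lambda>u v. {u, v} \<in> E) qs"
    and ends: "{c i, hd qs} \<in> E" "{last qs, c j} \<in> E" "i < j" "j < i + n"
  obtains n' c' where "graph_cycle E n' c'" "n < n'" "range c' \<subseteq> range c \<union> set qs"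
proof -
  have per: "c (i + n) = c i" using c by (simp add: graph_cycle_def)
  have pos: "0 < length qs" using qs by simp
  consider "j = Suc i" | "Suc j = i + n" | "i + 2 \<le> j" "j + 2 \<le> i + n" using ends by linarith
  then show thesis
  proof cases
    case 1
    then show thesis using graph_cycle_extend[OF c qs succ, of i] ends that pos by (metis less_add_same_cancel1)
  next
    case 2
    \<comment> \<open>The consecutive pair is now \<open>c j\<close> and \<open>c (Suc j)\<close>,
      which is \<open>c i\<close>, so the ear is traversed backwards.\<close>
    have "successively (\<lambda>u v. {u, v} \<in> E) (rev qs)" using succ by (simp add: insert_commute)
    moreover have "{c j, hd (rev qs)} \<in> E" "{last (rev qs), c (Suc j)} \<in> E"
      using ends 2 per qs by (auto simp: hd_rev last_rev insert_commute)
    ultimately show thesis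
      using graph_cycle_extend[OF c, of "rev qs" j] qs that pos
      by (metis distinct_rev length_rev less_add_same_cancel1 rev_is_Nil_conv set_rev)
  next
    case 3
    define ys where "ys = c i # qs @ [c j]"
    have ij: "i < j" "j < i + n" using ends by auto
    have "c i \<noteq> c j"
      using inj_onD[OF graph_cycle_inj[OF c ij(2)], of i j] ij by auto
    then have dy: "distinct ys" using qs by (auto simp: ys_def)
    have ly: "3 \<le> length ys" using pos by (simp add: ys_def Suc_le_eq)
    have "successively (\<lambda>u v. {u, v} \<in> E) ys"
      using succ ends qs by (auto simp: ys_def successively_Cons successively_append_iff)
    then have p3: "graph_path E (\<lambda>k. ys ! k) 0 (length ys - 1)"
      using graph_path_of_list[OF dy] ly by simp
    have im3: "(\<lambda>k. ys ! k) ` {0..length ys - 1} = set ys"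
    proof -
      have "{0..length ys - 1} = {..<length ys}" using ly by auto
      then show ?thesis by (auto simp: set_conv_nth)
    qed
    have p1: "graph_path E c i j" using graph_cycle_path[OF c ij] .
    have "graph_path E c j (i + n)" using graph_cycle_path[OF c, of j "i + n"] ij by simp
    then have p2: "graph_path E (\<lambda>k. c (i + n - k)) 0 (i + n - j)" by (rule graph_path_rev)
    have im2: "(\<lambda>k. c (i + n - k)) ` {0..i + n - j} = c ` {j..i + n}"
    proof -
      have "(\<lambda>k. i + n - k) ` {0..i + n - j} = {j..i + n}"
      proof (rule set_eqI, rule iffI)
        fix k assume "k \<in> {j..i + n}"
        then have "k = i + n - (i + n - k)" "i + n - k \<in> {0..i + n - j}" using ij by auto
        then show "k \<in> (\<lambda>k. i + n - k) ` {0..i + n - j}" by blast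
      qed (use ij in auto)
      then show ?thesis by (metis image_image)
    qed
    have y: "ys ! 0 = c i" "ys ! (length ys - 1) = c j"
      by (auto simp: ys_def nth_append)
    have out: "set ys \<inter> c ` X \<subseteq> {c i, c j}" for X using qs(3) by (auto simp: ys_def)
    have "False"
    proof (rule outerplanar_no_theta[OF G p1 3(1) refl refl p2 _ _ _ p3 _ y])
      show "0 + 2 \<le> i + n - j" using 3 by simp
      show "c (i + n - 0) = c i" "c (i + n - (i + n - j)) = c j" using per ij by auto
      show "0 + 2 \<le> length ys - 1" using ly by simp
      show "c ` {i..j} \<inter> (\<lambda>k. c (i + n - k)) ` {0..i + n - j} \<subseteq> {c i, c j}"
        unfolding im2 using graph_cycle_segment_Int[OF c ij] .
      show "c ` {i..j} \<inter> (!) ys ` {0..length ys - 1} \<subseteq> {c i, c j}"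
        using out[of "{i..j}"] unfolding im3 by blast
      show "(\<lambda>k. c (i + n - k)) ` {0..i + n - j} \<inter> (!) ys ` {0..length ys - 1} \<subseteq> {c i, c j}"
        using out[of "{j..i + n}"] unfolding im2 im3 by blast
    qed
    then show thesis ..
  qed
qed

text \<open>By 2-edge-connectivity a component of \<open>S\<close> off the cycle sends two edges to
  it. They end in different vertices, as a common one would have degree 4; so a path through the
  component is an ear, and a longer cycle arises.\<close>

lemma longest_cycle_spans:
  assumes G: "simple_graph V E" "outerplanar V E" and deg: "\<And>v. v \<in> \<Union>E \<Longrightarrow> vdegree E v \<le> 3"
    and S: "two_edge_connected E S" and c: "graph_cycle E n c" "range c \<subseteq> S"
    and longest: "\<And>n' c'. graph_cycle E n' c' \<Longrightarrow> range c' \<subseteq> S \<Longrightarrow> n' \<le> n"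
  shows "range c = S"
proof (rule ccontr)
  assume "range c \<noteq> S"
  then obtain q0 where q0: "q0 \<in> S - range c" using c(2) by blast
  have n: "3 \<le> n" using c by (simp add: graph_cycle_def)
  \<comment> \<open>\<open>Q\<close> will be the component of \<open>q0\<close> in what the cycle
    leaves of \<open>S\<close>.\<close>
  define R where "R = {(u, v). {u, v} \<in> E \<and> u \<in> S - range c \<and> v \<in> S - range c}"
  define Q where "Q = {q. (q0, q) \<in> R\<^sup>*}"
  have QS: "Q \<subseteq> S - range c"
  proof
    fix q assume "q \<in> Q"
    then have "(q0, q) \<in> R\<^sup>*" by (simp add: Q_def)
    then show "q \<in> S - range c" by (cases rule: rtranclE) (use q0 in \<open>auto simp: R_def\<close>)
  qed
  have "Q \<noteq> {}" by (auto simp: Q_def)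
  have "c 0 \<in> S - Q" using c(2) QS by auto
  then have "Q \<subset> S" using QS by blast
  obtain q1 v1 q2 v2 where qv: "{q1, v1} \<in> E" "{q2, v2} \<in> E" "{q1, v1} \<noteq> {q2, v2}"
    "q1 \<in> Q" "q2 \<in> Q" "v1 \<in> S - Q" "v2 \<in> S - Q"
    by (rule two_edge_connectedE[OF G(1) S \<open>Q \<noteq> {}\<close> \<open>Q \<subset> S\<close>])
  have inC: "v \<in> range c" if "{q, v} \<in> E" "q \<in> Q" "v \<in> S - Q" for q v
  proof (rule ccontr)
    assume "v \<notin> range c"
    then have "(q, v) \<in> R" using that QS by (auto simp: R_def)
    then have "v \<in> Q" using that(2) unfolding Q_def by (auto intro: rtrancl_into_rtrancl)
    then show False using that(3) by blast
  qed
  have "0 < n" using n by simp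
  then have idx: "\<exists>k<n. v = c k" if "v \<in> range c" for v
    using that graph_cycle_mod[OF c(1)] by (metis imageE mod_less_divisor)
  obtain i where i: "i < n" "v1 = c i" using idx[OF inC[OF qv(1,4,6)]] by blast
  obtain j0 where j0: "j0 < n" "v2 = c j0" using idx[OF inC[OF qv(2,5,7)]] by blast
  have "v1 \<noteq> v2"
  proof
    assume eq: "v1 = v2"
    then have q12: "q1 \<noteq> q2" using qv by blast
    \<comment> \<open>Shifted by one period, so that the predecessor on the cycle has an index even
      for \<open>i = 0\<close>.\<close>
    let ?k = "i + n"
    have inj: "inj_on c {?k - 1..?k + 1}" by (rule graph_cycle_inj[OF c(1)]) (use n in simp)
    have v1: "v1 = c ?k" using i c(1) by (simp add: graph_cycle_def)
    have "?k - 1 \<in> {?k - 1..?k + 1}" "?k + 1 \<in> {?k - 1..?k + 1}" "?k - 1 \<noteq> ?k + 1"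
      unfolding atLeastAtMost_iff using n by linarith+
    then have d: "c (?k - 1) \<noteq> c (?k + 1)" using inj_onD[OF inj] by metis
    have e: "{c k, c (Suc k)} \<in> E" for k using c(1) by (simp add: graph_cycle_def)
    have "Suc (?k - 1) = ?k" using n by simp
    then have "{c (?k - 1), v1} \<in> E" "{v1, c (?k + 1)} \<in> E" using e[of "?k - 1"] e[of ?k] v1 by auto
    then have sub: "{q1, q2, c (?k - 1), c (?k + 1)} \<subseteq> neighbours E v1"
      using qv(1,2) eq by (auto simp: neighbours_def insert_commute)
    have "card {q1, q2, c (?k - 1), c (?k + 1)} = 4"
    proof -
      have "q1 \<notin> range c" "q2 \<notin> range c" using QS qv(4,5) by auto
      then have "q1 \<noteq> c k" "q2 \<noteq> c k" for k by auto
      then show ?thesis using q12 d by simp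
    qed
    then have "4 \<le> card (neighbours E v1)"
      using card_mono[OF simple_graph_finite_neighbours[OF G(1)] sub] by simp
    moreover have "v1 \<in> \<Union>E" using qv(1) by blast
    ultimately show False using deg[of v1] card_neighbours[OF G(1), of v1] by simp
  qed
  then have ij0: "i \<noteq> j0" using i j0 by blast
  \<comment> \<open>Places the second attachment within one turn after the first.\<close>
  define j where "j = (if i < j0 then j0 else j0 + n)"
  have j: "i < j" "j < i + n" "v2 = c j"
    using ij0 i j0 c(1) by (auto simp: j_def graph_cycle_def)
  have sym: "sym R" by (auto simp: R_def sym_def insert_commute)
  have "(q1, q0) \<in> R\<^sup>*" using qv(4) sym_rtrancl[OF sym] by (auto simp: Q_def dest: symD)
  then have "(q1, q2) \<in> R\<^sup>*" using qv(5) by (auto simp: Q_def)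
  then obtain qs where qs: "qs \<noteq> []" "distinct qs" "hd qs = q1" "last qs = q2"
    "successively (\<lambda>u v. (u, v) \<in> R) qs" "set qs \<subseteq> insert q1 (Range R)"
    using rtrancl_distinct_list[OF \<open>(q1, q2) \<in> R\<^sup>*\<close>] by blast
  have setqs: "set qs \<subseteq> S - range c" using qs(6) qv(4) QS by (auto simp: R_def)
  have "successively (\<lambda>u v. {u, v} \<in> E) qs"
    by (rule successively_mono[OF qs(5)]) (auto simp: R_def)
  moreover have "set qs \<inter> range c = {}" using setqs by blast
  moreover have "{c i, hd qs} \<in> E" "{last qs, c j} \<in> E"
    using qv(1,2) qs(3,4) i(2) j(3) by (simp_all add: insert_commute)
  ultimately obtain n' c' where "graph_cycle E n' c'" "n < n'" "range c' \<subseteq> range c \<union> set qs"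
    using graph_cycle_ear[OF G c(1) qs(1,2) _ _ _ _ j(1,2)] by metis
  moreover from this have "range c' \<subseteq> S" using setqs c(2) by blast
  ultimately show False using longest[of n' c'] by simp
qed

text \<open>A vertex set that is minimal with at most one leaving edge is spanned by a cycle, and the
  configuration is found below a shortest chord of this cycle.\<close>

lemma outerplanar_reducible_configuration:
  assumes G: "simple_graph V E" "outerplanar V E" and "E \<noteq> {}"
    and deg: "\<And>v. v \<in> \<Union>E \<Longrightarrow> 2 \<le> vdegree E v \<and> vdegree E v \<le> 3"
  obtains (adjacent) x y where "{x, y} \<in> E" "vdegree E x = 2" "vdegree E y = 2"
  | (triangle) t x y where "{t, x} \<in> E" "{t, y} \<in> E" "{x, y} \<in> E" "vdegree E t = 2"
proof -
  have finU: "finite (\<Union>E)" using G(1) by (auto simp: simple_graph_def intro: finite_subset[of _ V])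
  let ?P = "\<lambda>S. S \<noteq> {} \<and> S \<subseteq> \<Union>E \<and> card (edge_cut E S) \<le> 1"
  have "edge_cut E (\<Union>E) = {}" by (auto simp: edge_cut_def)
  moreover have "\<Union>E \<noteq> {}"
  proof -
    obtain e where "e \<in> E" using assms(3) by blast
    moreover from this obtain u v where "e = {u, v}" by (rule simple_graph_edgeE[OF G(1)])
    ultimately show ?thesis by blast
  qed
  ultimately have "?P (\<Union>E)" by simp
  \<comment> \<open>An end piece of the graph: fewest vertices among the pieces with at most one
    leaving edge. The set of all covered vertices is such a piece, as no edge leaves it.\<close>
  then obtain S where S: "?P S" and min: "\<And>T. ?P T \<Longrightarrow> card S \<le> card T"
    using ex_has_least_nat[of ?P "\<Union>E" card] by blast
  have finS: "finite S" using S finU finite_subset by blast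
  have tec: "two_edge_connected E S"
  proof (rule two_edge_connected_minimal[OF G(1) finS])
    show "card (edge_cut E S) \<le> 1" using S by blast
    fix T assume T: "T \<noteq> {}" "T \<subset> S"
    then have "card T < card S" using finS psubset_card_mono by blast
    then have "\<not> ?P T" using min[of T] by linarith
    moreover have "T \<noteq> {}" "T \<subseteq> \<Union>E" using T S by auto
    ultimately show "1 < card (edge_cut E T)" by linarith
  qed
  \<comment> \<open>At a single vertex every edge leaves, and there are at least two.\<close>
  have "2 \<le> card S"
  proof (rule ccontr)
    assume "\<not> 2 \<le> card S"
    moreover have "card S \<noteq> 0" using S finS by simp
    ultimately obtain v where v: "S = {v}" by (metis One_nat_def card_1_singletonE less_2_cases not_le)
    have "edge_cut E {v} = {e \<in> E. v \<in> e}"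
    proof
      show "{e \<in> E. v \<in> e} \<subseteq> edge_cut E {v}"
      proof
        fix e assume "e \<in> {e \<in> E. v \<in> e}"
        then have e: "e \<in> E" "v \<in> e" by auto
        then obtain u where "e = {v, u}" "u \<noteq> v" using simple_graph_edge_other[OF G(1)] by metis
        then show "e \<in> edge_cut E {v}" using e by (auto simp: edge_cut_def)
      qed
    qed (auto simp: edge_cut_def)
    then show False using S v deg[of v] by (auto simp: vdegree_def)
  qed
  then obtain n0 c0 where c0: "graph_cycle E n0 c0" "range c0 \<subseteq> S"
    using two_edge_connected_cycle[OF G(1) finS _ tec] by blast
  have bound: "n < Suc (card S)" if "graph_cycle E n c" "range c \<subseteq> S" for n c
  proof -
    have "inj_on c {..<n}" using that by (simp add: graph_cycle_def)
    then have "card {..<n} \<le> card S" using that finS by (intro card_inj_on_le[of c]) auto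
    then show ?thesis by simp
  qed
  obtain n where "\<exists>c. graph_cycle E n c \<and> range c \<subseteq> S"
    and longest: "\<And>m. (\<exists>c. graph_cycle E m c \<and> range c \<subseteq> S) \<Longrightarrow> m \<le> n"
    using ex_has_greatest_nat[of "\<lambda>n. \<exists>c. graph_cycle E n c \<and> range c \<subseteq> S" n0 "\<lambda>n. n" "Suc (card S)"]
      c0 bound by blast
  then obtain c1 where c1: "graph_cycle E n c1" "range c1 \<subseteq> S" by blast
  have span1: "range c1 = S"
    using longest_cycle_spans[OF G _ tec c1] deg longest by blast
  \<comment> \<open>\<open>c1 k0\<close> is the only vertex of \<open>S\<close> at which an edge may
    leave; without a leaving edge any index will do.\<close>
  obtain k0 where k0: "\<And>e k. e \<in> edge_cut E S \<Longrightarrow> c1 k \<in> e \<Longrightarrow> c1 k = c1 k0"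
  proof (cases "edge_cut E S = {}")
    case True then show thesis using that by blast
  next
    case False
    then obtain f where f: "f \<in> edge_cut E S" by blast
    have "finite (edge_cut E S)" using simple_graph_finite_edges[OF G(1)] by (simp add: edge_cut_def)
    then have uniq: "e = f" if "e \<in> edge_cut E S" for e
      using S f that by (metis One_nat_def card_le_Suc0_iff_eq)
    obtain r where r: "r \<in> f" "r \<in> S" using f by (auto simp: edge_cut_def)
    then obtain w where w: "f = {r, w}" using simple_graph_edge_other[OF G(1)] f by (auto simp: edge_cut_def)
    then have "w \<notin> S" using f r by (auto simp: edge_cut_def)
    then have "c1 k = r" if "c1 k \<in> f" for k using w that span1 by auto
    moreover obtain k0 where "r = c1 k0" using r span1 by blast
    ultimately show thesis using that uniq by metis
  qed
  \<comment> \<open>Rotated so that the exceptional vertex becomes \<open>c 0\<close>; at the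
    indices from 1 to \<open>n - 1\<close> all neighbours lie on the cycle.\<close>
  define c where "c k = c1 (k + k0)" for k
  have c: "graph_cycle E n c"
  proof -
    have "inj_on c {..<n}"
    proof (rule inj_onI)
      fix k l assume kl: "k \<in> {..<n}" "l \<in> {..<n}" "c k = c l"
      have "k + k0 = l + k0"
        by (rule inj_onD[OF graph_cycle_inj[OF c1(1), of "k0 + n - 1" k0]])
          (use kl in \<open>auto simp: c_def\<close>)
      then show "k = l" by simp
    qed
    moreover have "c (k + n) = c k" for k
    proof -
      have "c1 (k + k0 + n) = c1 (k + k0)" using c1(1) by (simp add: graph_cycle_def)
      then show ?thesis by (simp add: c_def algebra_simps)
    qed
    moreover have "{c k, c (Suc k)} \<in> E" for k
      using c1(1) by (simp add: c_def graph_cycle_def)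
    moreover have "3 \<le> n" using c1(1) by (simp add: graph_cycle_def)
    ultimately show ?thesis by (simp add: graph_cycle_def)
  qed
  have n: "3 \<le> n" and per: "\<And>k. c (k + n) = c k" and edge: "\<And>k. {c k, c (Suc k)} \<in> E"
    using c by (auto simp: graph_cycle_def)
  have inj: "c k = c l \<Longrightarrow> k < n \<Longrightarrow> l < n \<Longrightarrow> k = l" for k l
    using c by (auto simp: graph_cycle_def inj_on_def)
  have span: "range c = S"
  proof -
    have "c1 k \<in> range c" for k
    proof -
      have "k0 \<le> k0 * n" using n by simp
      then have "k + k0 * n - k0 + k0 = k + k0 * n" by linarith
      then have "c1 k = c (k + k0 * n - k0)"
        unfolding c_def using graph_cycle_mod[OF c1(1), of "k + k0 * n"] graph_cycle_mod[OF c1(1), of k] by simp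
      then show ?thesis by blast
    qed
    then show ?thesis using span1 by (auto simp: c_def)
  qed
  \<comment> \<open>The two gap conditions exclude the edges of the cycle, including the one from
    \<open>c (n - 1)\<close> to \<open>c 0\<close>.\<close>
  define chord where "chord i j \<longleftrightarrow> i < j \<and> j < n \<and> i + 2 \<le> j \<and> j + 2 \<le> i + n \<and> {c i, c j} \<in> E" for i j
  have third: "vdegree E (c k) = 2 \<or> (\<exists>l. chord (min k l) (max k l))" if k: "1 \<le> k" "k < n" for k
  proof (cases "vdegree E (c k) = 2")
    case False
    have "c k \<in> \<Union>E" using edge[of k] by blast
    then have "vdegree E (c k) = 3" using deg[of "c k"] False by linarith
    then have "card (neighbours E (c k)) = 3" using card_neighbours[OF G(1)] by metis
    moreover have "card {c (k - 1), c (Suc k)} \<le> 2" by (simp add: card_insert_if)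
    ultimately have "\<not> neighbours E (c k) \<subseteq> {c (k - 1), c (Suc k)}"
      using card_mono[of "{c (k - 1), c (Suc k)}" "neighbours E (c k)"] by auto
    then obtain u where u: "{c k, u} \<in> E" "u \<noteq> c (k - 1)" "u \<noteq> c (Suc k)" by (auto simp: neighbours_def)
    have "u \<in> S"
    proof (rule ccontr)
      assume "u \<notin> S"
      then have "{c k, u} \<in> edge_cut E S" using u span by (auto simp: edge_cut_def)
      then have "c k = c 0" using k0[of "{c k, u}" "k + k0"] by (simp add: c_def)
      then show False using inj[of k 0] k n by simp
    qed
    then obtain l' where "u = c l'" using span by blast
    then obtain l where l: "l < n" "u = c l"
      using graph_cycle_mod[OF c] n by (metis mod_less_divisor gr_zeroI not_numeral_le_zero)
    have "l \<noteq> k" using u l simple_graph_no_loop[OF G(1)] by blast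
    moreover have "l \<noteq> k - 1" "l \<noteq> Suc k" using u l by auto
    moreover have "Suc k \<noteq> l + n" using u(3) l(2) per[of l] by auto
    moreover have "Suc l \<noteq> k + n"
    proof
      assume "Suc l = k + n"
      then have "l = (k - 1) + n" using k by simp
      then show False using per[of "k - 1"] u(2) l(2) by simp
    qed
    ultimately have "chord (min k l) (max k l)"
      using k l u(1) by (auto simp: chord_def min_def max_def insert_commute)
    then show ?thesis by blast
  qed blast
  show thesis
  proof (cases "\<exists>i j. chord i j")
    case False
    then have "vdegree E (c 1) = 2" "vdegree E (c 2) = 2" using third[of 1] third[of 2] n by auto
    then show thesis using adjacent[of "c 1" "c 2"] edge[of 1] by (simp add: numeral_2_eq_2)
  next
    case True
    \<comment> \<open>Shortest by index difference, not by cyclic length: the indices strictly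
      between \<open>i\<close> and \<open>j\<close> are positive, so the exceptional vertex
      \<open>c 0\<close> is avoided.\<close>
    then obtain i j where ij: "chord i j" and short: "\<And>i' j'. chord i' j' \<Longrightarrow> j - i \<le> j' - i'"
      using ex_has_least_nat[of "\<lambda>(i, j). chord i j" _ "\<lambda>(i, j). j - i"] by (auto split: prod.splits) blast
    have ij': "i + 2 \<le> j" "j < n" "{c i, c j} \<in> E" using ij by (auto simp: chord_def)
    have two: "vdegree E (c m) = 2" if m: "i < m" "m < j" for m
    proof (rule ccontr)
      assume "vdegree E (c m) \<noteq> 2"
      then obtain l where l: "chord (min m l) (max m l)" using third[of m] m ij' by auto
      then have ml: "{c m, c l} \<in> E" "l < n"
        by (auto simp: chord_def min_def max_def insert_commute split: if_splits)
      consider "l < i" | "i \<le> l" "l \<le> j" | "j < l" by linarith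
      then show False
      proof cases
        case 1
        \<comment> \<open>The end \<open>c l\<close> is taken one period later, so that it comes
          after \<open>j\<close> in the cyclic order.\<close>
        then show False
          using outerplanar_no_crossing_chords[OF G c m, of "l + n"] ij' ml per[of l] by simp
      next
        case 2
        then have "max m l - min m l < j - i" using m by (auto simp: min_def max_def)
        then show False using short[OF l] by simp
      next
        case 3
        then show False
          using outerplanar_no_crossing_chords[OF G c m, of l] ij' ml by simp
      qed
    qed
    show thesis
    proof (cases "j = i + 2")
      case True
      then have "{c (Suc i), c i} \<in> E" "{c (Suc i), c j} \<in> E" "vdegree E (c (Suc i)) = 2"
        using edge[of i] edge[of "Suc i"] two[of "Suc i"] by (simp_all add: insert_commute)
      then show thesis using triangle ij'(3) by blast
    next
      case False
      then have "vdegree E (c (Suc i)) = 2" "vdegree E (c (Suc (Suc i))) = 2" using two ij'(1) by auto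
      then show thesis using adjacent edge[of "Suc i"] by blast
    qed
  qed
qed

section \<open>Edge colourings\<close>

text \<open>Colour 0 is the class of the matching, colours 1 to 5 are those of the induced matchings.\<close>

definition packing_coloring :: "'a set set \<Rightarrow> ('a set \<Rightarrow> nat) \<Rightarrow> bool" where
  "packing_coloring E c \<longleftrightarrow> (\<forall>e\<in>E. c e \<le> 5) \<and>
     (\<forall>e\<in>E. \<forall>f\<in>E. e \<noteq> f \<longrightarrow> e \<inter> f \<noteq> {} \<longrightarrow> c e \<noteq> c f) \<and>
     (\<forall>g\<in>E. \<forall>e\<in>E. \<forall>f\<in>E. e \<noteq> f \<longrightarrow> e \<inter> g \<noteq> {} \<longrightarrow> g \<inter> f \<noteq> {} \<longrightarrow> c e = c f \<longrightarrow> c e = 0)"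

definition touching :: "'a set set \<Rightarrow> 'a set \<Rightarrow> 'a set set" where
  "touching E n = {f \<in> E. f \<inter> n \<noteq> {}}"

text \<open>The edges that would be within distance 2 of a new edge \<open>n\<close>; those meeting
  \<open>n\<close> are included by taking \<open>g\<close> to be \<open>f\<close>.\<close>

definition near :: "'a set set \<Rightarrow> 'a set \<Rightarrow> 'a set set" where
  "near E n = {f \<in> E. \<exists>g\<in>E. g \<inter> n \<noteq> {} \<and> g \<inter> f \<noteq> {}}"

lemma packing_coloringD:
  assumes "packing_coloring E c"
  shows "e \<in> E \<Longrightarrow> c e \<le> 5"
    and "e \<in> E \<Longrightarrow> f \<in> E \<Longrightarrow> e \<noteq> f \<Longrightarrow> e \<inter> f \<noteq> {} \<Longrightarrow> c e \<noteq> c f"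
    and "g \<in> E \<Longrightarrow> e \<in> E \<Longrightarrow> f \<in> E \<Longrightarrow> e \<noteq> f \<Longrightarrow> e \<inter> g \<noteq> {} \<Longrightarrow> g \<inter> f \<noteq> {} \<Longrightarrow> c e = c f \<Longrightarrow> c e = 0"
  using assms by (simp_all add: packing_coloring_def)

lemma packing_coloringI:
  assumes "\<And>e. e \<in> E \<Longrightarrow> c e \<le> 5"
    and "\<And>e f. e \<in> E \<Longrightarrow> f \<in> E \<Longrightarrow> e \<noteq> f \<Longrightarrow> e \<inter> f \<noteq> {} \<Longrightarrow> c e \<noteq> c f"
    and "\<And>g e f. g \<in> E \<Longrightarrow> e \<in> E \<Longrightarrow> f \<in> E \<Longrightarrow> e \<noteq> f \<Longrightarrow> e \<inter> g \<noteq> {} \<Longrightarrow> g \<inter> f \<noteq> {} \<Longrightarrow>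
      c e = c f \<Longrightarrow> c e = 0"
  shows "packing_coloring E c"
  unfolding packing_coloring_def by (intro conjI ballI impI) (rule assms; assumption)+

lemma packing_coloring_subset:
  assumes "packing_coloring E c" "E' \<subseteq> E"
  shows "packing_coloring E' c"
proof (rule packing_coloringI)
  note D = packing_coloringD[OF assms(1)] and s = subsetD[OF assms(2)]
  show "c e \<le> 5" if "e \<in> E'" for e by (rule D(1)[OF s[OF that]])
  show "c e \<noteq> c f" if "e \<in> E'" "f \<in> E'" "e \<noteq> f" "e \<inter> f \<noteq> {}" for e f
    by (rule D(2)[OF s[OF that(1)] s[OF that(2)] that(3,4)])
  show "c e = 0" if "g \<in> E'" "e \<in> E'" "f \<in> E'" "e \<noteq> f" "e \<inter> g \<noteq> {}" "g \<inter> f \<noteq> {}" "c e = c f" for g e f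
    by (rule D(3)[OF s[OF that(1)] s[OF that(2)] s[OF that(3)] that(4-7)])
qed

text \<open>Meeting edges have meeting images, so distances can only shrink under
  \<open>\<phi>\<close>, and every constraint on \<open>E'\<close> is already one on
  \<open>E\<close>. This lets \<open>{y, z}\<close> inherit the colour of
  \<open>{x, z}\<close>.\<close>

lemma packing_coloring_pullback:
  assumes "packing_coloring E c" "inj_on \<phi> E'" "\<phi> ` E' \<subseteq> E"
    and "\<And>e f. e \<in> E' \<Longrightarrow> f \<in> E' \<Longrightarrow> e \<inter> f \<noteq> {} \<Longrightarrow> \<phi> e \<inter> \<phi> f \<noteq> {}"
  shows "packing_coloring E' (c \<circ> \<phi>)"
proof -
  have \<phi>: "\<phi> e \<in> E" if "e \<in> E'" for e using that assms(3) by blast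
  have \<phi>': "\<phi> e \<noteq> \<phi> f" if "e \<in> E'" "f \<in> E'" "e \<noteq> f" for e f
    using that assms(2) by (auto dest: inj_onD)
  note \<phi> = \<phi> \<phi>'
  show ?thesis
  proof (rule packing_coloringI, unfold comp_apply)
    show "c (\<phi> e) \<le> 5" if "e \<in> E'" for e using packing_coloringD(1)[OF assms(1)] \<phi>(1) that .
    show "c (\<phi> e) \<noteq> c (\<phi> f)" if "e \<in> E'" "f \<in> E'" "e \<noteq> f" "e \<inter> f \<noteq> {}" for e f
      using packing_coloringD(2)[OF assms(1), of "\<phi> e" "\<phi> f"] that \<phi> assms(4)[of e f] by simp
    show "c (\<phi> e) = 0" if "g \<in> E'" "e \<in> E'" "f \<in> E'" "e \<noteq> f" "e \<inter> g \<noteq> {}" "g \<inter> f \<noteq> {}"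
      "c (\<phi> e) = c (\<phi> f)" for g e f
      using packing_coloringD(3)[OF assms(1), of "\<phi> g" "\<phi> e" "\<phi> f"] that \<phi> assms(4)[of e g] assms(4)[of g f] by simp
  qed
qed

text \<open>A new edge is also a shortcut: any two old edges that meet \<open>n\<close> come within
  distance 2 of each other, which is what \<open>bridge\<close> takes care of.\<close>

lemma packing_coloring_insert:
  assumes c: "packing_coloring E c" and n: "n \<notin> E" "k \<le> 5"
    and touch: "k \<notin> c ` touching E n" and near: "k = 0 \<or> k \<notin> c ` near E n"
    and bridge: "\<And>e f. e \<in> touching E n \<Longrightarrow> f \<in> touching E n \<Longrightarrow> e \<noteq> f \<Longrightarrow> c e = c f \<Longrightarrow> c e = 0"
  shows "packing_coloring (insert n E) (c(n := k))"
proof -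
  let ?c = "c(n := k)"
  have old: "?c e = c e" if "e \<in> E" for e using that n(1) by auto
  have t: "k \<noteq> c e" if "e \<in> E" "e \<inter> n \<noteq> {}" for e
    using that touch by (auto simp: touching_def)
  have nr: "k = 0" if "e \<in> E" "g \<in> E" "g \<inter> n \<noteq> {}" "g \<inter> e \<noteq> {}" "k = c e" for e g
    using near that unfolding near_def by blast
  show ?thesis
  proof (rule packing_coloringI)
    show "?c e \<noteq> ?c f" if "e \<in> insert n E" "f \<in> insert n E" "e \<noteq> f" "e \<inter> f \<noteq> {}" for e f
    proof (cases "e = n \<or> f = n")
      case True
      then show ?thesis
      proof
        assume "e = n" then show ?thesis using t[of f] that by (auto simp: Int_commute)
      next
        assume "f = n" then show ?thesis using t[of e] that by auto
      qed
    next
      case False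
      then show ?thesis using that packing_coloringD(2)[OF c] by auto
    qed
    show "?c e = 0" if "g \<in> insert n E" "e \<in> insert n E" "f \<in> insert n E" "e \<noteq> f"
      "e \<inter> g \<noteq> {}" "g \<inter> f \<noteq> {}" "?c e = ?c f" for g e f
    proof (cases "g = n")
      case True
      show ?thesis
      proof (cases "e = n \<or> f = n")
        case True
        then show ?thesis
        proof
          assume "e = n"
          then have "f \<in> E" "f \<inter> n \<noteq> {}" "k = c f" using that \<open>g = n\<close> old[of f] by (auto simp: Int_commute)
          then show ?thesis using t by blast
        next
          assume "f = n"
          then have "e \<in> E" "e \<inter> n \<noteq> {}" "k = c e" using that \<open>g = n\<close> old[of e] by auto
          then show ?thesis using t by blast
        qed
      next
        case False
        then have ef: "e \<in> E" "f \<in> E" using that by auto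
        then have "e \<in> touching E n" "f \<in> touching E n"
          using \<open>g = n\<close> that(5,6) unfolding touching_def by blast+
        then show ?thesis using bridge[of e f] that(4,7) old ef by simp
      qed
    next
      case g: False
      have "e = n \<and> f \<in> E \<or> f = n \<and> e \<in> E \<or> e \<in> E \<and> f \<in> E" using that by auto
      then consider "e = n" "f \<in> E" | "f = n" "e \<in> E" | "e \<in> E" "f \<in> E" by blast
      then show ?thesis
      proof cases
        case 1
        then have "g \<in> E" "g \<inter> n \<noteq> {}" "k = c f" using g that old[of f] by (auto simp: Int_commute)
        then show ?thesis using nr[of f g] 1 that(6) by simp
      next
        case 2
        then have "g \<in> E" "g \<inter> n \<noteq> {}" "g \<inter> e \<noteq> {}" "k = c e"
          using g that old[of e] by (auto simp: Int_commute)
        then show ?thesis using nr[of e g] 2 that(7) by simp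
      next
        case 3
        then show ?thesis using packing_coloringD(3)[OF c, of g e f] g that old by simp
      qed
    qed
    show "?c e \<le> 5" if "e \<in> insert n E" for e
      using that n packing_coloringD(1)[OF c] by auto
  qed
qed

text \<open>Colour 0 is restricted by adjacent edges alone, so moving an edge to the matching
  requires no look at distance 2.\<close>

lemma packing_coloring_recolor_0:
  assumes c: "packing_coloring E c" and "\<And>e. e \<in> E \<Longrightarrow> e \<noteq> n \<Longrightarrow> e \<inter> n \<noteq> {} \<Longrightarrow> c e \<noteq> 0"
  shows "packing_coloring E (c(n := 0))"
proof -
  let ?c = "c(n := 0)"
  show ?thesis
  proof (rule packing_coloringI)
    show "?c e \<le> 5" if "e \<in> E" for e using packing_coloringD(1)[OF c that] by simp
    show "?c e \<noteq> ?c f" if "e \<in> E" "f \<in> E" "e \<noteq> f" "e \<inter> f \<noteq> {}" for e f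
    proof -
      have "f \<inter> e \<noteq> {}" using that(4) by blast
      then show ?thesis using that packing_coloringD(2)[OF c that] assms(2)[of e] assms(2)[of f]
        by (cases "e = n"; cases "f = n") simp_all
    qed
    show "?c e = 0" if "g \<in> E" "e \<in> E" "f \<in> E" "e \<noteq> f" "e \<inter> g \<noteq> {}" "g \<inter> f \<noteq> {}" "?c e = ?c f" for g e f
      using that packing_coloringD(3)[OF c that(1-6)] by (auto split: if_splits)
  qed
qed

lemma packing_edge_colorableI:
  assumes "packing_coloring E c"
  shows "packing_edge_colorable (1 # replicate 5 2) E"
proof -
  let ?P = "\<lambda>i. {e \<in> E. c e = i}"
  have len: "length (1 # replicate 5 (2::nat)) = 6" by simp
  have "enat ((1 # replicate 5 2) ! i + 1) \<le> edge_dist E e f"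
    if "i < 6" "e \<in> ?P i" "f \<in> ?P i" "e \<noteq> f" for i e f
  proof (cases i)
    case 0
    have "e \<inter> f = {}" using packing_coloringD(2)[OF assms, of e f] that by auto
    then show ?thesis using edge_dist_ge_2_iff[of e E f] that 0 by (simp add: numeral_2_eq_2)
  next
    case (Suc j)
    have "e \<inter> f = {}" using packing_coloringD(2)[OF assms, of e f] that by auto
    moreover have "e \<inter> g = {} \<or> g \<inter> f = {}" if "g \<in> E" for g
      using packing_coloringD(3)[OF assms, of g e f] that Suc
        \<open>e \<in> ?P i\<close> \<open>f \<in> ?P i\<close> \<open>e \<noteq> f\<close> by auto
    ultimately have "enat 3 \<le> edge_dist E e f" using edge_dist_ge_3_iff[of e E f] that by blast
    moreover have "(1 # replicate 5 2) ! i + 1 = (3::nat)" using Suc that by simp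
    ultimately show ?thesis by simp
  qed
  moreover have "(\<Union>i<6. ?P i) = E"
    using packing_coloringD(1)[OF assms] by (force simp: less_Suc_eq_le)
  moreover have "disjoint_family_on ?P {..<6}" by (auto simp: disjoint_family_on_def)
  ultimately show ?thesis
    unfolding packing_edge_colorable_def packing_edge_coloring_def len by blast
qed

section \<open>Choice of colours for the reduced configurations\<close>

lemma exists_free_color:
  fixes S :: "nat set"
  assumes "finite S" "card S \<le> 4"
  obtains k where "1 \<le> k" "k \<le> 5" "k \<notin> S"
proof -
  have "\<not> {1..5} \<subseteq> S" using card_mono[OF assms(1), of "{1..5}"] assms(2) by auto
  then obtain k where "k \<in> {1..5}" "k \<notin> S" by blast
  then show thesis using that[of k] by simp
qed

lemma card_insert_le_Suc: "card (insert a A) \<le> Suc (card A)"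
  by (cases "finite A") (auto simp: card_insert_if)

text \<open>The colours \<open>\<alpha>\<close> and \<open>\<beta>\<close> of the edges \<open>{w, x}\<close> and \<open>{y, z}\<close> may only be replaced by 0.
  The colours \<open>\<kappa>\<close>, \<open>\<xi>\<close>, \<open>\<eta>\<close> are for \<open>{x, y}\<close> and for the third edges at \<open>x\<close> and \<open>y\<close>, and
  \<open>\<delta>\<close> remains available for an edge that meets these third edges.\<close>

lemma extension_colors_path:
  fixes W Z :: "nat set"
  assumes W: "finite W" "card W \<le> 2" and Z: "finite Z" "card Z \<le> 2"
    and "\<alpha> \<le> 5" "\<beta> \<le> 5" "\<alpha> \<noteq> \<beta>" "\<alpha> \<notin> W" "\<beta> \<notin> Z"
    and "\<alpha> \<noteq> 0 \<Longrightarrow> \<alpha> \<notin> Z" "\<beta> \<noteq> 0 \<Longrightarrow> \<beta> \<notin> W"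
  obtains \<alpha>' \<beta>' \<kappa> \<xi> \<eta> \<delta> where "\<alpha>' = \<alpha> \<or> \<alpha>' = 0 \<and> 0 \<notin> W" "\<beta>' = \<beta> \<or> \<beta>' = 0 \<and> 0 \<notin> Z"
    "\<kappa> \<le> 5" "\<xi> \<le> 5" "\<eta> \<le> 5" "1 \<le> \<delta>" "\<delta> \<le> 5" "\<delta> \<notin> {\<alpha>', \<beta>', \<kappa>, \<xi>, \<eta>}"
    "\<alpha>' = \<beta>' \<longrightarrow> \<alpha>' = 0" "\<kappa> \<notin> {\<alpha>', \<beta>'}" "\<kappa> \<noteq> 0 \<longrightarrow> \<kappa> \<notin> W \<union> Z"
    "\<xi> \<notin> {\<alpha>', \<kappa>, \<eta>}" "\<xi> \<noteq> 0 \<longrightarrow> \<xi> \<notin> insert \<beta>' W"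
    "\<eta> \<notin> {\<beta>', \<kappa>}" "\<eta> \<noteq> 0 \<longrightarrow> \<eta> \<notin> insert \<alpha>' Z"
proof -
  have i: "card (insert a A) \<le> Suc (card A)" for a :: nat and A by (rule card_insert_le_Suc)
  \<comment> \<open>If 0 is one of the two colours at \<open>w\<close>, only one nonzero colour is
    left there; this pays for keeping \<open>\<alpha>\<close>.\<close>
  have W0: "card (W - {0}) \<le> 1" if "0 \<in> W" using W that by (simp add: card_Diff_singleton)
  have Z0: "card (Z - {0}) \<le> 1" if "0 \<in> Z" using Z that by (simp add: card_Diff_singleton)
  consider "0 \<notin> W" "0 \<notin> Z" | "0 \<notin> W" "0 \<in> Z" | "0 \<in> W" "0 \<notin> Z" | "0 \<in> W" "0 \<in> Z" by blast
  then show thesis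
  proof cases
    case 1
    \<comment> \<open>Both end edges move to the matching, which frees their old colours. One of
      these is nonzero because they differ, and it occurs at neither end, so \<open>{x, y}\<close>
      can take it.\<close>
    define \<kappa> where "\<kappa> = (if \<alpha> = 0 then \<beta> else \<alpha>)"
    have \<kappa>: "\<kappa> \<noteq> 0" "\<kappa> \<le> 5" "\<kappa> \<notin> W" "\<kappa> \<notin> Z" using assms by (auto simp: \<kappa>_def)
    have "card (insert \<kappa> W) \<le> 4" using i[of \<kappa> W] W by linarith
    then obtain \<xi> where l: "1 \<le> \<xi>" "\<xi> \<le> 5" "\<xi> \<notin> insert \<kappa> W" using exists_free_color W by (metis finite_insert)
    have "card (insert \<xi> (insert \<kappa> Z)) \<le> 4" using i[of \<xi> "insert \<kappa> Z"] i[of \<kappa> Z] Z by linarith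
    then obtain \<eta> where m: "1 \<le> \<eta>" "\<eta> \<le> 5" "\<eta> \<notin> insert \<xi> (insert \<kappa> Z)" using exists_free_color Z by (metis finite_insert)
    have "card {\<kappa>, \<xi>, \<eta>} \<le> 4" by (simp add: card_insert_if)
    then obtain \<delta> where d: "1 \<le> \<delta>" "\<delta> \<le> 5" "\<delta> \<notin> {\<kappa>, \<xi>, \<eta>}" by (elim exists_free_color[rotated]) auto
    show thesis
      by (rule that[of 0 0 \<kappa> \<xi> \<eta> \<delta>])
        (use 1 \<kappa> l m d in auto)
  next
    case 2
    \<comment> \<open>As 0 occurs at \<open>z\<close>, the edge \<open>{y, z}\<close> keeps its
      nonzero colour. The third edge at \<open>y\<close> then takes 0: apart from it, only
      \<open>{w, x}\<close> here has colour 0, and the two do not meet.\<close>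
    then have "\<beta> \<noteq> 0" using assms(9) by metis
    then have \<beta>: "\<beta> \<noteq> 0" "\<beta> \<notin> W" using assms(11) by auto
    have "card (insert \<beta> (W \<union> (Z - {0}))) \<le> 4"
      using i[of \<beta> "W \<union> (Z - {0})"] card_Un_le[of W "Z - {0}"] W(2) Z0[OF 2(2)] by linarith
    then obtain \<kappa> where k: "1 \<le> \<kappa>" "\<kappa> \<le> 5" "\<kappa> \<notin> insert \<beta> (W \<union> (Z - {0}))"
      using W Z by (elim exists_free_color[rotated]) auto
    have "card (insert \<beta> (insert \<kappa> W)) \<le> 4" using i[of \<beta> "insert \<kappa> W"] i[of \<kappa> W] W by linarith
    then obtain \<xi> where l: "1 \<le> \<xi>" "\<xi> \<le> 5" "\<xi> \<notin> insert \<beta> (insert \<kappa> W)"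
      using W by (elim exists_free_color[rotated]) auto
    have "card {\<beta>, \<kappa>, \<xi>} \<le> 4" by (simp add: card_insert_if)
    then obtain \<delta> where d: "1 \<le> \<delta>" "\<delta> \<le> 5" "\<delta> \<notin> {\<beta>, \<kappa>, \<xi>}" by (elim exists_free_color[rotated]) auto
    show thesis
      by (rule that[of 0 \<beta> \<kappa> \<xi> 0 \<delta>])
        (use 2 \<beta> k l d in auto)
  next
    case 3
    then have "\<alpha> \<noteq> 0" using assms(8) by metis
    then have \<alpha>: "\<alpha> \<noteq> 0" "\<alpha> \<notin> Z" using assms(10) by auto
    have "card (insert \<alpha> (Z \<union> (W - {0}))) \<le> 4"
      using i[of \<alpha> "Z \<union> (W - {0})"] card_Un_le[of Z "W - {0}"] Z(2) W0[OF 3(1)] by linarith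
    then obtain \<kappa> where k: "1 \<le> \<kappa>" "\<kappa> \<le> 5" "\<kappa> \<notin> insert \<alpha> (Z \<union> (W - {0}))"
      using W Z by (elim exists_free_color[rotated]) auto
    have "card (insert \<alpha> (insert \<kappa> Z)) \<le> 4" using i[of \<alpha> "insert \<kappa> Z"] i[of \<kappa> Z] Z by linarith
    then obtain \<eta> where m: "1 \<le> \<eta>" "\<eta> \<le> 5" "\<eta> \<notin> insert \<alpha> (insert \<kappa> Z)"
      using Z by (elim exists_free_color[rotated]) auto
    have "card {\<alpha>, \<kappa>, \<eta>} \<le> 4" by (simp add: card_insert_if)
    then obtain \<delta> where d: "1 \<le> \<delta>" "\<delta> \<le> 5" "\<delta> \<notin> {\<alpha>, \<kappa>, \<eta>}" by (elim exists_free_color[rotated]) auto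
    show thesis
      by (rule that[of \<alpha> 0 \<kappa> 0 \<eta> \<delta>])
        (use 3 \<alpha> k m d in auto)
  next
    case 4
    \<comment> \<open>Neither end edge can move, so both have nonzero colours and the matching is
      free for \<open>{x, y}\<close>.\<close>
    then have "\<alpha> \<noteq> 0" "\<beta> \<noteq> 0" using assms(8,9) by metis+
    then have ab: "\<alpha> \<noteq> 0" "\<alpha> \<notin> Z" "\<beta> \<noteq> 0" "\<beta> \<notin> W" using assms(10,11) by auto
    have "card (insert \<alpha> (insert \<beta> (W - {0}))) \<le> 4"
      using i[of \<alpha> "insert \<beta> (W - {0})"] i[of \<beta> "W - {0}"] W0[OF 4(1)] by linarith
    then obtain \<xi> where l: "1 \<le> \<xi>" "\<xi> \<le> 5" "\<xi> \<notin> insert \<alpha> (insert \<beta> (W - {0}))"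
      using W by (elim exists_free_color[rotated]) auto
    have "card (insert \<xi> (insert \<alpha> (insert \<beta> (Z - {0})))) \<le> 4"
      using i[of \<xi> "insert \<alpha> (insert \<beta> (Z - {0}))"] i[of \<alpha> "insert \<beta> (Z - {0})"] i[of \<beta> "Z - {0}"] Z0[OF 4(2)]
      by linarith
    then obtain \<eta> where m: "1 \<le> \<eta>" "\<eta> \<le> 5" "\<eta> \<notin> insert \<xi> (insert \<alpha> (insert \<beta> (Z - {0})))"
      using Z by (elim exists_free_color[rotated]) auto
    have "card {\<alpha>, \<beta>, \<xi>, \<eta>} \<le> 4" by (simp add: card_insert_if)
    then obtain \<delta> where d: "1 \<le> \<delta>" "\<delta> \<le> 5" "\<delta> \<notin> {\<alpha>, \<beta>, \<xi>, \<eta>}" by (elim exists_free_color[rotated]) auto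
    show thesis
      by (rule that[of \<alpha> \<beta> 0 \<xi> \<eta> \<delta>])
        (use 4 ab l m d assms in auto)
  qed
qed

text \<open>The same for \<open>w = z\<close>, where \<open>W\<close> are the colours of the remaining edges at \<open>w\<close>
  and \<open>P\<close> are the colours near \<open>w\<close>.\<close>

lemma extension_colors_triangle:
  fixes W P :: "nat set"
  assumes W: "W \<subseteq> P" "card W \<le> 1" "W = {} \<Longrightarrow> P = {}" and P: "finite P" "card P \<le> 3"
  obtains \<alpha> \<beta> \<kappa> \<xi> \<eta> \<delta> where "\<alpha> \<le> 5" "\<alpha> \<notin> W" "\<alpha> \<noteq> 0 \<longrightarrow> \<alpha> \<notin> P"
    "\<beta> \<le> 5" "\<beta> \<notin> W" "\<beta> \<noteq> 0 \<longrightarrow> \<beta> \<notin> P" "\<alpha> \<noteq> \<beta>"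
    "\<kappa> \<le> 5" "\<xi> \<le> 5" "\<eta> \<le> 5" "1 \<le> \<delta>" "\<delta> \<le> 5" "\<delta> \<notin> {\<alpha>, \<beta>, \<kappa>, \<xi>, \<eta>}"
    "\<kappa> \<notin> {\<alpha>, \<beta>}" "\<kappa> \<noteq> 0 \<longrightarrow> \<kappa> \<notin> W"
    "\<xi> \<notin> {\<alpha>, \<kappa>, \<eta>}" "\<xi> \<noteq> 0 \<longrightarrow> \<xi> \<notin> insert \<beta> W"
    "\<eta> \<notin> {\<beta>, \<kappa>}" "\<eta> \<noteq> 0 \<longrightarrow> \<eta> \<notin> insert \<alpha> W"
proof -
  have i: "card (insert a A) \<le> Suc (card A)" for a :: nat and A by (rule card_insert_le_Suc)
  have finW: "finite W" using W P finite_subset by blast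
  show thesis
  proof (cases "W \<subseteq> {0}")
    case True
    \<comment> \<open>Either 0 is one of the at most three colours in \<open>P\<close>, or there is
      no further edge at \<open>w\<close> and \<open>P\<close> is empty.\<close>
    then have P0: "card (P - {0}) \<le> 2"
      using W P by (cases "W = {}") (auto simp: card_Diff_singleton)
    then obtain \<alpha> where a: "1 \<le> \<alpha>" "\<alpha> \<le> 5" "\<alpha> \<notin> P - {0}"
      using P(1) by (elim exists_free_color[of "P - {0}", rotated 2]) auto
    have "card (insert \<alpha> (P - {0})) \<le> 4" using i[of \<alpha> "P - {0}"] P0 by linarith
    then obtain \<beta> where b: "1 \<le> \<beta>" "\<beta> \<le> 5" "\<beta> \<notin> insert \<alpha> (P - {0})"
      using P(1) by (elim exists_free_color[rotated]) auto
    have "card {\<alpha>, \<beta>} \<le> 4" by (simp add: card_insert_if)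
    then obtain \<xi> where l: "1 \<le> \<xi>" "\<xi> \<le> 5" "\<xi> \<notin> {\<alpha>, \<beta>}" by (elim exists_free_color[rotated]) auto
    have "card {\<alpha>, \<beta>, \<xi>} \<le> 4" by (simp add: card_insert_if)
    then obtain \<eta> where m: "1 \<le> \<eta>" "\<eta> \<le> 5" "\<eta> \<notin> {\<alpha>, \<beta>, \<xi>}" by (elim exists_free_color[rotated]) auto
    have "card {\<alpha>, \<beta>, \<xi>, \<eta>} \<le> 4" by (simp add: card_insert_if)
    then obtain \<delta> where d: "1 \<le> \<delta>" "\<delta> \<le> 5" "\<delta> \<notin> {\<alpha>, \<beta>, \<xi>, \<eta>}" by (elim exists_free_color[rotated]) auto
    show thesis
      by (rule that[of \<alpha> \<beta> 0 \<xi> \<eta> \<delta>])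
        (use True a b l m d in auto)
  next
    case False
    then obtain \<epsilon> where e: "\<epsilon> \<in> W" "\<epsilon> \<noteq> 0" by blast
    then have We: "W = {\<epsilon>}" using W(2) finW by (metis One_nat_def card_le_Suc0_iff_eq is_singletonI' is_singleton_the_elem singletonD empty_iff)
    obtain \<beta> where b: "1 \<le> \<beta>" "\<beta> \<le> 5" "\<beta> \<notin> P" using P by (elim exists_free_color[rotated 2]) auto
    have "card {\<epsilon>, \<beta>} \<le> 4" by (simp add: card_insert_if)
    then obtain \<kappa> where k: "1 \<le> \<kappa>" "\<kappa> \<le> 5" "\<kappa> \<notin> {\<epsilon>, \<beta>}" by (elim exists_free_color[rotated]) auto
    have "card {\<epsilon>, \<beta>, \<kappa>} \<le> 4" by (simp add: card_insert_if)
    then obtain \<xi> where l: "1 \<le> \<xi>" "\<xi> \<le> 5" "\<xi> \<notin> {\<epsilon>, \<beta>, \<kappa>}" by (elim exists_free_color[rotated]) auto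
    have "card {\<beta>, \<kappa>, \<xi>} \<le> 4" by (simp add: card_insert_if)
    then obtain \<delta> where d: "1 \<le> \<delta>" "\<delta> \<le> 5" "\<delta> \<notin> {\<beta>, \<kappa>, \<xi>}" by (elim exists_free_color[rotated]) auto
    \<comment> \<open>The colour at \<open>w\<close> is not 0, so 0 serves both
      \<open>{w, x}\<close> and the third edge at \<open>y\<close>, which do not meet.\<close>
    show thesis
      by (rule that[of 0 \<beta> \<kappa> \<xi> 0 \<delta>])
        (use We W e b k l d in auto)
  qed
qed

section \<open>Extending a colouring over a configuration\<close>

text \<open>\<open>{x, y}\<close>, \<open>lx\<close> and \<open>ly\<close> are added one after the
  other. The first brings \<open>{w, x}\<close> and \<open>{y, z}\<close> to distance 2, so these
  may share no colour but 0. \<open>lx\<close> and \<open>ly\<close> are merely sets: pendant edges,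
  one-point dummies, or two edges with a common end \<open>t\<close>; because of the last case
  \<open>\<xi>\<close> and \<open>\<eta>\<close> have to differ even as colour 0.\<close>

lemma packing_coloring_insert_three:
  assumes c: "packing_coloring (E \<union> {{w, x}, {y, z}}) c"
    and xy: "x \<notin> \<Union>E" "y \<notin> \<Union>E" "x \<noteq> y" "w \<noteq> x" "w \<noteq> y" "z \<noteq> x" "z \<noteq> y"
    and lx: "lx \<inter> \<Union>E = {}" "x \<in> lx" "y \<notin> lx" "w \<notin> lx" "z \<notin> lx"
    and ly: "ly \<inter> \<Union>E = {}" "y \<in> ly" "x \<notin> ly" "w \<notin> ly" "z \<notin> ly"
    and W: "W = c ` {e \<in> E. w \<in> e}" and Z: "Z = c ` {e \<in> E. z \<in> e}"
    and \<alpha>: "\<alpha> = c {w, x}" and \<beta>: "\<beta> = c {y, z}" and \<alpha>\<beta>: "\<alpha> = \<beta> \<longrightarrow> \<alpha> = 0"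
    and \<kappa>: "\<kappa> \<le> 5" "\<kappa> \<notin> {\<alpha>, \<beta>}" "\<kappa> \<noteq> 0 \<longrightarrow> \<kappa> \<notin> W \<union> Z"
    and \<xi>: "\<xi> \<le> 5" "\<xi> \<notin> {\<alpha>, \<kappa>, \<eta>}" "\<xi> \<noteq> 0 \<longrightarrow> \<xi> \<notin> insert \<beta> W"
    and \<eta>: "\<eta> \<le> 5" "\<eta> \<notin> {\<beta>, \<kappa>}" "\<eta> \<noteq> 0 \<longrightarrow> \<eta> \<notin> insert \<alpha> Z"
  obtains d where "packing_coloring (E \<union> {{w, x}, {y, z}, {x, y}, lx, ly}) d"
    "d ` {{w, x}, {y, z}, {x, y}, lx, ly} = {\<alpha>, \<beta>, \<kappa>, \<xi>, \<eta>}"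
proof -
  let ?a = "{w, x}" and ?b = "{y, z}" and ?m = "{x, y}"
  let ?E1 = "E \<union> {?a, ?b}"
  let ?E2 = "insert ?m ?E1"
  let ?E3 = "insert lx ?E2"
  define d1 where "d1 = c({x, y} := \<kappa>)"
  define d2 where "d2 = d1(lx := \<xi>)"
  have ne: "?m \<noteq> ?a" "?m \<noteq> ?b" "?a \<noteq> ?b" "lx \<noteq> ?a" "lx \<noteq> ?b" "lx \<noteq> ?m" "ly \<noteq> ?a" "ly \<noteq> ?b" "ly \<noteq> ?m" "lx \<noteq> ly"
    using xy lx ly by (auto simp: doubleton_eq_iff)
  have E: "x \<notin> e" "y \<notin> e" "e \<inter> lx = {}" "e \<inter> ly = {}" "e \<noteq> ?a" "e \<noteq> ?b" "e \<noteq> ?m" "e \<noteq> lx" "e \<noteq> ly"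
    if "e \<in> E" for e
    using that xy(1,2) lx(1,2) ly(1,2) by auto
  have dj: "lx \<inter> {y, z} = {}" "ly \<inter> {w, x} = {}" using lx ly by auto
  have t1: "touching ?E1 ?m = {?a, ?b}"
    using E xy by (auto simp: touching_def)
  have n1: "near ?E1 ?m \<subseteq> {?a, ?b} \<union> {e \<in> E. w \<in> e} \<union> {e \<in> E. z \<in> e}"
  proof
    fix f assume "f \<in> near ?E1 ?m"
    then obtain g where g: "f \<in> ?E1" "g \<in> touching ?E1 ?m" "g \<inter> f \<noteq> {}" by (auto simp: near_def touching_def)
    show "f \<in> {?a, ?b} \<union> {e \<in> E. w \<in> e} \<union> {e \<in> E. z \<in> e}"
    proof (cases "f \<in> E")
      case True
      then show ?thesis using g E(1-4)[OF True] unfolding t1 by auto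
    next
      case False
      then show ?thesis using g(1) by blast
    qed
  qed
  have g1: "packing_coloring ?E2 d1"
    unfolding d1_def
  proof (rule packing_coloring_insert[OF c])
    show "?m \<notin> ?E1" using ne(1,2) E(7) by blast
    show "\<kappa> \<le> 5" by fact
    show "\<kappa> \<notin> c ` touching ?E1 ?m" unfolding t1 using \<kappa>(2) \<alpha> \<beta> by auto
    have "c ` near ?E1 ?m \<subseteq> {\<alpha>, \<beta>} \<union> W \<union> Z"
      using image_mono[OF n1, of c] unfolding W Z \<alpha> \<beta> by (simp add: image_Un)
    then show "\<kappa> = 0 \<or> \<kappa> \<notin> c ` near ?E1 ?m" using \<kappa>(2,3) by blast
    show "c e = 0" if "e \<in> touching ?E1 ?m" "f \<in> touching ?E1 ?m" "e \<noteq> f" "c e = c f" for e f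
      using that \<alpha>\<beta> unfolding t1 \<alpha> \<beta> by auto
  qed
  have c1: "d1 ?a = \<alpha>" "d1 ?b = \<beta>" "d1 ?m = \<kappa>" "\<And>e. e \<in> E \<Longrightarrow> d1 e = c e"
    using ne E(5-9) unfolding \<alpha> \<beta> d1_def by auto
  have t2: "touching ?E2 lx = {?a, ?m}"
    using E(1-4) xy(3-7) lx(2-5) by (auto simp: touching_def)
  have n2: "near ?E2 lx \<subseteq> {?a, ?b, ?m} \<union> {e \<in> E. w \<in> e}"
  proof
    fix f assume "f \<in> near ?E2 lx"
    then obtain g where g: "f \<in> ?E2" "g \<in> touching ?E2 lx" "g \<inter> f \<noteq> {}" by (auto simp: near_def touching_def)
    show "f \<in> {?a, ?b, ?m} \<union> {e \<in> E. w \<in> e}"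
    proof (cases "f \<in> E")
      case True
      then show ?thesis using g E(1-4)[OF True] unfolding t2 by auto
    next
      case False
      then show ?thesis using g(1) by blast
    qed
  qed
  have g2: "packing_coloring ?E3 d2"
    unfolding d2_def
  proof (rule packing_coloring_insert[OF g1])
    show "lx \<notin> ?E2" using ne(4-6) E(8) by blast
    show "\<xi> \<le> 5" by fact
    show "\<xi> \<notin> d1 ` touching ?E2 lx" unfolding t2 using \<xi>(2) c1 by simp
    have "d1 ` near ?E2 lx \<subseteq> d1 ` ({?a, ?b, ?m} \<union> {e \<in> E. w \<in> e})" by (rule image_mono[OF n2])
    also have "\<dots> = {\<alpha>, \<beta>, \<kappa>} \<union> W"
      unfolding W image_Un using c1 by auto
    finally show "\<xi> = 0 \<or> \<xi> \<notin> d1 ` near ?E2 lx" using \<xi>(2,3) by blast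
    show "d1 e = 0" if "e \<in> touching ?E2 lx" "f \<in> touching ?E2 lx" "e \<noteq> f" "d1 e = d1 f" for e f
      using that \<kappa>(2) c1 unfolding t2 by auto
  qed
  have c2: "d2 ?a = \<alpha>" "d2 ?b = \<beta>" "d2 ?m = \<kappa>" "d2 lx = \<xi>" "\<And>e. e \<in> E \<Longrightarrow> d2 e = c e"
    using ne(4-6) E(8) c1 unfolding d2_def by auto
  \<comment> \<open>Only an inclusion, because \<open>ly\<close> meets \<open>lx\<close> just when
    the two share a vertex.\<close>
  have t3: "touching ?E3 ly \<subseteq> {?b, ?m, lx}"
  proof
    fix f assume "f \<in> touching ?E3 ly"
    then have f: "f \<in> ?E3" "f \<inter> ly \<noteq> {}" by (simp_all add: touching_def)
    then have "f \<notin> E" using E(4) by blast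
    moreover have "f \<noteq> ?a" using f(2) dj(2) by blast
    ultimately show "f \<in> {?b, ?m, lx}" using f(1) by blast
  qed
  have n3: "near ?E3 ly \<subseteq> {?a, ?b, ?m, lx} \<union> {e \<in> E. z \<in> e}"
  proof
    fix f assume "f \<in> near ?E3 ly"
    then obtain g where g: "f \<in> ?E3" "g \<in> touching ?E3 ly" "g \<inter> f \<noteq> {}" by (auto simp: near_def touching_def)
    then have g': "g \<in> {?b, ?m, lx}" using t3 by blast
    show "f \<in> {?a, ?b, ?m, lx} \<union> {e \<in> E. z \<in> e}"
    proof (cases "f \<in> E")
      case True
      then show ?thesis using g g' E(1-4)[OF True] by auto
    next
      case False
      then show ?thesis using g(1) by blast
    qed
  qed
  have "packing_coloring (insert ly ?E3) (d2(ly := \<eta>))"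
  proof (rule packing_coloring_insert[OF g2])
    show "ly \<notin> ?E3" using ne(7-10) E(9) by blast
    show "\<eta> \<le> 5" by fact
    have "d2 ` touching ?E3 ly \<subseteq> d2 ` {?b, ?m, lx}" by (rule image_mono[OF t3])
    also have "\<dots> = {\<beta>, \<kappa>, \<xi>}" using c2 by simp
    finally show "\<eta> \<notin> d2 ` touching ?E3 ly" using \<eta>(2) \<xi>(2) by blast
    have "d2 ` near ?E3 ly \<subseteq> d2 ` ({?a, ?b, ?m, lx} \<union> {e \<in> E. z \<in> e})" by (rule image_mono[OF n3])
    also have "\<dots> = {\<alpha>, \<beta>, \<kappa>, \<xi>} \<union> Z"
      unfolding Z image_Un using c2 by auto
    finally show "\<eta> = 0 \<or> \<eta> \<notin> d2 ` near ?E3 ly" using \<eta>(2,3) \<xi>(2) by blast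
    show "d2 e = 0" if "e \<in> touching ?E3 ly" "f \<in> touching ?E3 ly" "e \<noteq> f" "d2 e = d2 f" for e f
    proof -
      have "e \<in> {?b, ?m, lx}" "f \<in> {?b, ?m, lx}" using that t3 by blast+
      then show ?thesis using that(3,4) \<kappa>(2) \<xi>(2,3) c2 by auto
    qed
  qed
  moreover have "insert ly ?E3 = E \<union> {{w, x}, {y, z}, {x, y}, lx, ly}" by auto
  ultimately have "packing_coloring (E \<union> {{w, x}, {y, z}, {x, y}, lx, ly}) (d2(ly := \<eta>))" by (simp only:)
  moreover have "(d2(ly := \<eta>)) ` {{w, x}, {y, z}, {x, y}, lx, ly} = {\<alpha>, \<beta>, \<kappa>, \<xi>, \<eta>}"
    using c2(1-4) ne(7-10) by simp
  ultimately show thesis by (rule that)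
qed

text \<open>The given colouring knows more than one of \<open>E\<close> with the two end edges:
  \<open>{w, x}\<close> and \<open>{x, z}\<close> are adjacent in the suppressed graph, which yields
  the relations between their colours and those at the opposite ends on which the choice of colours
  relies.\<close>

lemma packing_coloring_extend_path:
  assumes c: "packing_coloring (insert {x, z} (insert {w, x} E)) c" and fin: "finite E" and wz: "w \<noteq> z"
    and xy: "x \<notin> \<Union>E" "y \<notin> \<Union>E" "x \<noteq> y" "w \<noteq> x" "w \<noteq> y" "z \<noteq> x" "z \<noteq> y"
    and lx: "lx \<inter> \<Union>E = {}" "x \<in> lx" "y \<notin> lx" "w \<notin> lx" "z \<notin> lx"
    and ly: "ly \<inter> \<Union>E = {}" "y \<in> ly" "x \<notin> ly" "w \<notin> ly" "z \<notin> ly"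
    and deg: "card {e \<in> E. w \<in> e} \<le> 2" "card {e \<in> E. z \<in> e} \<le> 2"
  obtains d \<delta> where "packing_coloring (E \<union> {{w, x}, {y, z}, {x, y}, lx, ly}) d"
    "1 \<le> \<delta>" "\<delta> \<le> 5" "\<delta> \<notin> d ` {{w, x}, {y, z}, {x, y}, lx, ly}"
proof -
  let ?a = "{w, x}" and ?b = "{y, z}" and ?b' = "{x, z}"
  let ?E = "E \<union> {?a, ?b}" and ?E' = "insert ?b' (insert ?a E)"
  note D = packing_coloringD[OF c]
  have ab: "?a \<inter> ?b = {}" using xy wz by auto
  have nE: "x \<notin> e" "y \<notin> e" if "e \<in> E" for e using that xy(1,2) by auto
  have bE: "?a \<notin> E" "?b \<notin> E" "?b' \<notin> E" using nE by blast+
  have bb: "?a \<noteq> ?b" "?a \<noteq> ?b'" "?b \<noteq> ?b'" using xy wz by (auto simp: doubleton_eq_iff)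
  \<comment> \<open>Undoes the suppression: \<open>{y, z}\<close> is coloured like
    \<open>{x, z}\<close>.\<close>
  define \<phi> where "\<phi> e = (if e = ?b then ?b' else e)" for e
  have \<phi>: "\<phi> ?b = ?b'" "\<And>e. e \<noteq> ?b \<Longrightarrow> \<phi> e = e" by (simp_all add: \<phi>_def)
  define c1 where "c1 = c \<circ> \<phi>"
  have c1v: "c1 ?a = c ?a" "c1 ?b = c ?b'" "\<And>e. e \<in> E \<Longrightarrow> c1 e = c e"
  proof -
    show "c1 ?a = c ?a" "c1 ?b = c ?b'" using bb \<phi> unfolding c1_def comp_apply by simp_all
    show "c1 e = c e" if "e \<in> E" for e
    proof -
      have "e \<noteq> ?b" using that bE by blast
      then show ?thesis using \<phi> unfolding c1_def comp_apply by simp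
    qed
  qed
  have g1: "packing_coloring ?E c1"
    unfolding c1_def
  proof (rule packing_coloring_pullback[OF c])
    show "inj_on \<phi> ?E"
    proof (rule inj_onI)
      fix e f assume ef: "e \<in> ?E" "f \<in> ?E" "\<phi> e = \<phi> f"
      have "?b' \<notin> ?E" using bE bb by blast
      then show "e = f" using ef \<phi> by metis
    qed
    show "\<phi> ` ?E \<subseteq> ?E'"
    proof
      fix f assume "f \<in> \<phi> ` ?E"
      then obtain e where e: "e \<in> ?E" "f = \<phi> e" by blast
      show "f \<in> ?E'" using e \<phi> by (cases "e = ?b") auto
    qed
    \<comment> \<open>An edge of \<open>?E\<close> other than \<open>{y, z}\<close> meets it only in
      \<open>z\<close>, which survives in \<open>{x, z}\<close>.\<close>
    have *: "\<phi> ?b \<inter> f \<noteq> {}" if f: "f \<in> ?E" "f \<noteq> ?b" "?b \<inter> f \<noteq> {}" for f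
    proof -
      have "f \<in> E" using f ab by blast
      then have "z \<in> f" using f(3) nE by blast
      then show ?thesis using \<phi> by blast
    qed
    fix e f assume ef: "e \<in> ?E" "f \<in> ?E" "e \<inter> f \<noteq> {}"
    show "\<phi> e \<inter> \<phi> f \<noteq> {}"
    proof (cases "e = ?b")
      case True
      show ?thesis
      proof (cases "f = ?b")
        case True
        then show ?thesis using \<open>e = ?b\<close> \<phi>(1) by simp
      next
        case False
        then show ?thesis using *[of f] ef True \<phi>(2)[OF False] by simp
      qed
    next
      case False
      show ?thesis
      proof (cases "f = ?b")
        case True
        have "?b \<inter> e \<noteq> {}" using ef(3) True by blast
        then have "\<phi> ?b \<inter> e \<noteq> {}" using * ef(1) False by blast
        then show ?thesis using True \<phi>(2)[OF False] by blast
      next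
        case f: False
        show ?thesis unfolding \<phi>(2)[OF False] \<phi>(2)[OF f] using ef(3) .
      qed
    qed
  qed
  define W where "W = c1 ` {e \<in> E. w \<in> e}"
  define Z where "Z = c1 ` {e \<in> E. z \<in> e}"
  have W: "finite W" "card W \<le> 2" and Z: "finite Z" "card Z \<le> 2"
    using fin deg card_image_le[of "{e \<in> E. w \<in> e}" c1] card_image_le[of "{e \<in> E. z \<in> e}" c1]
    by (simp_all add: W_def Z_def)
  have "c1 ?a \<le> 5" "c1 ?b \<le> 5" using packing_coloringD(1)[OF g1] by simp_all
  moreover have "c1 ?a \<noteq> c1 ?b" unfolding c1v using D(2)[of ?a ?b'] bb by simp
  moreover have "c1 ?a \<notin> W"
  proof
    assume "c1 ?a \<in> W"
    then obtain e where e: "e \<in> E" "w \<in> e" "c1 ?a = c1 e" by (auto simp: W_def)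
    then have "e \<noteq> ?a" "?a \<inter> e \<noteq> {}" using bE by auto
    then show False using packing_coloringD(2)[OF g1, of ?a e] e by simp
  qed
  moreover have "c1 ?b \<notin> Z"
  proof
    assume "c1 ?b \<in> Z"
    then obtain e where e: "e \<in> E" "z \<in> e" "c1 ?b = c1 e" by (auto simp: Z_def)
    then have "e \<noteq> ?b" "?b \<inter> e \<noteq> {}" using bE by auto
    then show False using packing_coloringD(2)[OF g1, of ?b e] e by simp
  qed
  \<comment> \<open>In the suppressed graph \<open>{x, z}\<close> is a shortcut between
    \<open>{w, x}\<close> and the edges at \<open>z\<close>.\<close>
  moreover have "c1 ?a \<notin> Z" if "c1 ?a \<noteq> 0"
  proof
    assume "c1 ?a \<in> Z"
    then obtain e where e: "e \<in> E" "z \<in> e" "c ?a = c e" using c1v by (auto simp: Z_def)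
    then have "e \<noteq> ?a" "?b' \<inter> e \<noteq> {}" "?a \<inter> ?b' \<noteq> {}" using bE by auto
    then show False using D(3)[of ?b' ?a e] e that c1v by simp
  qed
  moreover have "c1 ?b \<notin> W" if "c1 ?b \<noteq> 0"
  proof
    assume "c1 ?b \<in> W"
    then obtain e where e: "e \<in> E" "w \<in> e" "c ?b' = c e" using c1v by (auto simp: W_def)
    then have "e \<noteq> ?b'" "?a \<inter> e \<noteq> {}" "?b' \<inter> ?a \<noteq> {}" using bE by auto
    then show False using D(3)[of ?a ?b' e] e that c1v by simp
  qed
  ultimately obtain \<alpha> \<beta> \<kappa> \<xi> \<eta> \<delta> where \<alpha>: "\<alpha> = c1 ?a \<or> \<alpha> = 0 \<and> 0 \<notin> W" and \<beta>: "\<beta> = c1 ?b \<or> \<beta> = 0 \<and> 0 \<notin> Z"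
    and le: "\<kappa> \<le> 5" "\<xi> \<le> 5" "\<eta> \<le> 5" and \<delta>: "1 \<le> \<delta>" "\<delta> \<le> 5" "\<delta> \<notin> {\<alpha>, \<beta>, \<kappa>, \<xi>, \<eta>}"
    and con: "\<alpha> = \<beta> \<longrightarrow> \<alpha> = 0" "\<kappa> \<notin> {\<alpha>, \<beta>}" "\<kappa> \<noteq> 0 \<longrightarrow> \<kappa> \<notin> W \<union> Z"
      "\<xi> \<notin> {\<alpha>, \<kappa>, \<eta>}" "\<xi> \<noteq> 0 \<longrightarrow> \<xi> \<notin> insert \<beta> W"
      "\<eta> \<notin> {\<beta>, \<kappa>}" "\<eta> \<noteq> 0 \<longrightarrow> \<eta> \<notin> insert \<alpha> Z"
    by (rule extension_colors_path[OF W Z])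
  define c2 where "c2 = c1(?a := \<alpha>)"
  define c3 where "c3 = c2(?b := \<beta>)"
  have g2: "packing_coloring ?E c2"
    using \<alpha>
  proof
    assume "\<alpha> = c1 ?a" then show ?thesis using g1 by (simp add: c2_def)
  next
    assume 0: "\<alpha> = 0 \<and> 0 \<notin> W"
    have "c1 e \<noteq> 0" if e: "e \<in> ?E" "e \<noteq> ?a" "e \<inter> ?a \<noteq> {}" for e
    proof -
      have "e \<in> E" using e ab by blast
      then have "c1 e \<in> W" using e(3) nE by (auto simp: W_def)
      then show ?thesis using 0 by metis
    qed
    then have "packing_coloring ?E (c1(?a := 0))" by (rule packing_coloring_recolor_0[OF g1])
    then show ?thesis using 0 by (simp add: c2_def)
  qed
  have c2v: "c2 e = c1 e" if "e \<in> E" for e using that bE by (auto simp: c2_def)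
  have g3: "packing_coloring ?E c3"
    using \<beta>
  proof
    assume "\<beta> = c1 ?b" then show ?thesis using g2 bb by (simp add: c3_def c2_def fun_upd_idem)
  next
    assume 0: "\<beta> = 0 \<and> 0 \<notin> Z"
    have "c2 e \<noteq> 0" if e: "e \<in> ?E" "e \<noteq> ?b" "e \<inter> ?b \<noteq> {}" for e
    proof -
      have "e \<in> E" using e ab by blast
      then have "c2 e \<in> Z" using e(3) nE c2v by (auto simp: Z_def)
      then show ?thesis using 0 by metis
    qed
    then have "packing_coloring ?E (c2(?b := 0))" by (rule packing_coloring_recolor_0[OF g2])
    then show ?thesis using 0 by (simp add: c3_def)
  qed
  have c3v: "c3 e = c1 e" if "e \<in> E" for e using that bE c2v by (auto simp: c3_def)
  have c3ab: "\<alpha> = c3 ?a" "\<beta> = c3 ?b" using bb by (simp_all add: c3_def c2_def)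
  have WZ: "W = c3 ` {e \<in> E. w \<in> e}" "Z = c3 ` {e \<in> E. z \<in> e}"
    unfolding W_def Z_def by (rule image_cong[OF refl], use c3v in simp)+
  from packing_coloring_insert_three[OF g3 xy lx ly WZ c3ab con(1) le(1) con(2,3) le(2) con(4,5) le(3) con(6,7)]
  obtain d where "packing_coloring (E \<union> {{w, x}, {y, z}, {x, y}, lx, ly}) d"
    "d ` {{w, x}, {y, z}, {x, y}, lx, ly} = {\<alpha>, \<beta>, \<kappa>, \<xi>, \<eta>}" by blast
  then show thesis using that[of d \<delta>] \<delta> by simp
qed

text \<open>Both edges at \<open>w\<close> are coloured anew: all that is within distance 2 of them
  in \<open>E\<close> is reached through the one remaining edge at \<open>w\<close>, which leaves at
  most three edges. The other three edges are inserted as before, with \<open>w\<close> in place of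
  \<open>z\<close>.\<close>

lemma packing_coloring_extend_triangle:
  assumes c: "packing_coloring E c" and fin: "finite E"
    and xy: "x \<notin> \<Union>E" "y \<notin> \<Union>E" "x \<noteq> y" "w \<noteq> x" "w \<noteq> y"
    and lx: "lx \<inter> \<Union>E = {}" "x \<in> lx" "y \<notin> lx" "w \<notin> lx"
    and ly: "ly \<inter> \<Union>E = {}" "y \<in> ly" "x \<notin> ly" "w \<notin> ly"
    and deg: "card {e \<in> E. w \<in> e} \<le> 1" "card {f \<in> E. \<exists>g\<in>E. w \<in> g \<and> g \<inter> f \<noteq> {}} \<le> 3"
  obtains d \<delta> where "packing_coloring (E \<union> {{w, x}, {y, w}, {x, y}, lx, ly}) d"
    "1 \<le> \<delta>" "\<delta> \<le> 5" "\<delta> \<notin> d ` {{w, x}, {y, w}, {x, y}, lx, ly}"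
proof -
  let ?a = "{w, x}" and ?b = "{y, w}"
  let ?F = "{e \<in> E. w \<in> e}" and ?N = "{f \<in> E. \<exists>g\<in>E. w \<in> g \<and> g \<inter> f \<noteq> {}}"
  have nE: "x \<notin> e" "y \<notin> e" if "e \<in> E" for e using that xy(1,2) by auto
  have bE: "?a \<notin> E" "?b \<notin> E" using nE by blast+
  have bb: "?a \<noteq> ?b" using xy by (auto simp: doubleton_eq_iff)
  define W where "W = c ` ?F"
  define P where "P = c ` ?N"
  have FN: "?F \<subseteq> ?N" by blast
  then have WP: "W \<subseteq> P" unfolding W_def P_def by (rule image_mono)
  have W1: "card W \<le> 1" and P3: "card P \<le> 3" and finP: "finite P"
    using fin deg card_image_le[of ?F c] card_image_le[of ?N c] by (simp_all add: W_def P_def)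
  have W0: "W = {} \<Longrightarrow> P = {}" by (auto simp: W_def P_def)
  have F1: "e = f" if "e \<in> ?F" "f \<in> ?F" for e f
  proof -
    have "finite ?F" using fin by simp
    then show ?thesis using deg(1) that card_le_Suc0_iff_eq[of ?F] by simp
  qed
  obtain \<alpha> \<beta> \<kappa> \<xi> \<eta> \<delta> where \<alpha>: "\<alpha> \<le> 5" "\<alpha> \<notin> W" "\<alpha> \<noteq> 0 \<longrightarrow> \<alpha> \<notin> P" and \<beta>: "\<beta> \<le> 5" "\<beta> \<notin> W" "\<beta> \<noteq> 0 \<longrightarrow> \<beta> \<notin> P"
    and ab: "\<alpha> \<noteq> \<beta>"
    and le: "\<kappa> \<le> 5" "\<xi> \<le> 5" "\<eta> \<le> 5" and \<delta>: "1 \<le> \<delta>" "\<delta> \<le> 5" "\<delta> \<notin> {\<alpha>, \<beta>, \<kappa>, \<xi>, \<eta>}"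
    and con: "\<kappa> \<notin> {\<alpha>, \<beta>}" "\<kappa> \<noteq> 0 \<longrightarrow> \<kappa> \<notin> W"
      "\<xi> \<notin> {\<alpha>, \<kappa>, \<eta>}" "\<xi> \<noteq> 0 \<longrightarrow> \<xi> \<notin> insert \<beta> W"
      "\<eta> \<notin> {\<beta>, \<kappa>}" "\<eta> \<noteq> 0 \<longrightarrow> \<eta> \<notin> insert \<alpha> W"
    by (rule extension_colors_triangle[OF WP W1 W0 finP P3])
  define c1 where "c1 = c(?a := \<alpha>)"
  define c2 where "c2 = c1(?b := \<beta>)"
  have t1: "touching E ?a = ?F" using nE by (auto simp: touching_def)
  have n1: "near E ?a = ?N" using nE by (auto simp: near_def)
  have g1: "packing_coloring (insert ?a E) c1"
    unfolding c1_def
  proof (rule packing_coloring_insert[OF c bE(1) \<alpha>(1)], unfold t1 n1)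
    show "\<alpha> \<notin> c ` ?F" using \<alpha>(2) unfolding W_def .
    show "\<alpha> = 0 \<or> \<alpha> \<notin> c ` ?N" using \<alpha>(3) unfolding P_def by blast
    show "c e = 0" if "e \<in> ?F" "f \<in> ?F" "e \<noteq> f" "c e = c f" for e f using F1 that by blast
  qed
  have c1v: "c1 ?a = \<alpha>" "\<And>e. e \<in> E \<Longrightarrow> c1 e = c e" using bE by (auto simp: c1_def)
  have t2: "touching (insert ?a E) ?b = insert ?a ?F" using nE xy by (auto simp: touching_def)
  have n2: "near (insert ?a E) ?b \<subseteq> insert ?a ?N"
  proof
    fix f assume "f \<in> near (insert ?a E) ?b"
    then obtain g where g: "f \<in> insert ?a E" "g \<in> touching (insert ?a E) ?b" "g \<inter> f \<noteq> {}"
      by (auto simp: near_def touching_def)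
    show "f \<in> insert ?a ?N"
    proof (cases "f = ?a")
      case False
      then have f: "f \<in> E" using g(1) by blast
      show ?thesis
      proof (cases "g = ?a")
        case True
        then have "w \<in> f" using g(3) nE[OF f] by blast
        then show ?thesis using f by blast
      next
        case False
        then have "g \<in> E" "w \<in> g" using g(2) unfolding t2 by auto
        then show ?thesis using f g(3) by blast
      qed
    qed blast
  qed
  have g2: "packing_coloring (insert ?b (insert ?a E)) c2"
    unfolding c2_def
  proof (rule packing_coloring_insert[OF g1 _ \<beta>(1)])
    show "?b \<notin> insert ?a E" using bE bb by blast
    have "c1 ` insert ?a ?F = insert \<alpha> W" using c1v by (auto simp: W_def)
    then show "\<beta> \<notin> c1 ` touching (insert ?a E) ?b" unfolding t2 using ab \<beta>(2) by simp
    have "c1 ` insert ?a ?N = insert \<alpha> P" using c1v by (auto simp: P_def)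
    then have "c1 ` near (insert ?a E) ?b \<subseteq> insert \<alpha> P" using image_mono[OF n2, of c1] by simp
    then show "\<beta> = 0 \<or> \<beta> \<notin> c1 ` near (insert ?a E) ?b" using ab \<beta>(3) by blast
    show "c1 e = 0" if "e \<in> touching (insert ?a E) ?b" "f \<in> touching (insert ?a E) ?b" "e \<noteq> f" "c1 e = c1 f" for e f
    proof -
      have W': "c1 h \<in> W" if "h \<in> ?F" for h using that c1v by (auto simp: W_def)
      have "e \<in> insert ?a ?F" "f \<in> insert ?a ?F" using that(1,2) by (simp_all only: t2)
      then have "e = ?a \<and> f \<in> ?F \<or> f = ?a \<and> e \<in> ?F" using F1 that(3) by blast
      then show ?thesis using W' \<alpha>(2) c1v(1) that(4) by metis
    qed
  qed
  have c2v: "\<alpha> = c2 ?a" "\<beta> = c2 ?b" "\<And>e. e \<in> E \<Longrightarrow> c2 e = c e" using bE bb c1v by (auto simp: c2_def)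
  have W2: "W = c2 ` ?F" unfolding W_def by (rule image_cong[OF refl]) (use c2v(3) in simp)
  have "insert ?b (insert ?a E) = E \<union> {?a, ?b}" by blast
  then have g3: "packing_coloring (E \<union> {?a, ?b}) c2" using g2 by simp
  have con': "\<alpha> = \<beta> \<longrightarrow> \<alpha> = 0" "\<kappa> \<noteq> 0 \<longrightarrow> \<kappa> \<notin> W \<union> W" using ab con(2) by simp_all
  from packing_coloring_insert_three[OF g3 xy xy(4,5) lx lx(4) ly ly(4) W2 W2 c2v(1,2) con'(1) le(1) con(1) con'(2) le(2) con(3,4) le(3) con(5,6)]
  obtain d where "packing_coloring (E \<union> {{w, x}, {y, w}, {x, y}, lx, ly}) d"
    "d ` {{w, x}, {y, w}, {x, y}, lx, ly} = {\<alpha>, \<beta>, \<kappa>, \<xi>, \<eta>}" by blast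
  then show thesis using that[of d \<delta>] \<delta> by simp
qed

text \<open>The edges that meet \<open>l\<close> all contain \<open>v\<close> and already differ in
  colour, so \<open>l\<close> creates no conflict between old edges, and four colours nearby leave a
  fifth for \<open>l\<close>.\<close>

lemma packing_coloring_insert_pendant:
  assumes E: "l \<in> E" "finite E" and l: "l = {v, u}" and u: "\<And>e. e \<in> E \<Longrightarrow> u \<in> e \<Longrightarrow> e = l"
    and c: "packing_coloring (E - {l}) c" and card: "card (near (E - {l}) l) \<le> 4"
  shows "\<exists>d. packing_coloring E d"
proof -
  let ?E = "E - {l}"
  have fin: "finite (near ?E l)" using E by (simp add: near_def)
  have "card (c ` near ?E l) \<le> 4" using card_image_le[OF fin, of c] card by linarith
  then obtain k where k: "1 \<le> k" "k \<le> 5" "k \<notin> c ` near ?E l"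
    using fin exists_free_color[of "c ` near ?E l"] by blast
  have tn: "touching ?E l \<subseteq> near ?E l" by (auto simp: touching_def near_def)
  have "packing_coloring (insert l ?E) (c(l := k))"
  proof (rule packing_coloring_insert[OF c _ k(2)])
    show "k \<notin> c ` touching ?E l" using k(3) tn by blast
    show "c e = 0" if ef: "e \<in> touching ?E l" "f \<in> touching ?E l" "e \<noteq> f" "c e = c f" for e f
    proof -
      have "e \<in> ?E" "f \<in> ?E" "v \<in> e" "v \<in> f" using ef(1,2) u l by (auto simp: touching_def)
      then show ?thesis using packing_coloringD(2)[OF c, of e f] ef(3,4) by blast
    qed
  qed (use k in auto)
  moreover have "insert l ?E = E" using E by blast
  ultimately show ?thesis by auto
qed

section \<open>The induction\<close>

lemma vdegree_mono: "finite E \<Longrightarrow> E' \<subseteq> E \<Longrightarrow> vdegree E' v \<le> vdegree E v"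
  unfolding vdegree_def by (rule card_mono) auto

lemma vdegree_eq_1D:
  assumes "vdegree E v = 1" "e \<in> E" "f \<in> E" "v \<in> e" "v \<in> f"
  shows "e = f"
proof -
  obtain g where g: "{e \<in> E. v \<in> e} = {g}" using assms(1) unfolding vdegree_def by (rule card_1_singletonE)
  have "e \<in> {e \<in> E. v \<in> e}" "f \<in> {e \<in> E. v \<in> e}" using assms by simp_all
  then show ?thesis unfolding g by simp
qed

text \<open>All edges outside \<open>E'\<close> and the path are dropped first, so that
  \<open>y\<close> has degree 2 and can be suppressed. In the count, two edges \<open>{x, y}\<close>
  and \<open>{y, z}\<close> give way to one.\<close>

lemma suppress_smaller:
  assumes G: "simple_graph V E" "outerplanar V E" and deg: "\<And>v. vdegree E v \<le> 3"
    and e: "{w, x} \<in> E" "{x, y} \<in> E" "{y, z} \<in> E"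
    and ne: "x \<noteq> y" "w \<noteq> x" "w \<noteq> y" "z \<noteq> x" "z \<noteq> y" "w \<noteq> z"
    and E': "E' \<subseteq> E - {{w, x}, {x, y}, {y, z}}" "x \<notin> \<Union>E'" "y \<notin> \<Union>E'"
  shows "simple_graph (V - {y}) (insert {x, z} (insert {w, x} E'))"
    and "outerplanar (V - {y}) (insert {x, z} (insert {w, x} E'))"
    and "vdegree (insert {x, z} (insert {w, x} E')) v \<le> 3"
    and "card (insert {x, z} (insert {w, x} E')) < card E"
proof -
  let ?E = "insert {x, z} (insert {w, x} E')" and ?E1 = "E' \<union> {{w, x}, {x, y}, {y, z}}"
  have "E' \<subseteq> E" using E'(1) by blast
  then have fin: "finite E" "finite E'"
    using simple_graph_finite_edges[OF G(1)] finite_subset[of E' E] by simp_all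
  have E1: "?E1 \<subseteq> E" using e E' by auto
  have V: "x \<in> V" "y \<in> V" "z \<in> V" "w \<in> V" using e G(1) by (auto simp: simple_graph_def)
  have V': "e \<subseteq> V" "card e = 2" if "e \<in> E'" for e using that E' G(1) by (auto simp: simple_graph_def)
  have d: "{w, x} \<noteq> {x, y}" "{w, x} \<noteq> {y, z}" "{x, y} \<noteq> {y, z}" "{x, z} \<noteq> {w, x}" "{x, z} \<noteq> {x, y}" "{x, z} \<noteq> {y, z}"
    using ne by (auto simp: doubleton_eq_iff)
  show "simple_graph (V - {y}) ?E"
    using G(1) V V' ne E'(3) by (auto simp: simple_graph_def)
  have s1: "simple_graph V ?E1" using simple_graph_subset[OF G(1) E1] .
  have o1: "outerplanar V ?E1" using outerplanar_subgraph[OF G(2) subset_refl E1] .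
  have "outerplanar (V - {y}) (insert {x, z} (?E1 - {{x, y}, {y, z}}))"
  proof (rule outerplanar_suppress[OF s1 o1])
    show "{x, y} \<in> ?E1" "{y, z} \<in> ?E1" "x \<noteq> z" using ne by auto
    show "e = {x, y} \<or> e = {y, z}" if "e \<in> ?E1" "y \<in> e" for e using that E'(3) ne by auto
    have "{x, z} \<notin> E'" using E'(2) by blast
    then show "{x, z} \<notin> ?E1" using d by simp
  qed
  moreover have "?E1 - {{x, y}, {y, z}} = insert {w, x} E'"
  proof -
    have "{x, y} \<notin> E'" "{y, z} \<notin> E'" using E'(3) by blast+
    then show ?thesis using d(1,2) by blast
  qed
  ultimately show "outerplanar (V - {y}) ?E" by simp
  show "vdegree ?E v \<le> 3"
  proof (cases "v = x")
    case True
    have "{e \<in> ?E. x \<in> e} \<subseteq> {{x, z}, {w, x}}" using E'(2) by auto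
    then have "card {e \<in> ?E. x \<in> e} \<le> card {{x, z}, {w, x}}" by (rule card_mono[rotated]) simp
    also have "\<dots> \<le> 3" by (simp add: card_insert_if)
    finally show ?thesis using True by (simp add: vdegree_def)
  next
    case False
    \<comment> \<open>Away from \<open>x\<close> the edges at \<open>v\<close> come from old edges
      at \<open>v\<close>: only \<open>{x, z}\<close> is new, and it replaces
      \<open>{y, z}\<close>.\<close>
    let ?\<phi> = "\<lambda>e. if e = {y, z} then {x, z} else e"
    have "{e \<in> ?E. v \<in> e} \<subseteq> ?\<phi> ` {e \<in> E. v \<in> e}"
    proof
      fix f assume f: "f \<in> {e \<in> ?E. v \<in> e}"
      show "f \<in> ?\<phi> ` {e \<in> E. v \<in> e}"
      proof (cases "f = {x, z}")
        case True
        then have "v = z" using f False by simp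
        then show ?thesis using True e(3) by (intro image_eqI[of _ _ "{y, z}"]) auto
      next
        case F: False
        then have "f = {w, x} \<or> f \<in> E'" "v \<in> f" using f by blast+
        then have "f \<in> E" "f \<noteq> {y, z}" "v \<in> f" using e(1) E'(1) d(2) by blast+
        then show ?thesis by (intro image_eqI[of _ _ f]) auto
      qed
    qed
    then have "card {e \<in> ?E. v \<in> e} \<le> card (?\<phi> ` {e \<in> E. v \<in> e})" using fin by (intro card_mono) auto
    also have "\<dots> \<le> card {e \<in> E. v \<in> e}" using fin by (intro card_image_le) auto
    finally show ?thesis using deg[of v] by (simp add: vdegree_def)
  qed
  have "{x, y} \<notin> E'" "{y, z} \<notin> E'" using E'(3) by blast+
  then have "insert {w, x} E' \<subseteq> E - {{x, y}, {y, z}}" using e(1) E'(1) d(1,2) by blast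
  then have "card (insert {w, x} E') \<le> card (E - {{x, y}, {y, z}})" using fin by (intro card_mono) auto
  also have "\<dots> = card E - 2" using e d fin by (simp add: card_Diff_subset)
  finally have "card ?E \<le> Suc (card E - 2)" using card_insert_le_Suc[of "{x, z}" "insert {w, x} E'"] by linarith
  moreover have "2 \<le> card E" using card_mono[OF fin(1), of "{{x, y}, {y, z}}"] e d by simp
  ultimately show "card ?E < card E" by linarith
qed

text \<open>Common to both configurations, hence the abstract \<open>lx\<close> and
  \<open>ly\<close>. The spare colour \<open>\<delta>\<close> is meant for a pendant edge at the tip
  of a triangle.\<close>

lemma packing_coloring_reduction:
  fixes V :: "'a set" and E :: "'a set set"
  assumes G: "simple_graph V E" "outerplanar V E" and deg: "\<And>v. vdegree E v \<le> 3"
    and IH: "\<And>(V' :: 'a set) E'. simple_graph V' E' \<Longrightarrow> outerplanar V' E' \<Longrightarrow> (\<And>v. vdegree E' v \<le> 3) \<Longrightarrow>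
      card E' < card E \<Longrightarrow> \<exists>c. packing_coloring E' c"
    and e: "{w, x} \<in> E" "{x, y} \<in> E" "{y, z} \<in> E"
    and ne: "x \<noteq> y" "w \<noteq> x" "w \<noteq> y" "z \<noteq> x" "z \<noteq> y"
    and E': "E' \<subseteq> E - {{w, x}, {x, y}, {y, z}}" "x \<notin> \<Union>E'" "y \<notin> \<Union>E'"
    and lx: "lx \<inter> \<Union>E' = {}" "x \<in> lx" "y \<notin> lx" "w \<notin> lx" "z \<notin> lx"
    and ly: "ly \<inter> \<Union>E' = {}" "y \<in> ly" "x \<notin> ly" "w \<notin> ly" "z \<notin> ly"
  obtains d \<delta> where "packing_coloring (E' \<union> {{w, x}, {y, z}, {x, y}, lx, ly}) d"
    "1 \<le> \<delta>" "\<delta> \<le> 5" "\<delta> \<notin> d ` {{w, x}, {y, z}, {x, y}, lx, ly}"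
proof -
  have "E' \<subseteq> E" using E'(1) by blast
  then have fin: "finite E" "finite E'"
    using simple_graph_finite_edges[OF G(1)] finite_subset[of E' E] by simp_all
  \<comment> \<open>Each removed edge at \<open>v\<close> lowers its degree: an end of the path
    keeps at most two edges, and at most one if both ends coincide.\<close>
  have less: "card {e \<in> E'. v \<in> e} \<le> 3 - card F" if "F \<subseteq> {e \<in> E. v \<in> e}" "F \<inter> E' = {}" for v F
  proof -
    have finF: "finite F" using that fin finite_subset[of F "{e \<in> E. v \<in> e}"] by simp
    have "{e \<in> E'. v \<in> e} \<subseteq> {e \<in> E. v \<in> e} - F" using that E' by auto
    then have "card {e \<in> E'. v \<in> e} \<le> card ({e \<in> E. v \<in> e} - F)" using fin by (intro card_mono) auto
    also have "\<dots> = vdegree E v - card F" using finF that by (simp add: card_Diff_subset vdegree_def)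
    finally show ?thesis using deg[of v] by linarith
  qed
  show thesis
  proof (cases "w = z")
    case False
    note S = suppress_smaller[OF G deg e ne False E']
    obtain c where c: "packing_coloring (insert {x, z} (insert {w, x} E')) c"
    proof -
      have "\<exists>c. packing_coloring (insert {x, z} (insert {w, x} E')) c" by (rule IH) (rule S)+
      then show thesis using that by blast
    qed
    have "card {e \<in> E'. w \<in> e} \<le> 2" "card {e \<in> E'. z \<in> e} \<le> 2"
      using less[of "{{w, x}}" w] less[of "{{y, z}}" z] e E'(1) by auto
    from packing_coloring_extend_path[OF c fin(2) False E'(2,3) ne lx ly this] that
    show thesis by blast
  next
    case True
    have "card E' < card E"
      using fin e E'(1) by (intro psubset_card_mono) auto
    moreover have "vdegree E' v \<le> 3" for v using vdegree_mono[OF fin(1), of E' v] E'(1) deg[of v] by force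
    moreover have "simple_graph V E'" "outerplanar V E'"
      using simple_graph_subset[OF G(1)] outerplanar_subgraph[OF G(2)] E'(1) by blast+
    ultimately obtain c where c: "packing_coloring E' c" using IH by blast
    have d: "{w, x} \<noteq> {y, w}" using ne by (auto simp: doubleton_eq_iff)
    have F1: "card {e \<in> E'. w \<in> e} \<le> 1"
      using less[of "{{w, x}, {y, w}}" w] e E'(1) True d by auto
    \<comment> \<open>The one remaining edge at \<open>w\<close> leads to some \<open>u\<close>, and
      all edges of \<open>E'\<close> that meet it, itself included, contain
      \<open>u\<close>.\<close>
    have "card {f \<in> E'. \<exists>g\<in>E'. w \<in> g \<and> g \<inter> f \<noteq> {}} \<le> 3"
    proof (cases "\<exists>g\<in>E'. w \<in> g")
      case False
      then have "{f \<in> E'. \<exists>g\<in>E'. w \<in> g \<and> g \<inter> f \<noteq> {}} = {}" by blast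
      then show ?thesis by (metis card.empty le0)
    next
      case True
      then obtain g where g: "g \<in> E'" "w \<in> g" by blast
      have "finite {e \<in> E'. w \<in> e}" using fin by simp
      then have uniq: "h = g" if "h \<in> E'" "w \<in> h" for h
        using F1 that g card_le_Suc0_iff_eq[of "{e \<in> E'. w \<in> e}"] by simp
      have "g \<in> E" using g E'(1) by blast
      then obtain u where u: "g = {w, u}" using simple_graph_edge_other[OF G(1) _ g(2)] by metis
      have "{f \<in> E'. \<exists>g\<in>E'. w \<in> g \<and> g \<inter> f \<noteq> {}} \<subseteq> {e \<in> E. u \<in> e}"
      proof
        fix f assume f: "f \<in> {f \<in> E'. \<exists>g\<in>E'. w \<in> g \<and> g \<inter> f \<noteq> {}}"
        then have gf: "g \<inter> f \<noteq> {}" "f \<in> E'" using uniq by auto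
        then have "u \<in> f" using u uniq[of f] by auto
        then show "f \<in> {e \<in> E. u \<in> e}" using gf E'(1) by auto
      qed
      then have "card {f \<in> E'. \<exists>g\<in>E'. w \<in> g \<and> g \<inter> f \<noteq> {}} \<le> vdegree E u"
        unfolding vdegree_def using fin by (intro card_mono) auto
      then show ?thesis using deg[of u] by linarith
    qed
    from packing_coloring_extend_triangle[OF c fin(2) E'(2,3) ne(1-3) lx(1-4) ly(1-4) F1 this] that True
    show thesis by blast
  qed
qed

text \<open>If \<open>x\<close> has no pendant edge in \<open>E\<close>, the set \<open>{x}\<close> serves as a dummy edge.\<close>

lemma pendant_edge_slot:
  assumes G: "simple_graph V E" and deg: "vdegree E x \<le> 3"
    and H: "H = {e \<in> E. \<forall>v\<in>e. vdegree E v \<noteq> 1}" "vdegree H x = 2"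
    and e: "e1 \<in> H" "e2 \<in> H" "x \<in> e1" "x \<in> e2" "e1 \<noteq> e2"
  obtains l where "x \<in> l" "\<And>e. e \<in> E \<Longrightarrow> x \<in> e \<Longrightarrow> e \<in> {e1, e2, l}"
    "\<And>e. e \<in> E \<Longrightarrow> e \<noteq> l \<Longrightarrow> e \<inter> l \<noteq> {} \<Longrightarrow> x \<in> e" "l \<inter> \<Union>H \<subseteq> {x}"
proof (cases "{e \<in> E. x \<in> e} \<subseteq> {e1, e2}")
  case True
  then show thesis using that[of "{x}"] by auto
next
  case False
  then obtain e3 where e3: "e3 \<in> E" "x \<in> e3" "e3 \<noteq> e1" "e3 \<noteq> e2" by blast
  have fin: "finite E" using simple_graph_finite_edges[OF G] .
  have eE: "e1 \<in> E" "e2 \<in> E" using e H by auto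
  have c3: "card {e1, e2, e3} = 3" using e e3 by auto
  have T: "{e \<in> E. x \<in> e} = {e1, e2, e3}"
  proof (rule card_seteq[symmetric])
    show "finite {e \<in> E. x \<in> e}" using fin by simp
    show "{e1, e2, e3} \<subseteq> {e \<in> E. x \<in> e}" using e e3 eE by auto
    show "card {e \<in> E. x \<in> e} \<le> card {e1, e2, e3}" using deg c3 by (simp add: vdegree_def)
  qed
  have finH: "finite {e \<in> H. x \<in> e}" using fin H by simp
  have "e3 \<notin> H"
  proof
    assume "e3 \<in> H"
    then have "card {e1, e2, e3} \<le> card {e \<in> H. x \<in> e}" using e e3 finH by (intro card_mono) auto
    then show False using c3 H(2) by (simp add: vdegree_def)
  qed
  \<comment> \<open>Not being in \<open>H\<close>, the third edge at \<open>x\<close> has an end of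
    degree 1. This end is not \<open>x\<close>, so other edges can meet the third edge only in
    \<open>x\<close>.\<close>
  then obtain u where u: "u \<in> e3" "vdegree E u = 1" using e3 H by blast
  have "vdegree E x = 3" unfolding vdegree_def T using c3 .
  then have "u \<noteq> x" using u(2) by auto
  moreover obtain r where "e3 = {x, r}" using simple_graph_edge_other[OF G e3(1,2)] by metis
  ultimately have e3': "e3 = {x, u}" using u(1) by blast
  have only: "f = e3" if "f \<in> E" "u \<in> f" for f using vdegree_eq_1D[OF u(2) that(1) e3(1) that(2) u(1)] .
  show thesis
  proof (rule that[of e3])
    show "x \<in> e3" by fact
    show "f \<in> {e1, e2, e3}" if "f \<in> E" "x \<in> f" for f using that T by blast
    show "x \<in> f" if "f \<in> E" "f \<noteq> e3" "f \<inter> e3 \<noteq> {}" for f using that only[of f] e3' by blast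
    show "e3 \<inter> \<Union>H \<subseteq> {x}" using e3' only \<open>e3 \<notin> H\<close> H(1) by blast
  qed
qed

lemma vdegree_other_neighbour:
  assumes G: "simple_graph V E" and deg: "card Y < vdegree E x" and Y: "finite Y"
  obtains w where "{x, w} \<in> E" "w \<notin> Y" "w \<noteq> x"
proof -
  have "\<not> neighbours E x \<subseteq> Y"
    using card_mono[OF Y, of "neighbours E x"] card_neighbours[OF G, of x] deg by auto
  then obtain w where "{x, w} \<in> E" "w \<notin> Y" by (auto simp: neighbours_def)
  then show thesis using that simple_graph_no_loop[OF G] by metis
qed

lemma subcubic_outerplanar_packing_coloring:
  fixes V :: "'a set" and E :: "'a set set"
  assumes "simple_graph V E" "outerplanar V E" "\<And>v. vdegree E v \<le> 3"
  shows "\<exists>c. packing_coloring E c"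
  using assms
proof (induction "card E" arbitrary: V E rule: less_induct)
  case less
  note G = less.prems(1,2) and deg = less.prems(3)
  have fin: "finite E" using simple_graph_finite_edges[OF G(1)] .
  have IH: "\<exists>c. packing_coloring E' c"
    if "simple_graph V' E'" "outerplanar V' E'" "\<And>v. vdegree E' v \<le> 3" "card E' < card E" for V' :: "'a set" and E'
    by (rule less.hyps[OF that(4,1,2)]) (rule that(3))
  define H where "H = {e \<in> E. \<forall>v\<in>e. vdegree E v \<noteq> 1}"
  have HE: "H \<subseteq> E" by (auto simp: H_def)
  have GH: "simple_graph V H" "outerplanar V H"
    using simple_graph_subset[OF G(1) HE] outerplanar_subgraph[OF G(2) subset_refl HE] .
  have remove: "\<exists>c. packing_coloring E c"
    if l: "l \<in> E" "l = {v, u}" "vdegree E u = 1" "card (near (E - {l}) l) \<le> 4" for l v u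
  proof -
    have "card (E - {l}) < card E" using fin l(1) by (rule card_Diff1_less)
    moreover have "vdegree (E - {l}) v \<le> 3" for v
      using vdegree_mono[OF fin, of "E - {l}" v] deg[of v] by force
    moreover have "simple_graph V (E - {l})" "outerplanar V (E - {l})"
      using simple_graph_subset[OF G(1)] outerplanar_subgraph[OF G(2)] by blast+
    ultimately obtain c where c: "packing_coloring (E - {l}) c" using IH by blast
    have "f = l" if "f \<in> E" "u \<in> f" for f using vdegree_eq_1D[OF l(3) that(1) l(1) that(2)] l(2) by blast
    then show ?thesis using packing_coloring_insert_pendant[OF l(1) fin l(2) _ c l(4)] by blast
  qed
  \<comment> \<open>A pendant edge at a vertex of degree other than 1 has its leaf at the other end,
    so whatever meets it contains that vertex: it opens no route to further edges.\<close>
  have nonH: "f \<inter> g = {} \<or> v \<in> f" if A: "g \<in> E" "g \<notin> H" "v \<in> g" "vdegree E v \<noteq> 1" "f \<in> E" for f g v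
  proof -
    obtain s where s: "s \<in> g" "vdegree E s = 1" using A(1,2) by (auto simp: H_def)
    obtain r where r: "g = {v, r}" using simple_graph_edge_other[OF G(1) A(1,3)] by metis
    have "s \<noteq> v" using s(2) A(4) by metis
    then have "g = {v, s}" using r s(1) by blast
    moreover have "f = g" if "s \<in> f" using vdegree_eq_1D[OF s(2) A(5,1) that s(1)] .
    ultimately show ?thesis using A(3) by blast
  qed
  have star: "card ({f \<in> E. v \<in> f} - {g}) \<le> 2" if "g \<in> E" "v \<in> g" for g v
    using deg[of v] that fin by (simp add: vdegree_def card_Diff_singleton)
  \<comment> \<open>Pendant edges at \<open>x\<close> and \<open>y\<close> fill the slots
    \<open>lx\<close> and \<open>ly\<close>. A missing one is padded by a dummy, which disappears
    when the colouring is restricted to \<open>E\<close>.\<close>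
  have step: "\<exists>c. packing_coloring E c"
    if xy: "{x, y} \<in> H" "vdegree H x = 2" "vdegree H y = 2" for x y
  proof -
    have nxy: "x \<noteq> y" using simple_graph_no_loop[OF GH(1) xy(1)] .
    obtain w where w: "{x, w} \<in> H" "w \<noteq> y" "w \<noteq> x"
      using vdegree_other_neighbour[OF GH(1), of "{y}" x] xy(2) by auto
    obtain z where z: "{y, z} \<in> H" "z \<noteq> x" "z \<noteq> y"
      using vdegree_other_neighbour[OF GH(1), of "{x}" y] xy(3) by auto
    have dx: "{w, x} \<noteq> {x, y}" and dy: "{y, z} \<noteq> {x, y}" using w z by (auto simp: doubleton_eq_iff)
    have w': "{w, x} \<in> H" using w(1) by (simp add: insert_commute)
    obtain lx where lx: "x \<in> lx" "\<And>e. e \<in> E \<Longrightarrow> x \<in> e \<Longrightarrow> e \<in> {{w, x}, {x, y}, lx}"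
      "\<And>e. e \<in> E \<Longrightarrow> e \<noteq> lx \<Longrightarrow> e \<inter> lx \<noteq> {} \<Longrightarrow> x \<in> e" "lx \<inter> \<Union>H \<subseteq> {x}"
      by (rule pendant_edge_slot[OF G(1) deg H_def xy(2) w' xy(1) _ _ dx]) auto
    obtain ly where ly: "y \<in> ly" "\<And>e. e \<in> E \<Longrightarrow> y \<in> e \<Longrightarrow> e \<in> {{y, z}, {x, y}, ly}"
      "\<And>e. e \<in> E \<Longrightarrow> e \<noteq> ly \<Longrightarrow> e \<inter> ly \<noteq> {} \<Longrightarrow> y \<in> e" "ly \<inter> \<Union>H \<subseteq> {y}"
      by (rule pendant_edge_slot[OF G(1) deg H_def xy(3) z(1) xy(1) _ _ dy]) auto
    define E' where "E' = E - {{w, x}, {y, z}, {x, y}, lx, ly}"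
    have UH: "w \<in> \<Union>H" "x \<in> \<Union>H" "y \<in> \<Union>H" "z \<in> \<Union>H" using w z xy by blast+
    have x': "x \<notin> \<Union>E'"
    proof
      assume "x \<in> \<Union>E'"
      then obtain e where e: "e \<in> E'" "x \<in> e" by blast
      then have "e \<in> E" by (simp add: E'_def)
      from lx(2)[OF this e(2)] show False using e(1) by (simp add: E'_def)
    qed
    have y': "y \<notin> \<Union>E'"
    proof
      assume "y \<in> \<Union>E'"
      then obtain e where e: "e \<in> E'" "y \<in> e" by blast
      then have "e \<in> E" by (simp add: E'_def)
      from ly(2)[OF this e(2)] show False using e(1) by (simp add: E'_def)
    qed
    have eE: "{w, x} \<in> E" "{x, y} \<in> E" "{y, z} \<in> E" using HE w' xy z by auto
    have lx': "lx \<inter> \<Union>E' = {}"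
    proof (rule ccontr)
      assume "lx \<inter> \<Union>E' \<noteq> {}"
      then obtain f where "f \<in> E'" "f \<inter> lx \<noteq> {}" by blast
      then have "x \<in> f" using lx(3)[of f] by (auto simp: E'_def)
      then show False using x' \<open>f \<in> E'\<close> by blast
    qed
    have ly': "ly \<inter> \<Union>E' = {}"
    proof (rule ccontr)
      assume "ly \<inter> \<Union>E' \<noteq> {}"
      then obtain f where "f \<in> E'" "f \<inter> ly \<noteq> {}" by blast
      then have "y \<in> f" using ly(3)[of f] by (auto simp: E'_def)
      then show False using y' \<open>f \<in> E'\<close> by blast
    qed
    have nlx: "y \<notin> lx" "w \<notin> lx" "z \<notin> lx" using lx(4) UH nxy w z by blast+
    have nly: "x \<notin> ly" "w \<notin> ly" "z \<notin> ly" using ly(4) UH nxy w z by blast+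
    have sub: "E' \<subseteq> E - {{w, x}, {x, y}, {y, z}}" unfolding E'_def by blast
    obtain d where "packing_coloring (E' \<union> {{w, x}, {y, z}, {x, y}, lx, ly}) d"
      by (rule packing_coloring_reduction[OF G deg IH eE nxy w(3,2) z(2,3) sub x' y'
            lx' lx(1) nlx ly' ly(1) nly])
    moreover have "E \<subseteq> E' \<union> {{w, x}, {y, z}, {x, y}, lx, ly}" unfolding E'_def by blast
    ultimately show ?thesis using packing_coloring_subset by blast
  qed
  show ?case
  proof (cases "H = {}")
    case True
    show ?thesis
    proof (cases "E = {}")
      case True
      then have "packing_coloring E (\<lambda>_. 0)" by (simp add: packing_coloring_def)
      then show ?thesis by blast
    next
      case False
      then obtain e where e: "e \<in> E" by blast
      then obtain u where u: "u \<in> e" "vdegree E u = 1" using True by (auto simp: H_def)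
      then obtain v where v: "e = {u, v}" using simple_graph_edge_other[OF G(1) e] by metis
      \<comment> \<open>Every edge is pendant, so each component is a star and only the other edges
        at \<open>v\<close> count.\<close>
      have "near (E - {e}) e \<subseteq> {f \<in> E. v \<in> f} - {e}"
      proof
        fix f assume "f \<in> near (E - {e}) e"
        then obtain g where g: "f \<in> E" "f \<noteq> e" "g \<in> E" "g \<noteq> e" "g \<inter> e \<noteq> {}" "g \<inter> f \<noteq> {}" by (auto simp: near_def)
        then have "u \<notin> g" using vdegree_eq_1D[OF u(2) _ e _ u(1)] by blast
        then have vg: "v \<in> g" using g(5) v by blast
        have "vdegree E v \<noteq> 1" using vdegree_eq_1D[of E v e g] e g(3,4) vg v by blast
        then have "v \<in> f" using nonH[of g v f] g True vg by blast
        then show "f \<in> {f \<in> E. v \<in> f} - {e}" using g by blast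
      qed
      then have "card (near (E - {e}) e) \<le> card ({f \<in> E. v \<in> f} - {e})" using fin by (intro card_mono) auto
      also have "\<dots> \<le> 2" using star[of e v] e v by blast
      finally show ?thesis using remove[of e v u] e v u(2) by (simp add: insert_commute)
    qed
  next
    case False
    show ?thesis
    proof (cases "\<forall>v\<in>\<Union>H. 2 \<le> vdegree H v")
      case False
      then obtain v h where v: "v \<in> h" "h \<in> H" "vdegree H v < 2" by fastforce
      have hE: "h \<in> E" using v HE by blast
      have nv: "vdegree E v \<noteq> 1" using v by (auto simp: H_def)
      have "finite {e \<in> H. v \<in> e}" using fin HE finite_subset by fastforce
      then have uniq: "g = h" if "g \<in> H" "v \<in> g" for g
        using v that card_le_Suc0_iff_eq[of "{e \<in> H. v \<in> e}"] by (simp add: vdegree_def)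
      obtain w where w: "h = {v, w}" using simple_graph_edge_other[OF G(1) hE v(1)] by metis
      \<comment> \<open>Lying on an edge of \<open>H\<close>, the vertex \<open>v\<close> has degree
        at least 2 in \<open>E\<close>; as \<open>h\<close> is its only edge in \<open>H\<close>,
        another one is pendant.\<close>
      have "\<not> {e \<in> E. v \<in> e} \<subseteq> {h}"
      proof
        assume "{e \<in> E. v \<in> e} \<subseteq> {h}"
        then have "{e \<in> E. v \<in> e} = {h}" using hE v(1) by blast
        then show False using nv by (simp add: vdegree_def)
      qed
      then obtain l where l: "l \<in> E" "v \<in> l" "l \<noteq> h" by blast
      then have "l \<notin> H" using uniq by blast
      then obtain u where u: "u \<in> l" "vdegree E u = 1" using l(1) by (auto simp: H_def)
      then have l': "l = {v, u}" using simple_graph_edge_other[OF G(1) l(1,2)] nv by blast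
      \<comment> \<open>At most two edges at \<open>v\<close> other than \<open>l\<close>, and only
        \<open>h\<close> leads on, to at most two further edges at \<open>w\<close>: four in
        all.\<close>
      have "near (E - {l}) l \<subseteq> ({f \<in> E. v \<in> f} - {l}) \<union> ({f \<in> E. w \<in> f} - {h})"
      proof
        fix f assume "f \<in> near (E - {l}) l"
        then obtain g where g: "f \<in> E" "f \<noteq> l" "g \<in> E" "g \<noteq> l" "g \<inter> l \<noteq> {}" "g \<inter> f \<noteq> {}" by (auto simp: near_def)
        then have "u \<notin> g" using vdegree_eq_1D[OF u(2) _ l(1) _ u(1)] by blast
        then have vg: "v \<in> g" using g(5) l' by blast
        show "f \<in> ({f \<in> E. v \<in> f} - {l}) \<union> ({f \<in> E. w \<in> f} - {h})"
        proof (cases "v \<in> f")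
          case True
          then show ?thesis using g by blast
        next
          case False
          then have "g \<in> H" using nonH[of g v f] g vg nv by blast
          then have "g = h" using uniq vg by blast
          then have "w \<in> f" "f \<noteq> h" using g(6) w False v(1) by blast+
          then show ?thesis using g(1) by blast
        qed
      qed
      then have "card (near (E - {l}) l) \<le> card (({f \<in> E. v \<in> f} - {l}) \<union> ({f \<in> E. w \<in> f} - {h}))"
        using fin by (intro card_mono) auto
      also have "\<dots> \<le> card ({f \<in> E. v \<in> f} - {l}) + card ({f \<in> E. w \<in> f} - {h})" by (rule card_Un_le)
      also have "\<dots> \<le> 4" using star[OF l(1,2)] star[OF hE, of w] w by simp
      finally show ?thesis using remove[OF l(1) l' u(2)] by blast
    next
      case True
      have degH: "2 \<le> vdegree H v \<and> vdegree H v \<le> 3" if "v \<in> \<Union>H" for v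
        using True that vdegree_mono[OF fin HE, of v] deg[of v] by force
      consider (adjacent) x y where "{x, y} \<in> H" "vdegree H x = 2" "vdegree H y = 2"
        | (triangle) t x y where "{t, x} \<in> H" "{t, y} \<in> H" "{x, y} \<in> H" "vdegree H t = 2"
      proof (rule outerplanar_reducible_configuration[OF GH False])
        show "2 \<le> vdegree H v \<and> vdegree H v \<le> 3" if "v \<in> \<Union>H" for v using degH[OF that] .
      qed (rule that; assumption)+
      then show ?thesis
      proof cases
        case (adjacent x y)
        then show ?thesis by (rule step)
      next
        case (triangle t x y)
        show ?thesis
        proof (cases "vdegree H x = 2 \<or> vdegree H y = 2")
          case True
          \<comment> \<open>The tip \<open>t\<close> and a base vertex of degree 2 are an adjacent
            pair.\<close>
          then show ?thesis using step[of t x] step[of t y] triangle by blast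
        next
          case False
          have UH: "x \<in> \<Union>H" "y \<in> \<Union>H" "t \<in> \<Union>H" using triangle by blast+
          have d3: "vdegree H x = 3" "vdegree H y = 3" using degH[OF UH(1)] degH[OF UH(2)] False by linarith+
          have txy: "t \<noteq> x" "t \<noteq> y" "x \<noteq> y"
            using simple_graph_no_loop[OF GH(1)] triangle by blast+
          obtain w where w: "{x, w} \<in> H" "w \<notin> {t, y}" "w \<noteq> x"
            by (rule vdegree_other_neighbour[OF GH(1), of "{t, y}" x]) (use d3 txy in auto)
          obtain z where z: "{y, z} \<in> H" "z \<notin> {t, x}" "z \<noteq> y"
            by (rule vdegree_other_neighbour[OF GH(1), of "{t, x}" y]) (use d3 txy in auto)
          have UH': "w \<in> \<Union>H" "z \<in> \<Union>H" using w z by blast+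
          \<comment> \<open>The edges to the tip \<open>t\<close> take the slots of the third edges
            at \<open>x\<close> and \<open>y\<close>.\<close>
          let ?lx = "{x, t}" and ?ly = "{y, t}"
          have at: "{e \<in> E. v \<in> e} = {{v, p}, {v, q}, {v, r}}"
            if "{v, p} \<in> H" "{v, q} \<in> H" "{v, r} \<in> H" "p \<noteq> q" "q \<noteq> r" "p \<noteq> r" for v p q r
          proof (rule card_seteq[symmetric])
            show "finite {e \<in> E. v \<in> e}" using fin by simp
            show "{{v, p}, {v, q}, {v, r}} \<subseteq> {e \<in> E. v \<in> e}" using that HE by auto
            have "card {{v, p}, {v, q}, {v, r}} = 3" using that by (auto simp: doubleton_eq_iff card_insert_if)
            then show "card {e \<in> E. v \<in> e} \<le> card {{v, p}, {v, q}, {v, r}}" using deg[of v] by (simp add: vdegree_def)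
          qed
          have eH: "{x, t} \<in> H" "{y, t} \<in> H" "{y, x} \<in> H" "{w, x} \<in> H"
            using triangle w by (simp_all add: insert_commute)
          have atx: "e \<in> {{w, x}, {x, y}, ?lx}" if "e \<in> E" "x \<in> e" for e
          proof -
            have "{e \<in> E. x \<in> e} = {{x, w}, {x, y}, {x, t}}"
              by (rule at) (use w eH triangle txy in auto)
            then have "e \<in> {{x, w}, {x, y}, {x, t}}" using that by blast
            then show ?thesis by (simp add: insert_commute)
          qed
          have aty: "e \<in> {{y, z}, {x, y}, ?ly}" if "e \<in> E" "y \<in> e" for e
          proof -
            have "{e \<in> E. y \<in> e} = {{y, z}, {y, x}, {y, t}}"
              by (rule at) (use z eH triangle txy in auto)
            then have "e \<in> {{y, z}, {y, x}, {y, t}}" using that by blast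
            then show ?thesis by (simp add: insert_commute)
          qed
          have dt: "?lx \<noteq> ?ly" using txy by (auto simp: doubleton_eq_iff)
          obtain lt where lt: "t \<in> lt" "\<And>e. e \<in> E \<Longrightarrow> t \<in> e \<Longrightarrow> e \<in> {?lx, ?ly, lt}"
            "\<And>e. e \<in> E \<Longrightarrow> e \<noteq> lt \<Longrightarrow> e \<inter> lt \<noteq> {} \<Longrightarrow> t \<in> e" "lt \<inter> \<Union>H \<subseteq> {t}"
            by (rule pendant_edge_slot[OF G(1) deg H_def triangle(4) eH(1,2) _ _ dt]) auto
          have nlt: "x \<notin> lt" "y \<notin> lt" "w \<notin> lt" "z \<notin> lt" using lt(4) UH UH' txy w z by blast+
          \<comment> \<open>All edges at \<open>t\<close> are dropped, so that \<open>?lx\<close>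
            and \<open>?ly\<close> do not meet \<open>E'\<close>.\<close>
          define E' where "E' = E - {{w, x}, {y, z}, {x, y}, ?lx, ?ly, lt}"
          let ?N = "{{w, x}, {y, z}, {x, y}, ?lx, ?ly}"
          have x': "x \<notin> \<Union>E'"
          proof
            assume "x \<in> \<Union>E'"
            then obtain e where e: "e \<in> E'" "x \<in> e" by blast
            then have "e \<in> E" by (simp add: E'_def)
            from atx[OF this e(2)] show False using e(1) by (simp add: E'_def)
          qed
          have y': "y \<notin> \<Union>E'"
          proof
            assume "y \<in> \<Union>E'"
            then obtain e where e: "e \<in> E'" "y \<in> e" by blast
            then have "e \<in> E" by (simp add: E'_def)
            from aty[OF this e(2)] show False using e(1) by (simp add: E'_def)
          qed
          have t': "t \<notin> \<Union>E'"
          proof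
            assume "t \<in> \<Union>E'"
            then obtain e where e: "e \<in> E'" "t \<in> e" by blast
            then have "e \<in> E" by (simp add: E'_def)
            from lt(2)[OF this e(2)] show False using e(1) by (simp add: E'_def)
          qed
          have eE: "{w, x} \<in> E" "{x, y} \<in> E" "{y, z} \<in> E" using HE eH triangle z by auto
          have sub: "E' \<subseteq> E - {{w, x}, {x, y}, {y, z}}" unfolding E'_def by blast
          have lx': "?lx \<inter> \<Union>E' = {}" "x \<in> ?lx" "y \<notin> ?lx" "w \<notin> ?lx" "z \<notin> ?lx"
            using x' t' txy w z by auto
          have ly': "?ly \<inter> \<Union>E' = {}" "y \<in> ?ly" "x \<notin> ?ly" "w \<notin> ?ly" "z \<notin> ?ly"
            using y' t' txy w z by auto
          have wz: "w \<noteq> y" "z \<noteq> x" using w z by auto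
          obtain c \<delta> where c: "packing_coloring (E' \<union> ?N) c" and \<delta>: "1 \<le> \<delta>" "\<delta> \<le> 5" "\<delta> \<notin> c ` ?N"
            by (rule packing_coloring_reduction[OF G deg IH eE txy(3) w(3) wz z(3) sub x' y' lx' ly'])
          have touch: "touching (E' \<union> ?N) lt \<subseteq> {?lx, ?ly}"
          proof
            fix f assume "f \<in> touching (E' \<union> ?N) lt"
            then have f: "f \<in> E' \<union> ?N" "f \<inter> lt \<noteq> {}" by (auto simp: touching_def)
            have "f \<notin> E'"
            proof
              assume "f \<in> E'"
              then have "t \<in> f" using lt(3)[of f] f(2) by (auto simp: E'_def)
              then show False using t' \<open>f \<in> E'\<close> by blast
            qed
            moreover have "f \<notin> {{w, x}, {y, z}, {x, y}}" using f(2) nlt by blast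
            ultimately show "f \<in> {?lx, ?ly}" using f(1) by blast
          qed
          \<comment> \<open>From \<open>lt\<close> one reaches only \<open>?lx\<close> and
            \<open>?ly\<close>, and through these only the five edges of \<open>?N\<close>, whose
            colours \<open>\<delta>\<close> avoids.\<close>
          have nr: "near (E' \<union> ?N) lt \<subseteq> ?N"
          proof
            fix f assume "f \<in> near (E' \<union> ?N) lt"
            then obtain g where g: "f \<in> E' \<union> ?N" "g \<in> touching (E' \<union> ?N) lt" "g \<inter> f \<noteq> {}"
              by (auto simp: near_def touching_def)
            then have "g \<in> {?lx, ?ly}" using touch by blast
            then have "f \<notin> E'" using g(3) lx'(1) ly'(1) by blast
            then show "f \<in> ?N" using g(1) by blast
          qed
          have "packing_coloring (insert lt (E' \<union> ?N)) (c(lt := \<delta>))"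
          proof (rule packing_coloring_insert[OF c _ \<delta>(2)])
            have "lt \<notin> E'" using t' lt(1) by blast
            moreover have "lt \<notin> ?N" using nlt by blast
            ultimately show "lt \<notin> E' \<union> ?N" by blast
            show "\<delta> \<notin> c ` touching (E' \<union> ?N) lt"
              using \<delta>(3) image_mono[OF touch, of c] by auto
            show "\<delta> = 0 \<or> \<delta> \<notin> c ` near (E' \<union> ?N) lt"
              using \<delta>(3) image_mono[OF nr, of c] by blast
            show "c e = 0" if ef: "e \<in> touching (E' \<union> ?N) lt" "f \<in> touching (E' \<union> ?N) lt" "e \<noteq> f" "c e = c f" for e f
            proof -
              have "e \<in> {?lx, ?ly}" "f \<in> {?lx, ?ly}" using ef touch by blast+
              then have "e \<inter> f \<noteq> {}" "e \<in> E' \<union> ?N" "f \<in> E' \<union> ?N" by auto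
              then show ?thesis using packing_coloringD(2)[OF c, of e f] ef(3,4) by blast
            qed
          qed
          moreover have "E \<subseteq> insert lt (E' \<union> ?N)" unfolding E'_def by blast
          ultimately show ?thesis using packing_coloring_subset by blast
        qed
      qed
    qed
  qed
qed

theorem corollary2p7:
  fixes V :: "'a set" and E :: "'a set set"
  assumes "simple_graph V E"
    and "subcubic V E"
    and "outerplanar V E"
  shows "packing_edge_colorable (1 # replicate 5 2) E"
proof -
  \<comment> \<open>\<open>subcubic\<close> bounds the degrees on \<open>V\<close> only; elsewhere
    the degree is 0.\<close>
  have "vdegree E v \<le> 3" for v
  proof (cases "v \<in> V")
    case False
    then have "{e \<in> E. v \<in> e} = {}" using assms(1) by (auto simp: simple_graph_def)
    then show ?thesis unfolding vdegree_def by (metis card.empty le0)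
  qed (use assms(2) in \<open>simp add: subcubic_def\<close>)
  then obtain c where "packing_coloring E c"
    using subcubic_outerplanar_packing_coloring assms(1,3) by blast
  then show ?thesis by (rule packing_edge_colorableI)
qed

end
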